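(* Suppose $s>1$, $\frac{s+s^3}{2}>u>s$ and $v\in(0,u^{-1})$. Let $$a=\frac{v^{-1}(u-s^{-1})(u-s)}{u(v^{-1}-s^{-1})(v^{-1}-s)}>0$$ and suppose $\gamma>a$. Let $N=N(M)$ be a sequence of positive integers with $N(M)\ge\gamma\cdot M$ for all sufficiently large $M$, and consider the probability measure $\mathbb{P}_{u,v}^{N,M}$ on $\mathcal{P}_N$. Then for every $k\in\mathbb{N}$, $$\lim_{M\to\infty}\mathbb{P}_{u,v}^{N,M}\left(\{\omega\in\mathcal{P}_N:\ \lambda^N_{N-i+1}(\omega)=i,\ 1\le i\le k\}\right)=1.$$
   Context: Signatures: $\mathsf{Sign}_N^+$ is the set of integer sequences $\lambda_1\ge\dots\ge\lambda_N\ge0$. Path collections: let $D_N=\mathbb{Z}_{\ge0}\times\{1,\dots,N\}$. $\mathcal{P}_N$ is the set of collections $\omega$ of $N$ up-right lattice paths in $D_N$ such that a path enters each point $(0,m)$, $1\le m\le N$, through the horizontal arrow from $(-1,m)$, all paths exit through the top boundary, and no two paths share a horizontal or a vertical edge. For a vertex $(i,j)$, $\omega(i,j)=(i_1,j_1;i_2,j_2)$ records the numbers of arrows entering from below ($i_1$), entering from the left ($j_1$), leaving upwards ($i_2$) and leaving to the right ($j_2$). For $1\le k\le N$, $\lambda^k(\omega)=(\lambda_1^k\ge\dots\ge\lambda_k^k)$ is the ordered list of $x$-coordinates of the intersections of $\omega$ with the line $y=k+1/2$. Weights: put $q=s^{-2}$. For $g\in\mathbb{Z}_{\ge0}$ let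 $w_u(g,0;g,0)=\frac{1-sq^gu}{1-su}$, $w_u(g+1,0;g,1)=\frac{(1-s^2q^g)u}{1-su}$, $w_u(g,1;g,1)=\frac{u-sq^g}{1-su}$, $w_u(g,1;g+1,0)=\frac{1-q^{g+1}}{1-su}$; $w^c_u(g,0;g,0)=\frac{1-sq^gu}{1-su}$, $w^c_u(g+1,0;g,1)=\frac{(1-q^{g+1})u}{1-su}$, $w^c_u(g,1;g,1)=\frac{u-sq^g}{1-su}$, $w^c_u(g,1;g+1,0)=\frac{1-s^2q^{g}}{1-su}$; all other weights are $0$. For $\lambda,\nu\in\mathsf{Sign}_N^+$, $\mathsf{G}^c_{\lambda/\nu}(v_1,\dots,v_M)$ is the sum of $\prod_{i\ge0}\prod_{j=1}^M w^c_{v_j}(\omega'(i,j))$ over all collections $\omega'$ of $N$ up-right paths in $\mathbb{Z}_{\ge0}\times\{1,\dots,M\}$ starting with the vertical edges $(\nu_i,0)\to(\nu_i,1)$ and ending with the vertical edges $(\lambda_i,M)\to(\lambda_i,M+1)$, $1\le i\le N$ (vertical edges may be shared, horizontal ones may not). Measure: for $\lambda\in\mathsf{Sign}_N^+$ put $$f(\lambda)=(-1)^N\sum_{\nu_1>\nu_2>\dots>\nu_N\ge1}\ \prod_{j=1}^N(-s)^{\nu_j}\ \mathsf{G}^c_{\lambda/\nu}(v_1,\dots,v_M),\qquad \mathcal{W}(\omega)=\prod_{i=0}^\infty\prod_{j=1}^N w_{u_j}(\omega(i,j))\cdot f(\lambda^N(\omega)).$$ For $s>1$, $u_i>s$, $v_j>0$,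 $u_iv_j<1$ for all $i,j$, the weights $\mathcal{W}(\omega)$, $\omega\in\mathcal{P}_N$, are nonnegative with finite positive sum, and $\mathbb{P}_{\mathbf u,\mathbf v}(\omega)=\mathcal{W}(\omega)/\sum_{\omega'\in\mathcal{P}_N}\mathcal{W}(\omega')$. $\mathbb{P}_{u,v}^{N,M}$ is $\mathbb{P}_{\mathbf u,\mathbf v}$ with $u_1=\dots=u_N=u$ and $v_1=\dots=v_M=v$. *)

theory Defs
  imports "HOL-Analysis.Analysis"
begin

type_synonym point = "int \<times> int"
type_synonym edge = "point \<times> point"

text \<open>A collection of paths is identified with its arrow configuration: to every oriented lattice
  edge, the number of paths that use it. Collections that differ only in how the paths are
  continued at a common vertex are the same collection.\<close>

type_synonym config = "edge \<Rightarrow> nat"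

definition up_right :: "point list \<Rightarrow> bool" where
  "up_right p \<longleftrightarrow> (\<forall>n. Suc n < length p \<longrightarrow>
     (case p ! n of (x, y) \<Rightarrow> p ! Suc n = (x + 1, y) \<or> p ! Suc n = (x, y + 1)))"

definition path_edges :: "point list \<Rightarrow> edge set" where
  "path_edges p = set (zip p (tl p))"

definition horizontal_edges :: "point list \<Rightarrow> edge set" where
  "horizontal_edges p = {((x, y), (x', y')) \<in> path_edges p. y' = y}"

definition strip :: "nat \<Rightarrow> point set" where
  "strip N = {0..} \<times> {1..int N}"

text \<open>The first point \<open>a\<close> and the last point \<open>d\<close> lie outside the strip: the path enters the strip
  through the edge \<open>(a, b)\<close> and leaves it through the edge \<open>(c, d)\<close>.\<close>

definition strip_path :: "nat \<Rightarrow> edge \<Rightarrow> edge \<Rightarrow> point list \<Rightarrow> bool" where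
  "strip_path N e e' p \<longleftrightarrow> (case (e, e') of ((a, b), (c, d)) \<Rightarrow>
     up_right p \<and>
     (\<exists>r. p = a # r @ [d] \<and> r \<noteq> [] \<and> hd r = b \<and> last r = c \<and> set r \<subseteq> strip N))"

definition arrows :: "nat \<Rightarrow> (nat \<Rightarrow> point list) \<Rightarrow> config" where
  "arrows N p e = card {m \<in> {1..N}. e \<in> path_edges (p m)}"

definition path_collections :: "nat \<Rightarrow> config set" where
  "path_collections N = {arrows N p | p.
     (\<forall>m\<in>{1..N}. \<exists>x.
        strip_path N ((-1, int m), (0, int m)) ((x, int N), (x, int N + 1)) (p m)) \<and>
     disjoint_family_on (\<lambda>m. path_edges (p m)) {1..N}}"

text \<open>Integer sequences are lists; the parts are numbered from \<open>1\<close>.\<close>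

definition part :: "int list \<Rightarrow> nat \<Rightarrow> int" where
  "part lam i = lam ! (i - 1)"

definition Sign :: "nat \<Rightarrow> int list set" where
  "Sign N = {lam. length lam = N \<and> sorted_wrt (\<ge>) lam \<and> (\<forall>x\<in>set lam. 0 \<le> x)}"

text \<open>The intersections of the paths with the line \<open>y = k + 1/2\<close>. In a member of
  \<^term>\<open>path_collections N\<close> no vertical edge is shared, so the abscissae are distinct.\<close>

definition level :: "nat \<Rightarrow> config \<Rightarrow> int list" where
  "level k \<omega> = rev (sorted_list_of_set {x. 0 < \<omega> ((x, int k), (x, int k + 1))})"

text \<open>Arguments of the vertex weights are ordered as \<open>i\<^sub>1, j\<^sub>1, i\<^sub>2, j\<^sub>2\<close>: arrows entering from below,
  entering from the left, leaving upwards, leaving to the right.\<close>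

definition qpar :: "real \<Rightarrow> real" where
  "qpar s = s powi (-2)"

definition weight :: "real \<Rightarrow> real \<Rightarrow> nat \<times> nat \<times> nat \<times> nat \<Rightarrow> real" where
  "weight s u = (\<lambda>(i1, j1, i2, j2).
     if j1 = 0 \<and> j2 = 0 \<and> i1 = i2 then (1 - s * qpar s ^ i2 * u) / (1 - s * u)
     else if j1 = 0 \<and> j2 = 1 \<and> i1 = i2 + 1 then (1 - s\<^sup>2 * qpar s ^ i2) * u / (1 - s * u)
     else if j1 = 1 \<and> j2 = 1 \<and> i1 = i2 then (u - s * qpar s ^ i2) / (1 - s * u)
     else if j1 = 1 \<and> j2 = 0 \<and> i2 = i1 + 1 then (1 - qpar s ^ (i1 + 1)) / (1 - s * u)
     else 0)"

definition weight_c :: "real \<Rightarrow> real \<Rightarrow> nat \<times> nat \<times> nat \<times> nat \<Rightarrow> real" where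
  "weight_c s u = (\<lambda>(i1, j1, i2, j2).
     if j1 = 0 \<and> j2 = 0 \<and> i1 = i2 then (1 - s * qpar s ^ i2 * u) / (1 - s * u)
     else if j1 = 0 \<and> j2 = 1 \<and> i1 = i2 + 1 then (1 - qpar s ^ (i2 + 1)) * u / (1 - s * u)
     else if j1 = 1 \<and> j2 = 1 \<and> i1 = i2 then (u - s * qpar s ^ i2) / (1 - s * u)
     else if j1 = 1 \<and> j2 = 0 \<and> i2 = i1 + 1 then (1 - s\<^sup>2 * qpar s ^ i1) / (1 - s * u)
     else 0)"

definition vertex_type :: "config \<Rightarrow> int \<Rightarrow> int \<Rightarrow> nat \<times> nat \<times> nat \<times> nat" where
  "vertex_type \<omega> i j =
     (\<omega> ((i, j - 1), (i, j)), \<omega> ((i - 1, j), (i, j)),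
      \<omega> ((i, j), (i, j + 1)), \<omega> ((i, j), (i + 1, j)))"

text \<open>Path \<open>m\<close> is taken to run from \<open>\<nu>\<^sub>m\<close> to \<open>\<lambda>\<^sub>m\<close>. Any other matching of entries with exits gives
  the same arrow configurations, since paths can be uncrossed at common vertices.\<close>

definition skew_collections ::
    "nat \<Rightarrow> nat \<Rightarrow> int list \<Rightarrow> int list \<Rightarrow> config set" where
  "skew_collections N M lam nu = {arrows N p | p.
     (\<forall>m\<in>{1..N}. strip_path M ((part nu m, 0), (part nu m, 1))
        ((part lam m, int M), (part lam m, int M + 1)) (p m)) \<and>
     disjoint_family_on (\<lambda>m. horizontal_edges (p m)) {1..N}}"

definition Gc :: "real \<Rightarrow> nat \<Rightarrow> nat \<Rightarrow> (nat \<Rightarrow> real) \<Rightarrow> int list \<Rightarrow> int list \<Rightarrow> real" where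
  "Gc s N M v lam nu = (\<Sum>\<omega>\<in>skew_collections N M lam nu.
     \<Prod>i. \<Prod>j=1..M. weight_c s (v j) (vertex_type \<omega> (int i) (int j)))"

definition boundary_weight ::
    "real \<Rightarrow> nat \<Rightarrow> nat \<Rightarrow> (nat \<Rightarrow> real) \<Rightarrow> int list \<Rightarrow> real" where
  "boundary_weight s N M v lam = (-1) ^ N *
     (\<Sum>\<^sub>\<infinity>nu\<in>{nu \<in> Sign N. sorted_wrt (>) nu \<and> (\<forall>x\<in>set nu. 1 \<le> x)}.
        (\<Prod>j=1..N. (- s) powi (part nu j)) * Gc s N M v lam nu)"

definition config_weight ::
    "real \<Rightarrow> nat \<Rightarrow> nat \<Rightarrow> (nat \<Rightarrow> real) \<Rightarrow> (nat \<Rightarrow> real) \<Rightarrow> config \<Rightarrow> real" where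
  "config_weight s N M u v \<omega> =
     (\<Prod>i. \<Prod>j=1..N. weight s (u j) (vertex_type \<omega> (int i) (int j))) *
     boundary_weight s N M v (level N \<omega>)"

definition partition_function ::
    "real \<Rightarrow> nat \<Rightarrow> nat \<Rightarrow> (nat \<Rightarrow> real) \<Rightarrow> (nat \<Rightarrow> real) \<Rightarrow> real" where
  "partition_function s N M u v =
     (\<Sum>\<^sub>\<infinity>\<omega>\<in>path_collections N. config_weight s N M u v \<omega>)"

definition path_measure ::
    "real \<Rightarrow> nat \<Rightarrow> nat \<Rightarrow> (nat \<Rightarrow> real) \<Rightarrow> (nat \<Rightarrow> real) \<Rightarrow> config measure" where
  "path_measure s N M u v = point_measure (path_collections N)
     (\<lambda>\<omega>. ennreal (config_weight s N M u v \<omega> / partition_function s N M u v))"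

end

theory Submission
  imports Defs "HOL-Library.Nat_Bijection"
begin

text \<open>After a gauge transformation a \<open>u\<close>-row becomes a row of the stochastic six vertex model, acting by
  a Markov operator \<open>TT\<close> on functions of the occupied set of columns. A \<open>v\<close>-row, read from top to
  bottom with complemented horizontal arrows, becomes an operator \<open>DD\<close> of the same form, and
  \<open>TT \<circ> DD\<close> is a constant times \<open>DD \<circ> TT\<close> by the Yang--Baxter equation. The relations for the other
  horizontal boundary conditions yield a linear recursion for the probability \<open>Q n m\<close> that the first
  column is empty after \<open>n\<close> \<open>u\<close>-rows and \<open>m\<close> \<open>v\<close>-rows, from which \<open>Q n m \<le> x ^ n * V x ^ m\<close> for all
  \<open>x \<in> [\<beta>, 1]\<close>. As \<open>- V' 1 = a\<close> and \<open>V 1 = 1\<close>, this decays exponentially along \<open>n \<ge> \<gamma> m\<close> with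
  \<open>\<gamma> > a\<close>. Finally, if the first \<open>k\<close> columns are not all occupied, one can move their arrows so that
  the first column becomes empty; the weights change only by a constant times \<open>(1 + \<epsilon>) ^ (n + m)\<close>,
  so the probability that the first \<open>k\<close> columns are not all occupied decays as well.\<close>

text \<open>The relation \<open>s\<^sup>2 * qpar s = 1\<close> kills the v-vertex at which two
  arrows meet and both leave upwards, so the v-rows, like the u-rows, act on sets of columns.
  Complementing the horizontal arrows of a v-row turns "no arrow enters from the left" into "an
  arrow enters", as in a u-row; the parameter then enters through 1/v, and the signs and powers of s
  cancel between the two kinds of rows and the sum over nu. That sum becomes a power of
  \<open>DD\<close> applied to an indicator.

  Commutation alone yields the total mass only. The event of an empty first column is accessible as
  well because an occupied first column stays occupied when an arrow enters from the left, so
  restriction to sets avoiding it is compatible with both operators. For several columns no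
  recursion is derived. Instead the strict inequality \<gamma> > a leaves an exponential margin, and
  the comparison with one column costs an arbitrarily small exponential rate, which that margin
  absorbs.\<close>

subsection \<open>Rows of the stochastic six vertex model\<close>

text \<open>A finite set of occupied columns is encoded by the number whose binary digits are its
  indicator. In \<open>row_weight w e i A C\<close> the horizontal arrow enters from the left in state \<open>i\<close> and is
  in state \<open>e\<close> far to the right.\<close>

type_synonym vertex_weight = "bool \<Rightarrow> bool \<Rightarrow> bool \<Rightarrow> bool \<Rightarrow> real"

function row_weight :: "vertex_weight \<Rightarrow> bool \<Rightarrow> bool \<Rightarrow> nat \<Rightarrow> nat \<Rightarrow> real" where
  "row_weight w e i A C = (if A = 0 \<and> C = 0 then of_bool (i = e) else
     w (odd A) i (odd C) False * row_weight w e False (A div 2) (C div 2) +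
     w (odd A) i (odd C) True * row_weight w e True (A div 2) (C div 2))"
  by pat_completeness auto
termination
  by (relation "Wellfounded.measure (\<lambda>(w, e, i, A, C). A + C)") auto

declare row_weight.simps [simp del]

lemma card_set_decode_rec: "card (set_decode A) = of_bool (odd A) + card (set_decode (A div 2))"
proof -
  have "set_decode A = (if odd A then {0} else {}) \<union> Suc ` set_decode (A div 2)"
    by (auto simp: set_decode_0 set_decode_Suc image_iff elim: nat.exhaust)
      (metis nat.exhaust set_decode_0 set_decode_Suc)+
  then show ?thesis
    by (simp add: card_image card_insert_if image_iff)
qed

text \<open>The ice rule together with a normalisation: in state \<open>e\<close> the horizontal
  arrow crosses empty columns at no cost, so the infinitely many columns on the right contribute the
  factor 1.\<close>

locale ice =
  fixes w :: vertex_weight and e :: bool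
  assumes nonneg: "0 \<le> w a i c j"
    and conserve: "w a i c j \<noteq> 0 \<Longrightarrow> of_bool a + of_bool i = (of_bool c + of_bool j :: nat)"
    and vacuum: "w False e False e = 1"
begin

text \<open>The recursion persists at A = C = 0, where \<open>row_weight\<close> is set by hand:
  conservation leaves only the straight crossing, and \<open>vacuum\<close> gives it weight 1 in the
  state \<open>e\<close>. Later inductions need no separate treatment of this case.\<close>

lemma row_rec:
  "row_weight w e i A C = w (odd A) i (odd C) False * row_weight w e False (A div 2) (C div 2) +
     w (odd A) i (odd C) True * row_weight w e True (A div 2) (C div 2)"
proof (cases "A = 0 \<and> C = 0")
  case True
  have z: "row_weight w e k 0 0 = of_bool (k = e)" for k
    by (simp add: row_weight.simps)
  have "w False i False j = 0" if "j \<noteq> i" for j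
    using conserve[of False i False j] that by (cases i; cases j; auto)
  then show ?thesis
    using True vacuum z by (cases i; cases e) simp_all
next
  case False
  show ?thesis
    unfolding row_weight.simps[of w e i A C] if_not_P[OF False] ..
qed

lemma row_zero: "row_weight w e i 0 0 = of_bool (i = e)"
  by (simp add: row_weight.simps)

lemma row_nonneg: "0 \<le> row_weight w e i A C"
proof (induction "A + C" arbitrary: i A C rule: less_induct)
  case less
  show ?case
  proof (cases "A = 0 \<and> C = 0")
    case False
    then have lt: "A div 2 + C div 2 < A + C" by presburger
    have "0 \<le> row_weight w e k (A div 2) (C div 2)" for k
      by (rule less) (rule lt)
    then show ?thesis
      unfolding row_rec[of i A C] by (intro add_nonneg_nonneg mult_nonneg_nonneg nonneg)
  qed (simp add: row_zero)
qed

lemma row_card: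
  "row_weight w e i A C \<noteq> 0 \<Longrightarrow>
    card (set_decode A) + of_bool i = card (set_decode C) + of_bool e"
proof (induction "A + C" arbitrary: i A C rule: less_induct)
  case less
  show ?case
  proof (cases "A = 0 \<and> C = 0")
    case True
    then show ?thesis using less.prems by (auto simp: row_zero)
  next
    case False
    have lt: "A div 2 + C div 2 < A + C" using False by presburger
    obtain j where j: "w (odd A) i (odd C) j \<noteq> 0" "row_weight w e j (A div 2) (C div 2) \<noteq> 0"
      using less.prems unfolding row_rec[of i A C]
      by (metis add.right_neutral mult_zero_left mult_zero_right)
    then show ?thesis
      using conserve[OF j(1)] less.hyps[OF lt j(2)]
        card_set_decode_rec[of A] card_set_decode_rec[of C] by simp
  qed
qed

end

text \<open>Two rows on top of each other; \<open>z\<close> is the value far to the right, where both boundary states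
  are empty.\<close>

function two_rows :: "vertex_weight \<Rightarrow> vertex_weight \<Rightarrow> (bool \<Rightarrow> bool \<Rightarrow> real) \<Rightarrow>
    bool \<Rightarrow> bool \<Rightarrow> nat \<Rightarrow> nat \<Rightarrow> real" where
  "two_rows w w' z i j A B = (if A = 0 \<and> B = 0 then z i j else
     (\<Sum>c\<in>UNIV. \<Sum>k\<in>UNIV. \<Sum>l\<in>UNIV.
        w (odd A) i c k * w' c j (odd B) l * two_rows w w' z k l (A div 2) (B div 2)))"
  by pat_completeness auto
termination
  by (relation "Wellfounded.measure (\<lambda>(w, w', z, i, j, A, B). A + B)") auto

declare two_rows.simps [simp del]

lemma sums_even_odd:
  fixes f :: "nat \<Rightarrow> real"
  assumes "(\<lambda>n. f (2 * n)) sums a" "(\<lambda>n. f (2 * n + 1)) sums b"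
  shows "f sums (a + b)"
proof -
  have "(\<lambda>n. if even n then f (2 * (n div 2)) else f (2 * ((n - 1) div 2) + 1)) sums (b + a)"
    by (rule sums_if[OF assms(2) assms(1)])
  moreover have "(\<lambda>n. if even n then f (2 * (n div 2)) else f (2 * ((n - 1) div 2) + 1)) = f"
    by (rule ext) simp
  ultimately show ?thesis by (simp add: add.commute)
qed

text \<open>The sum runs over the set C between the two rows. Splitting C by its lowest digit peels
  off one column; \<open>base\<close> is needed because C may still have arrows to the right of
  everything in A and B.\<close>

lemma two_rows_sums:
  assumes "ice w e" "ice w' e'"
    and base: "\<And>i j. (\<lambda>C. row_weight w e i 0 C * row_weight w' e' j C 0) sums z i j"
  shows "(\<lambda>C. row_weight w e i A C * row_weight w' e' j C B) sums two_rows w w' z i j A B"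
proof (induction "A + B" arbitrary: i j A B rule: less_induct)
  case less
  interpret I: ice w e by fact
  interpret I': ice w' e' by fact
  show ?case
  proof (cases "A = 0 \<and> B = 0")
    case True
    then show ?thesis using base[of i j] by (simp add: two_rows.simps[of w w' z i j 0 0])
  next
    case False
    let ?A = "A div 2" and ?B = "B div 2"
    let ?g = "\<lambda>c. (\<Sum>k\<in>UNIV. \<Sum>l\<in>UNIV.
        w (odd A) i c k * w' c j (odd B) l * two_rows w w' z k l ?A ?B)"
    have IH: "(\<lambda>C. row_weight w e k ?A C * row_weight w' e' l C ?B) sums two_rows w w' z k l ?A ?B" for k l
      by (rule less) (use False in presburger)
    have "(\<lambda>C. row_weight w e i A (2 * C + of_bool c) * row_weight w' e' j (2 * C + of_bool c) B) sums ?g c" for c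
    proof -
      have "(\<lambda>C. \<Sum>k\<in>UNIV. \<Sum>l\<in>UNIV. w (odd A) i c k * w' c j (odd B) l *
          (row_weight w e k ?A C * row_weight w' e' l C ?B)) sums ?g c"
        by (intro sums_sum sums_mult IH)
      moreover have "row_weight w e i A (2 * C + of_bool c) * row_weight w' e' j (2 * C + of_bool c) B =
         (\<Sum>k\<in>UNIV. \<Sum>l\<in>UNIV. w (odd A) i c k * w' c j (odd B) l *
          (row_weight w e k ?A C * row_weight w' e' l C ?B))" for C
        unfolding I.row_rec[of i A] I'.row_rec[of j "2 * C + of_bool c"]
        by (simp add: UNIV_bool algebra_simps)
      ultimately show ?thesis by simp
    qed
    from this[of False] this[of True]
    have "(\<lambda>C. row_weight w e i A C * row_weight w' e' j C B) sums (?g False + ?g True)"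
      by (intro sums_even_odd) simp_all
    moreover have "two_rows w w' z i j A B = ?g False + ?g True"
      unfolding two_rows.simps[of w w' z i j A B] if_not_P[OF False] by (simp add: UNIV_bool)
    ultimately show ?thesis by simp
  qed
qed

text \<open>Arguments: below, left, above, right. For each incoming pair the outgoing weights add up
  to 1: a horizontal arrow crosses an empty column with probability b, and a vertical arrow meeting
  no horizontal one continues upwards with probability q * b.\<close>

definition wT :: "real \<Rightarrow> real \<Rightarrow> vertex_weight" where
  "wT q b a i c j =
     (if a \<and> i \<and> c \<and> j \<or> \<not> a \<and> \<not> i \<and> \<not> c \<and> \<not> j then 1
      else if a \<and> \<not> i \<and> c \<and> \<not> j then q * b
      else if a \<and> \<not> i \<and> \<not> c \<and> j then 1 - q * b
      else if \<not> a \<and> i \<and> \<not> c \<and> j then b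
      else if \<not> a \<and> i \<and> c \<and> \<not> j then 1 - b
      else 0)"

lemma wT_simps [simp]:
  "wT q b True True True True = 1"
  "wT q b True True True False = 0"
  "wT q b True True False True = 0"
  "wT q b True True False False = 0"
  "wT q b True False True True = 0"
  "wT q b True False True False = q * b"
  "wT q b True False False True = 1 - q * b"
  "wT q b True False False False = 0"
  "wT q b False True True True = 0"
  "wT q b False True True False = 1 - b"
  "wT q b False True False True = b"
  "wT q b False True False False = 0"
  "wT q b False False True True = 0"
  "wT q b False False True False = 0"
  "wT q b False False False True = 0"
  "wT q b False False False False = 1"
  by (simp_all add: wT_def)

text \<open>The division by \<open>b\<close> gives weight 1 to a horizontal arrow over empty columns, of which there are
  infinitely many.\<close>

definition wD :: "real \<Rightarrow> real \<Rightarrow> vertex_weight" where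
  "wD q b a i c j = wT q b a i c j / b"

text \<open>The strict inequality \<open>\<beta> < \<beta>'\<close> makes the sum over the set
  between a T-row and a following D-row converge; it contains a geometric series of ratio
  \<open>\<beta> / \<beta>'\<close>.\<close>

locale commuting_rows =
  fixes q \<beta> \<beta>' :: real
  assumes q: "0 < q" "q < 1" and b: "0 < \<beta>" "\<beta> < \<beta>'" "\<beta>' < 1"
begin

lemma qb: "q * \<beta> < 1" "q * \<beta>' < 1"
proof -
  have "q * x < 1" if "0 < x" "x < 1" for x
    using q that mult_strict_mono[of q 1 x 1] by simp
  then show "q * \<beta> < 1" "q * \<beta>' < 1" using b by auto
qed

lemma ice_wT: "0 \<le> x \<Longrightarrow> x \<le> 1 \<Longrightarrow> q * x \<le> 1 \<Longrightarrow> 0 \<le> wT q x a i c j"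
  using q by (cases a; cases i; cases c; cases j; simp add: wT_def)

lemma conserve_wT: "wT q x a i c j \<noteq> 0 \<Longrightarrow> of_bool a + of_bool i = (of_bool c + of_bool j :: nat)"
  by (cases a; cases i; cases c; cases j; simp add: wT_def)

sublocale T: ice "wT q \<beta>" False
proof
  show "0 \<le> wT q \<beta> a i c j" for a i c j
    using b qb by (intro ice_wT) auto
qed (fact conserve_wT, simp add: wT_def)

sublocale D: ice "wD q \<beta>'" True
proof
  show "0 \<le> wD q \<beta>' a i c j" for a i c j
    unfolding wD_def using b qb by (intro divide_nonneg_nonneg ice_wT) auto
  show "of_bool a + of_bool i = (of_bool c + of_bool j :: nat)" if "wD q \<beta>' a i c j \<noteq> 0" for a i c j
    using that conserve_wT[of \<beta>' a i c j] by (auto simp: wD_def)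
  show "wD q \<beta>' False True False True = 1" using b by (simp add: wD_def wT_def)
qed

abbreviation "T \<equiv> row_weight (wT q \<beta>) False"
abbreviation "D \<equiv> row_weight (wD q \<beta>') True"

text \<open>Together with 1 and q these are the weights of the cross vertex in the Yang--Baxter
  equation: \<open>Pf\<close> for equal horizontal states, \<open>r\<close> and \<open>r'\<close>
  for exchanged ones. The normalisation gives weight 1 to an empty T-row and a full D-row, the
  states far to the right.\<close>

definition Pf :: real where "Pf = (1 - (1 + q) * \<beta> + q * \<beta> * \<beta>') / (\<beta>' - \<beta>)"
definition r :: real where "r = (1 - \<beta>) * (1 - q * \<beta>') / (\<beta>' - \<beta>)"
definition r' :: real where "r' = (1 - \<beta>') * (1 - q * \<beta>) / (\<beta>' - \<beta>)"

text \<open>The value \<open>r\<close> belongs to an arrow that enters the T-row, turns up in some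
  empty column and leaves through the D-row; it is the sum over all such columns.\<close>

definition TD_far :: "bool \<Rightarrow> bool \<Rightarrow> real" where
  "TD_far i j = (if j then of_bool (\<not> i) else if i then r else 0)"
definition DT_far :: "bool \<Rightarrow> bool \<Rightarrow> real" where
  "DT_far j i = of_bool (j \<and> \<not> i)"

abbreviation "TD \<equiv> two_rows (wT q \<beta>) (wD q \<beta>') TD_far"
abbreviation "DT \<equiv> two_rows (wD q \<beta>') (wT q \<beta>) DT_far"

text \<open>The cross vertex is pulled through one column at a time. Each step is a finite identity
  between vertex weights, checked for the four parities of A and B; the induction starts far to the
  right, where the constants were normalised. In \<open>TD\<close> the state of the T-row comes
  first, in \<open>DT\<close> that of the D-row.\<close>

lemma ybe:
  "TD False False A B = Pf * DT False False A B \<and>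
   TD False True A B = DT True False A B + r' * DT False True A B \<and>
   TD True False A B = r * DT True False A B + q * DT False True A B \<and>
   TD True True A B = Pf * DT True True A B"
proof (induction "A + B" arbitrary: A B rule: less_induct)
  case less
  have ne: "\<beta>' - \<beta> \<noteq> 0" "\<beta>' \<noteq> 0" "\<beta>' \<noteq> \<beta>" using b by auto
  define x where "x i j = DT j i (A div 2) (B div 2)" for i j
  show ?case
  proof (cases "A = 0 \<and> B = 0")
    case True
    then show ?thesis
      by (simp add: two_rows.simps[of _ _ _ _ _ 0 0] TD_far_def DT_far_def)
  next
    case False
    have lt: "A div 2 + B div 2 < A + B" using False by presburger
    have IH: "TD False False (A div 2) (B div 2) = Pf * x False False"
      "TD False True (A div 2) (B div 2) = x False True + r' * x True False"
      "TD True False (A div 2) (B div 2) = r * x False True + q * x True False"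
      "TD True True (A div 2) (B div 2) = Pf * x True True"
      using less[OF lt] unfolding x_def by auto
    note exps = two_rows.simps[of _ _ _ _ _ A B]
    show ?thesis
      unfolding exps if_not_P[OF False] UNIV_bool
      apply (cases "odd A"; cases "odd B";
          simp add: IH x_def[symmetric] wD_def)
      apply (simp_all add: Pf_def r_def r'_def ne divide_simps)
      apply (simp_all add: algebra_simps)
      done
  qed
qed

end

subsection \<open>Commutation of the transfer operators\<close>

text \<open>Values in \<open>ennreal\<close> make every interchange of sums legitimate. The price is
  the absence of subtraction, so that operator identities are written with nonnegative terms on both
  sides.\<close>

definition transfer :: "(nat \<Rightarrow> nat \<Rightarrow> real) \<Rightarrow> (nat \<Rightarrow> ennreal) \<Rightarrow> nat \<Rightarrow> ennreal" where
  "transfer K g A = (\<integral>\<^sup>+C. ennreal (K A C) * g C \<partial>count_space UNIV)"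

lemma nn_integral_even_odd:
  fixes f :: "nat \<Rightarrow> ennreal"
  shows "(\<integral>\<^sup>+C. f C \<partial>count_space UNIV) =
    (\<integral>\<^sup>+C. f (2 * C) \<partial>count_space UNIV) + (\<integral>\<^sup>+C. f (2 * C + 1) \<partial>count_space UNIV)"
proof -
  have U: "(UNIV :: nat set) = range (\<lambda>C. 2 * C) \<union> range (\<lambda>C. 2 * C + 1)"
    by (auto simp: image_iff) presburger
  let ?E = "range (\<lambda>C::nat. 2 * C)" and ?O = "range (\<lambda>C::nat. 2 * C + 1)"
  have "?E \<inter> ?O = {}"
    by (auto, presburger)
  then have "f C = f C * indicator ?E C + f C * indicator ?O C" for C
    using U UNIV_I[of C] by (auto simp: indicator_def)
  then have "(\<integral>\<^sup>+C. f C \<partial>count_space UNIV) =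
      (\<integral>\<^sup>+C. f C * indicator ?E C + f C * indicator ?O C \<partial>count_space UNIV)"
    by presburger
  then have "(\<integral>\<^sup>+C. f C \<partial>count_space UNIV) =
      (\<integral>\<^sup>+C. f C \<partial>count_space ?E) + (\<integral>\<^sup>+C. f C \<partial>count_space ?O)"
    by (simp add: nn_integral_add nn_integral_count_space_indicator)
  moreover have "(\<integral>\<^sup>+C. f C \<partial>count_space (range h)) = (\<integral>\<^sup>+C. f (h C) \<partial>count_space UNIV)"
    if "inj h" for h :: "nat \<Rightarrow> nat"
    using that by (intro nn_integral_bij_count_space[symmetric] inj_on_imp_bij_betw)
  ultimately show ?thesis by (simp add: inj_def)
qed

lemma transfer_add: "transfer K (\<lambda>C. f C + g C) A = transfer K f A + transfer K g A"
  by (simp add: transfer_def distrib_left nn_integral_add)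

lemma transfer_cmult: "transfer K (\<lambda>C. c * g C) A = c * transfer K g A"
  by (simp add: transfer_def nn_integral_cmult[symmetric] ac_simps)

lemma transfer_zero: "transfer K (\<lambda>C. 0) A = 0"
  by (simp add: transfer_def)

lemma transfer_zero_fun: "transfer K (\<lambda>C. 0) = (\<lambda>C. 0)"
  by (simp add: fun_eq_iff transfer_zero)

lemma transfer_mono: "(\<And>C. f C \<le> g C) \<Longrightarrow> transfer K f A \<le> transfer K g A"
  by (auto simp: transfer_def intro!: nn_integral_mono mult_left_mono)

lemma nn_integral_sums:
  fixes f :: "nat \<Rightarrow> real"
  assumes "f sums x" "\<And>n. 0 \<le> f n"
  shows "(\<integral>\<^sup>+n. ennreal (f n) \<partial>count_space UNIV) = ennreal x"
  unfolding nn_integral_count_space_nat using assms by (intro suminf_ennreal_eq)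

lemma transfer_transfer:
  assumes K: "\<And>A C. 0 \<le> K A C" "\<And>A C. 0 \<le> K' A C"
    and sums: "\<And>B. (\<lambda>C. K A C * K' C B) sums L B"
  shows "transfer K (transfer K' g) A = (\<integral>\<^sup>+B. ennreal (L B) * g B \<partial>count_space UNIV)"
proof -
  let ?h = "\<lambda>(C, B). ennreal (K A C * K' C B) * g B"
  have "transfer K (transfer K' g) A =
      (\<integral>\<^sup>+C. \<integral>\<^sup>+B. ?h (C, B) \<partial>count_space UNIV \<partial>count_space UNIV)"
    unfolding transfer_def using K
    by (simp add: nn_integral_cmult[symmetric] ennreal_mult mult.assoc)
  also have "\<dots> = (\<integral>\<^sup>+B. \<integral>\<^sup>+C. ?h (C, B) \<partial>count_space UNIV \<partial>count_space UNIV)"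
    by (subst nn_integral_fst_count_space) (subst nn_integral_snd_count_space, simp)
  also have "\<dots> = (\<integral>\<^sup>+B. (\<integral>\<^sup>+C. ennreal (K A C * K' C B) \<partial>count_space UNIV) * g B \<partial>count_space UNIV)"
    by (simp add: nn_integral_multc)
  also have "\<dots> = (\<integral>\<^sup>+B. ennreal (L B) * g B \<partial>count_space UNIV)"
    using K by (subst nn_integral_sums[OF sums]) simp_all
  finally show ?thesis .
qed

text \<open>The two rules force f to vanish off the powers of two, with f (2 ^ j) = k * \<rho> ^ j.
  Powers of two are the codes of single columns, and the series is geometric in the position of that
  column.\<close>

lemma doubling_sums:
  fixes f :: "nat \<Rightarrow> real"
  assumes \<rho>: "0 \<le> \<rho>" "\<rho> < 1" and k: "0 \<le> k" and nonneg: "\<And>n. 0 \<le> f n"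
    and even: "\<And>n. f (2 * n) = \<rho> * f n" and odd: "\<And>n. f (2 * n + 1) = k * of_bool (n = 0)"
  shows "f sums (k / (1 - \<rho>))"
proof -
  have f0: "f 0 = 0" using even[of 0] \<rho> by simp
  have eo: "(\<Sum>i<2 * m. f i) = (\<Sum>i<m. f (2 * i)) + (\<Sum>i<m. f (2 * i + 1))" for m
    by (induction m) auto
  have part: "(\<Sum>i<2 ^ n. f i) = k * (1 - \<rho> ^ n) / (1 - \<rho>)" for n
  proof (induction n)
    case 0
    then show ?case by (simp add: f0)
  next
    case (Suc n)
    have "(\<Sum>i<2 ^ n. f (2 * i + 1)) = (\<Sum>i\<in>{0}. f (2 * i + 1))"
      by (rule sum.mono_neutral_right) (auto simp: odd[simplified])
    then have "(\<Sum>i<2 ^ Suc n. f i) = \<rho> * (\<Sum>i<2 ^ n. f i) + k"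
      using odd[of 0] by (simp add: eo[of "2 ^ n", simplified] even sum_distrib_left)
    then show ?case using Suc \<rho> by (simp add: divide_simps) (simp add: algebra_simps)
  qed
  have bound: "(\<Sum>i<n. f i) \<le> k / (1 - \<rho>)" for n
  proof -
    have "n \<le> 2 ^ n" by (simp add: less_imp_le)
    then have "(\<Sum>i<n. f i) \<le> (\<Sum>i<2 ^ n. f i)" by (intro sum_mono2) (use nonneg in auto)
    also have "\<dots> \<le> k / (1 - \<rho>)"
      unfolding part using \<rho> k by (intro divide_right_mono) (auto intro!: mult_left_le)
    finally show ?thesis .
  qed
  have summ: "summable f"
    by (rule summableI_nonneg_bounded[OF nonneg bound])
  have "(\<lambda>n. \<Sum>i<2 ^ n. f i) \<longlonglongrightarrow> suminf f"
    using LIMSEQ_subseq_LIMSEQ[OF summable_LIMSEQ[OF summ], of "\<lambda>n. 2 ^ n"]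
    by (simp add: o_def strict_mono_def)
  moreover have "(\<lambda>n. \<Sum>i<2 ^ n. f i) \<longlonglongrightarrow> k * (1 - 0) / (1 - \<rho>)"
    unfolding part using \<rho> by (intro tendsto_intros LIMSEQ_realpow_zero) auto
  ultimately have "suminf f = k / (1 - \<rho>)" by (simp add: LIMSEQ_unique)
  with summ show ?thesis by (metis summable_sums)
qed

text \<open>When the far state is full, missing horizontal arrows carry vertical ones to the left,
  so the code cannot increase. Columnwise this is the carry rule of binary addition. For the D-rows
  it leaves finitely many successors of each set.\<close>

lemma row_triangular:
  assumes w: "\<And>a i c j. w a i c j \<noteq> 0 \<Longrightarrow> of_bool a + of_bool i = (of_bool c + of_bool j :: nat)"
    and "row_weight w True i A C \<noteq> 0"
  shows "C + of_bool (\<not> i) \<le> A"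
  using assms(2)
proof (induction "A + C" arbitrary: i A C rule: less_induct)
  case less
  show ?case
  proof (cases "A = 0 \<and> C = 0")
    case True
    then show ?thesis using less.prems by (simp add: row_weight.simps[of _ _ _ 0 0])
  next
    case False
    have lt: "A div 2 + C div 2 < A + C" using False by presburger
    obtain j where j: "w (odd A) i (odd C) j \<noteq> 0" "row_weight w True j (A div 2) (C div 2) \<noteq> 0"
      using less.prems False unfolding row_weight.simps[of w True i A C] if_not_P[OF False]
      by (metis add.right_neutral mult_zero_left mult_zero_right)
    have 1: "C div 2 + of_bool (\<not> j) \<le> A div 2"
      by (rule less.hyps[OF lt j(2)])
    have 2: "of_bool (odd A) + of_bool i = (of_bool (odd C) + of_bool j :: nat)"
      by (rule w[OF j(1)])
    have "A = 2 * (A div 2) + of_bool (odd A)" "C = 2 * (C div 2) + of_bool (odd C)"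
      by simp_all
    then show ?thesis
      using 1 2 by (cases i; cases j; simp split: if_splits)
  qed
qed

context commuting_rows begin

abbreviation "t i \<equiv> transfer (T i)"
abbreviation "d i \<equiv> transfer (D i)"

lemma T_False_0: "T False 0 C = of_bool (C = 0)"
proof (cases "T False 0 C = 0")
  case True
  then show ?thesis by (cases "C = 0") (auto simp: T.row_zero)
next
  case False
  then have "set_decode C = {}" using T.row_card[of False 0 C] by simp
  then have "C = 0" by (metis set_decode_inverse set_encode_empty)
  then show ?thesis by (simp add: T.row_zero)
qed

lemma D_True_0: "D True C 0 = of_bool (C = 0)"
proof (cases "D True C 0 = 0")
  case True
  then show ?thesis by (cases "C = 0") (auto simp: D.row_zero)
next
  case False
  then have "set_decode C = {}" using D.row_card[of True C 0] by simp
  then have "C = 0" by (metis set_decode_inverse set_encode_empty)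
  then show ?thesis by (simp add: D.row_zero)
qed

lemma D_zero: "D i 0 C = of_bool (i \<and> C = 0)"
proof (cases "D i 0 C = 0")
  case True
  then show ?thesis by (cases "C = 0") (auto simp: D.row_zero)
next
  case False
  then have "C + of_bool (\<not> i) \<le> 0" by (intro row_triangular[OF D.conserve]) auto
  then show ?thesis by (simp add: D.row_zero split: if_splits)
qed

lemma T_True_0_even: "T True 0 (2 * C) = \<beta> * T True 0 C"
  and T_True_0_odd: "T True 0 (2 * C + 1) = (1 - \<beta>) * of_bool (C = 0)"
  using T.row_rec[of True 0 "2 * C"] T.row_rec[of True 0 "2 * C + 1"]
  by (simp_all add: T_False_0)

text \<open>The outgoing weights of each vertex add up to 1, and a horizontal arrow beyond the last
  occupied column eventually turns up because \<open>\<beta> < 1\<close>; hence \<open>TT\<close> is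
  a Markov operator. The case A = 0 is the geometric series, the rest follows column by
  column.\<close>

lemma T_sums: "(\<lambda>C. T i A C) sums 1"
proof (induction A arbitrary: i rule: less_induct)
  case (less A)
  show ?case
  proof (cases "A = 0")
    case True
    have "(\<lambda>C. T True 0 C) sums ((1 - \<beta>) / (1 - \<beta>))"
      by (rule doubling_sums[where \<rho> = \<beta>])
        (use b T.row_nonneg T_True_0_even T_True_0_odd in auto)
    moreover have "(\<lambda>C. T False 0 C) sums 1"
      unfolding T_False_0 using sums_single[of 0 "\<lambda>_. 1::real"] by (simp add: of_bool_def)
    ultimately show ?thesis using True b by (cases i) auto
  next
    case False
    then have IH: "(\<lambda>C. T j (A div 2) C) sums 1" for j by (intro less) simp
    have s: "(\<lambda>C. T i A (2 * C + of_bool c)) sums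
        (wT q \<beta> (odd A) i c False * 1 + wT q \<beta> (odd A) i c True * 1)" for c
    proof -
      have "T i A (2 * C + of_bool c) = wT q \<beta> (odd A) i c False * T False (A div 2) C +
          wT q \<beta> (odd A) i c True * T True (A div 2) C" for C
        using T.row_rec[of i A "2 * C + of_bool c"] by simp
      then show ?thesis by (simp only:) (intro sums_add sums_mult IH)
    qed
    have "(\<lambda>C. T i A C) sums
       ((wT q \<beta> (odd A) i False False * 1 + wT q \<beta> (odd A) i False True * 1) +
        (wT q \<beta> (odd A) i True False * 1 + wT q \<beta> (odd A) i True True * 1))"
      using sums_even_odd[of "T i A"] s[of False] s[of True] by simp
    then show ?thesis
      by (cases "odd A"; cases i; simp)
  qed
qed

lemma TD_sums: "(\<lambda>C. T i A C * D j C B) sums TD i j A B"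
proof (rule two_rows_sums)
  show "(\<lambda>C. T i 0 C * D j C 0) sums TD_far i j" for i j
  proof (cases i)
    case False
    have "(\<lambda>C. T i 0 C * D j C 0) = (\<lambda>C. if C = 0 then of_bool j else 0)"
      using False by (auto simp: T_False_0 D.row_zero fun_eq_iff)
    then show ?thesis
      using False sums_single[of 0 "\<lambda>_. of_bool j :: real"] by (cases j; simp add: TD_far_def)
  next
    case True
    show ?thesis
    proof (cases j)
      case True
      have "T i 0 C * D j C 0 = 0" for C
        using True \<open>i\<close> by (cases "C = 0") (simp_all add: D_True_0 T.row_zero)
      then have "(\<lambda>C. T i 0 C * D j C 0) = (\<lambda>_. 0)" by (rule ext)
      then show ?thesis using True \<open>i\<close> by (simp add: TD_far_def)
    next
      case False
      \<comment> \<open>The arrow rises in column j with probability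
        \<open>(1 - \<beta>) * \<beta> ^ j\<close>; the D-row then pays \<open>1 / \<beta>'\<close>
        for each of j empty columns and \<open>(1 - q * \<beta>') / \<beta>'\<close> for the
        turn.\<close>
      have "(\<lambda>C. T True 0 C * D False C 0) sums
          ((1 - \<beta>) * ((1 - q * \<beta>') / \<beta>') / (1 - \<beta> / \<beta>'))"
      proof (rule doubling_sums)
        have e: "D False (2 * C) 0 = D False C 0 / \<beta>'" for C
          using D.row_rec[of False "2 * C" 0] by (simp add: wD_def)
        have o: "D False (2 * C + 1) 0 = (1 - q * \<beta>') / \<beta>' * D True C 0" for C
          using D.row_rec[of False "2 * C + 1" 0] by (simp add: wD_def)
        show "T True 0 (2 * C) * D False (2 * C) 0 = \<beta> / \<beta>' * (T True 0 C * D False C 0)" for C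
          by (simp add: T_True_0_even e)
        show "T True 0 (2 * C + 1) * D False (2 * C + 1) 0 =
          (1 - \<beta>) * ((1 - q * \<beta>') / \<beta>') * of_bool (C = 0)" for C
          unfolding T_True_0_odd o by (cases "C = 0") (simp_all add: D_True_0)
        show "0 \<le> T True 0 C * D False C 0" for C
          by (intro mult_nonneg_nonneg T.row_nonneg D.row_nonneg)
      qed (use b qb in auto)
      moreover have "(1 - \<beta>) * ((1 - q * \<beta>') / \<beta>') / (1 - \<beta> / \<beta>') = r"
        using b by (simp add: r_def field_simps)
      ultimately show ?thesis using False \<open>i\<close> by (simp add: TD_far_def)
    qed
  qed
qed unfold_locales

lemma DT_sums: "(\<lambda>C. D j A C * T i C B) sums DT j i A B"
proof (rule two_rows_sums)
  show "(\<lambda>C. D j 0 C * T i C 0) sums DT_far j i" for i j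
  proof -
    have "(\<lambda>C. D j 0 C * T i C 0) = (\<lambda>C. if C = 0 then of_bool (j \<and> \<not> i) else 0)"
      by (auto simp: D_zero T.row_zero fun_eq_iff)
    then show ?thesis
      using sums_single[of 0 "\<lambda>_. of_bool (j \<and> \<not> i) :: real"] by (auto simp: DT_far_def)
  qed
qed unfold_locales

end

text \<open>The lowest digit belongs to the first column, so this is restriction to the sets that
  avoid it.\<close>

definition ev :: "(nat \<Rightarrow> ennreal) \<Rightarrow> nat \<Rightarrow> ennreal" where
  "ev g C = (if even C then g C else 0)"

text \<open>Stated in a semiring because it is applied in \<open>ennreal\<close>, where terms cannot
  be cancelled.\<close>

lemma four_term_identity:
  fixes b k r m c :: "'a :: comm_semiring"
  assumes "b * k * r = m * c"
  shows "b * (P * X + k * (r * Y + q * Z)) + m * (b * X) + q * b * (b * X + c * Y) =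
    P * (b * X) + m * (b * X + c * Y) + q * b * (b * X + c * Y + k * Z)"
proof -
  have "b * (k * (r * Y)) = m * (c * Y)" using assms by (metis mult.assoc)
  then show ?thesis by (simp add: algebra_simps)
qed

section \<open>Exchange relations and the identity behind the recursion for the first column\<close>

context commuting_rows begin

lemma Pf_pos: "0 < Pf"
proof -
  have "(1 - (1 + q) * \<beta> + q * \<beta> * \<beta>') - (1 - \<beta>) * (1 - q * \<beta>) = q * \<beta> * (\<beta>' - \<beta>)"
    by (simp add: algebra_simps)
  moreover have "0 < (1 - \<beta>) * (1 - q * \<beta>)" "0 < q * \<beta> * (\<beta>' - \<beta>)"
    using q b qb by simp_all
  ultimately show ?thesis unfolding Pf_def using b by (intro divide_pos_pos) linarith+
qed

lemma r_nonneg: "0 \<le> r"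
  unfolding r_def using b qb by (intro divide_nonneg_nonneg mult_nonneg_nonneg) auto

lemma two_rows_nonneg:
  assumes "\<And>C. 0 \<le> K C" "K sums x" shows "(0::real) \<le> x"
  by (rule sums_le[OF assms(1) sums_zero assms(2)])

lemma DT_nonneg: "0 \<le> DT j i A B"
  by (rule two_rows_nonneg[OF _ DT_sums]) (simp add: D.row_nonneg T.row_nonneg)

lemma t_d: "t i (d j g) A = (\<integral>\<^sup>+B. ennreal (TD i j A B) * g B \<partial>count_space UNIV)"
  by (rule transfer_transfer[OF T.row_nonneg D.row_nonneg TD_sums])

lemma d_t: "d j (t i g) A = (\<integral>\<^sup>+B. ennreal (DT j i A B) * g B \<partial>count_space UNIV)"
  by (rule transfer_transfer[OF D.row_nonneg T.row_nonneg DT_sums])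

lemma t_d_11: "t True (d True g) A = ennreal Pf * d True (t True g) A"
  unfolding t_d d_t using ybe Pf_pos DT_nonneg
  by (simp add: nn_integral_cmult[symmetric] ennreal_mult mult.assoc)

lemma t_d_10: "t True (d False g) A = ennreal r * d True (t False g) A + ennreal q * d False (t True g) A"
  unfolding t_d d_t using ybe r_nonneg DT_nonneg q
  by (simp add: nn_integral_cmult[symmetric] nn_integral_add[symmetric] ennreal_mult ennreal_plus
      mult.assoc distrib_right)

text \<open>The function seen by the remaining columns when the first one is empty, and below when
  it is occupied.\<close>

definition even_part :: "(nat \<Rightarrow> ennreal) \<Rightarrow> nat \<Rightarrow> ennreal" where "even_part g C = g (2 * C)"
definition odd_part :: "(nat \<Rightarrow> ennreal) \<Rightarrow> nat \<Rightarrow> ennreal" where "odd_part g C = g (2 * C + 1)"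

lemma t_even: "t True g (2 * A) = ennreal \<beta> * t True (even_part g) A + ennreal (1 - \<beta>) * t False (odd_part g) A"
proof -
  have "T True (2 * A) (2 * C) = \<beta> * T True A C" "T True (2 * A) (2 * C + 1) = (1 - \<beta>) * T False A C" for C
    using T.row_rec[of True "2 * A" "2 * C"] T.row_rec[of True "2 * A" "2 * C + 1"] by simp_all
  then show ?thesis
    unfolding transfer_def nn_integral_even_odd[of "\<lambda>C. ennreal (T True (2 * A) C) * g C"]
    using b T.row_nonneg
    by (simp add: even_part_def odd_part_def nn_integral_cmult[symmetric] ennreal_mult mult.assoc)
qed

lemma t_odd: "t True g (2 * A + 1) = t True (odd_part g) A"
proof -
  have "T True (2 * A + 1) (2 * C) = 0" "T True (2 * A + 1) (2 * C + 1) = T True A C" for C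
    using T.row_rec[of True "2 * A + 1" "2 * C"] T.row_rec[of True "2 * A + 1" "2 * C + 1"] by simp_all
  then show ?thesis
    unfolding transfer_def nn_integral_even_odd[of "\<lambda>C. ennreal (T True (2 * A + 1) C) * g C"]
    by (simp add: odd_part_def)
qed

lemma d_even: "d True g (2 * A) = d True (even_part g) A + ennreal ((1 - \<beta>') / \<beta>') * d False (odd_part g) A"
proof -
  have "D True (2 * A) (2 * C) = D True A C" "D True (2 * A) (2 * C + 1) = (1 - \<beta>') / \<beta>' * D False A C" for C
    using D.row_rec[of True "2 * A" "2 * C"] D.row_rec[of True "2 * A" "2 * C + 1"] b
    by (simp_all add: wD_def)
  then show ?thesis
    unfolding transfer_def nn_integral_even_odd[of "\<lambda>C. ennreal (D True (2 * A) C) * g C"]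
    using b D.row_nonneg
    by (simp add: even_part_def odd_part_def nn_integral_cmult[symmetric] ennreal_mult mult.assoc
        del: times_divide_eq_left)
qed

lemma d_odd: "d True g (2 * A + 1) = ennreal (1 / \<beta>') * d True (odd_part g) A"
proof -
  have "D True (2 * A + 1) (2 * C) = 0" "D True (2 * A + 1) (2 * C + 1) = 1 / \<beta>' * D True A C" for C
    using D.row_rec[of True "2 * A + 1" "2 * C"] D.row_rec[of True "2 * A + 1" "2 * C + 1"] b
    by (simp_all add: wD_def)
  then show ?thesis
    unfolding transfer_def nn_integral_even_odd[of "\<lambda>C. ennreal (D True (2 * A + 1) C) * g C"]
    using b D.row_nonneg
    by (simp add: odd_part_def nn_integral_cmult[symmetric] ennreal_mult mult.assoc
        del: times_divide_eq_left)
qed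

abbreviation "TT \<equiv> t True"
abbreviation "DD \<equiv> d True"

lemma TT_one: "TT (\<lambda>_. 1) A = 1"
  unfolding transfer_def using nn_integral_sums[OF T_sums] T.row_nonneg by simp

lemma DD_0: "DD g 0 = g 0"
proof -
  have "DD g 0 = (\<integral>\<^sup>+C. g C * indicator {0} C \<partial>count_space UNIV)"
    unfolding transfer_def by (intro nn_integral_cong) (auto simp: D_zero indicator_def)
  then show ?thesis by (simp add: nn_integral_count_space_indicator[symmetric] nn_integral_count_space_finite)
qed

lemma ev_parts: "even_part (ev g) = even_part g" "odd_part (ev g) = (\<lambda>_. 0)"
  by (auto simp: ev_def even_part_def odd_part_def fun_eq_iff)

text \<open>By the ice rule a horizontal arrow entering an occupied first column must leave it again
  and the column stays occupied. Hence an odd set only leads to odd sets, on which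
  \<open>ev g\<close> vanishes.\<close>

lemma ev_stable: "ev (TT (ev g)) = TT (ev g)" "ev (DD (ev g)) = DD (ev g)"
  by (auto simp: ev_def[of "transfer _ _"] fun_eq_iff t_odd[simplified] d_odd[simplified] ev_parts transfer_zero elim!: oddE)

text \<open>The constant for which the \<open>Y\<close>-terms of the next identity match:
  \<open>\<beta> * (1 - \<beta>') / \<beta>' * r = k1 * (1 - \<beta>)\<close>.\<close>

definition k1 :: real where "k1 = \<beta> * (1 - \<beta>') * r / (\<beta>' * (1 - \<beta>))"

lemma k1_nonneg: "0 \<le> k1"
  unfolding k1_def using b r_nonneg by (intro divide_nonneg_nonneg mult_nonneg_nonneg) auto

text \<open>Applied to \<open>F m\<close>, where \<open>TT\<close> acts by a scalar, this is a recursion for the value on sets that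
  avoid the first column. The terms with a horizontal arrow on the right of the first column are
  eliminated with the help of the exchange relation \<open>t_d_10\<close>.\<close>

lemma four_term:
  "ev (TT (ev (DD g))) A + ennreal k1 * ev (DD (TT (ev g))) A + ennreal (q * \<beta>) * ev (DD (ev (TT g))) A =
   ennreal Pf * ev (DD (TT (ev g))) A + ennreal k1 * ev (DD (ev (TT g))) A + ennreal (q * \<beta>) * ev (DD (TT g)) A"
proof (cases "even A")
  case True
  then obtain B where A: "A = 2 * B" by (elim evenE)
  \<comment> \<open>What happens to the right of the first column, always with \<open>d\<close>
    outside \<open>t\<close>: the horizontal arrow leaves the first column in both rows, in the
    D-row only, or in the T-row only.\<close>
  define X where "X = d True (t True (even_part g)) B"
  define Y where "Y = d True (t False (odd_part g)) B"
  define Z where "Z = d False (t True (odd_part g)) B"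
  define k where "k = (1 - \<beta>') / \<beta>'"
  have parts: "even_part (t True f) = (\<lambda>C. ennreal \<beta> * t True (even_part f) C + ennreal (1 - \<beta>) * t False (odd_part f) C)"
    "odd_part (t True f) = t True (odd_part f)"
    "even_part (d True f) = (\<lambda>C. d True (even_part f) C + ennreal k * d False (odd_part f) C)" for f
    by (simp_all add: fun_eq_iff even_part_def[of "transfer _ _"] odd_part_def[of "transfer _ _"]
        t_even t_odd[simplified] d_even k_def)
  have e1: "ev (TT (ev (DD g))) A =
      ennreal \<beta> * (ennreal Pf * X + ennreal k * (ennreal r * Y + ennreal q * Z))"
    by (simp add: A ev_def[of "transfer _ _"] t_even ev_parts parts transfer_zero_fun transfer_add
        transfer_cmult t_d_11 t_d_10 X_def Y_def Z_def)
  have e2: "ev (DD (TT (ev g))) A = ennreal \<beta> * X"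
    by (simp add: A ev_def[of "transfer _ _"] d_even ev_parts parts transfer_zero_fun transfer_add
        transfer_cmult X_def)
  have e3: "ev (DD (ev (TT g))) A = ennreal \<beta> * X + ennreal (1 - \<beta>) * Y"
    by (simp add: A ev_def[of "transfer _ _"] d_even ev_parts parts transfer_zero_fun transfer_add
        transfer_cmult X_def Y_def)
  have e4: "ev (DD (TT g)) A = ennreal \<beta> * X + ennreal (1 - \<beta>) * Y + ennreal k * Z"
    by (simp add: A ev_def[of "transfer _ _"] d_even ev_parts parts transfer_zero_fun transfer_add
        transfer_cmult X_def Y_def Z_def k_def)
  have k: "0 \<le> k" using b by (simp add: k_def)
  have "\<beta> * k * r = k1 * (1 - \<beta>)" using b by (simp add: k_def k1_def)
  then have "ennreal \<beta> * ennreal k * ennreal r = ennreal k1 * ennreal (1 - \<beta>)"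
    using b k k1_nonneg r_nonneg by (simp add: ennreal_mult[symmetric])
  moreover have "ennreal (q * \<beta>) = ennreal q * ennreal \<beta>" using q b by (simp add: ennreal_mult)
  ultimately show ?thesis
    unfolding e1 e2 e3 e4 by (simp only: four_term_identity)
next
  case False
  then show ?thesis by (simp add: ev_def[of "transfer _ _"])
qed

end

subsection \<open>The probability that the first column is empty\<close>

lemma transfer_add_fun: "transfer K (\<lambda>C. f C + g C) = (\<lambda>A. transfer K f A + transfer K g A)"
  by (simp add: fun_eq_iff transfer_add)

lemma transfer_cmult_fun: "transfer K (\<lambda>C. c * g C) = (\<lambda>A. c * transfer K g A)"
  by (simp add: fun_eq_iff transfer_cmult)

lemma transfer_funpow_add:
  "(transfer K ^^ n) (\<lambda>A. f A + g A) = (\<lambda>A. (transfer K ^^ n) f A + (transfer K ^^ n) g A)"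
  by (induction n) (simp_all add: transfer_add_fun)

lemma transfer_funpow_cmult:
  "(transfer K ^^ n) (\<lambda>A. c * g A) = (\<lambda>A. c * (transfer K ^^ n) g A)"
  by (induction n) (simp_all add: transfer_cmult_fun)

lemma transfer_funpow_mono:
  "(\<And>A. f A \<le> g A) \<Longrightarrow> (transfer K ^^ n) f A \<le> (transfer K ^^ n) g A"
  by (induction n arbitrary: A) (auto intro!: transfer_mono)

context commuting_rows begin

definition F :: "nat \<Rightarrow> nat \<Rightarrow> ennreal" where "F m = (DD ^^ m) (\<lambda>_. 1)"

lemma TT_DD: "TT (DD g) = (\<lambda>A. ennreal Pf * DD (TT g) A)"
  by (simp add: fun_eq_iff t_d_11)

lemma TT_pow_DD: "(TT ^^ n) (DD g) = (\<lambda>A. ennreal (Pf ^ n) * DD ((TT ^^ n) g) A)"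
proof (induction n)
  case (Suc n)
  have "(TT ^^ Suc n) (DD g) = TT (\<lambda>A. ennreal (Pf ^ n) * DD ((TT ^^ n) g) A)"
    by (simp add: Suc)
  also have "\<dots> = (\<lambda>A. ennreal (Pf ^ n) * (ennreal Pf * DD (TT ((TT ^^ n) g)) A))"
    by (simp add: fun_eq_iff transfer_cmult TT_DD)
  finally show ?case
    using Pf_pos by (simp add: fun_eq_iff ennreal_mult ac_simps)
qed simp

text \<open>The constant 1 is fixed by the Markov operator \<open>TT\<close>, and each of the m
  exchanges with \<open>DD\<close> costs a factor \<open>Pf\<close>.\<close>

lemma TT_F: "TT (F m) = (\<lambda>A. ennreal (Pf ^ m) * F m A)"
proof (induction m)
  case 0
  then show ?case by (simp add: F_def fun_eq_iff TT_one)
next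
  case (Suc m)
  have "TT (F (Suc m)) = (\<lambda>A. ennreal Pf * DD (TT (F m)) A)"
    by (simp add: F_def TT_DD)
  then show ?case
    unfolding Suc using Pf_pos by (simp add: F_def fun_eq_iff transfer_cmult ennreal_mult ac_simps)
qed

lemma TT_pow_F: "(TT ^^ n) (F m) = (\<lambda>A. ennreal (Pf ^ (n * m)) * F m A)"
proof (induction n)
  case (Suc n)
  then have "(TT ^^ Suc n) (F m) = (\<lambda>A. ennreal (Pf ^ (n * m)) * TT (F m) A)"
    by (simp add: transfer_cmult_fun)
  then show ?case
    using Pf_pos by (simp add: TT_F ennreal_mult power_add fun_eq_iff ac_simps)
qed simp

lemma F_0: "F m 0 = 1"
  by (induction m) (simp_all add: F_def DD_0)

lemma total: "(TT ^^ n) (F m) 0 = ennreal (Pf ^ (n * m))"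
  by (simp add: TT_pow_F F_0)

definition e :: "nat \<Rightarrow> nat \<Rightarrow> ennreal" where "e n m = (TT ^^ n) (ev (F m)) 0"

lemma ev_le: "ev g A \<le> g A"
  by (simp add: ev_def)

lemma ev_cmult: "ev (\<lambda>A. c * g A) = (\<lambda>A. c * ev g A)"
  by (simp add: ev_def fun_eq_iff)

lemma e_le: "e n m \<le> ennreal (Pf ^ (n * m))"
  unfolding e_def total[symmetric] by (intro transfer_funpow_mono ev_le)

lemma e_0: "e 0 m = 1"
  by (simp add: e_def ev_def F_0)

text \<open>Without v-rows, the arrow entering each row has to cross the empty first column,
  independently with probability \<open>\<beta>\<close>.\<close>

lemma e_n_0: "e n 0 = ennreal (\<beta> ^ n)"
proof -
  have "TT (ev (\<lambda>_. 1)) = (\<lambda>A. ennreal \<beta> * ev (\<lambda>_. 1) A)"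
  proof
    fix A
    show "TT (ev (\<lambda>_. 1)) A = ennreal \<beta> * ev (\<lambda>_. 1) A"
    proof (cases "even A")
      case True
      then obtain B where "A = 2 * B" by (elim evenE)
      moreover have "even_part (\<lambda>_. 1) = (\<lambda>_. 1)" by (simp add: even_part_def fun_eq_iff)
      ultimately show ?thesis
        using t_even[of "ev (\<lambda>_. 1)" B] TT_one[of B]
        by (simp add: ev_parts transfer_zero) (simp add: ev_def)
    next
      case False
      then show ?thesis using fun_cong[OF ev_stable(1), of "\<lambda>_. 1" A] by (simp add: ev_def)
    qed
  qed
  then have "(TT ^^ n) (ev (\<lambda>_. 1)) = (\<lambda>A. ennreal (\<beta> ^ n) * ev (\<lambda>_. 1) A)"
    using b by (induction n) (simp_all add: transfer_cmult_fun ennreal_mult ac_simps)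
  then show ?thesis by (simp add: e_def F_def ev_def)
qed

text \<open>\<open>four_term\<close> for \<open>F m\<close>, followed by n more u-rows and evaluated
  at the empty set. An outer \<open>DD\<close> is moved through the n rows, which gives
  \<open>Pf ^ n\<close>, and disappears at the empty set by \<open>DD_0\<close>; an inner
  \<open>TT\<close> acts on \<open>F m\<close> as the scalar \<open>Pf ^ m\<close>.\<close>

lemma e_rec:
  "e (Suc n) (Suc m) + ennreal (k1 * Pf ^ n) * e (Suc n) m + ennreal (q * \<beta> * Pf ^ (n + m)) * e n m =
   ennreal (Pf * Pf ^ n) * e (Suc n) m + ennreal (k1 * Pf ^ (n + m)) * e n m +
   ennreal (q * \<beta> * Pf ^ m) * e n (Suc m)"
proof -
  let ?S = "TT ^^ n" and ?g = "F m"
  have Fs: "F (Suc m) = DD ?g" by (simp add: F_def)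
  have pow: "?S (TT f) = (TT ^^ Suc n) f" for f
    by (simp add: funpow_swap1)
  have 1: "?S (ev (TT (ev (DD ?g)))) 0 = e (Suc n) (Suc m)"
    by (simp only: ev_stable pow e_def Fs)
  have "ev (DD (TT (ev ?g))) = DD (TT (ev ?g))"
    using ev_stable(2)[of "TT (ev ?g)"] by (simp add: ev_stable)
  then have 2: "?S (ev (DD (TT (ev ?g)))) 0 = ennreal (Pf ^ n) * e (Suc n) m"
    by (simp add: TT_pow_DD DD_0 e_def funpow_swap1)
  have "ev (TT ?g) = (\<lambda>A. ennreal (Pf ^ m) * ev ?g A)"
    by (simp add: TT_F ev_def fun_eq_iff)
  then have "ev (DD (ev (TT ?g))) = (\<lambda>A. ennreal (Pf ^ m) * DD (ev ?g) A)"
    using fun_cong[OF ev_stable(2)[of ?g]] by (simp add: transfer_cmult_fun ev_cmult)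
  then have 3: "?S (ev (DD (ev (TT ?g)))) 0 = ennreal (Pf ^ (n + m)) * e n m"
    using Pf_pos by (simp add: transfer_funpow_cmult TT_pow_DD DD_0 e_def power_add ennreal_mult ac_simps)
  have "ev (DD (TT ?g)) = (\<lambda>A. ennreal (Pf ^ m) * ev (F (Suc m)) A)"
    by (simp add: TT_F Fs ev_def fun_eq_iff transfer_cmult)
  then have 4: "?S (ev (DD (TT ?g))) 0 = ennreal (Pf ^ m) * e n (Suc m)"
    by (simp add: transfer_funpow_cmult e_def)
  have "?S (\<lambda>A. ev (TT (ev (DD ?g))) A + ennreal k1 * ev (DD (TT (ev ?g))) A + ennreal (q * \<beta>) * ev (DD (ev (TT ?g))) A) 0 =
    ?S (\<lambda>A. ennreal Pf * ev (DD (TT (ev ?g))) A + ennreal k1 * ev (DD (ev (TT ?g))) A + ennreal (q * \<beta>) * ev (DD (TT ?g)) A) 0"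
    by (simp add: four_term)
  then show ?thesis
    using Pf_pos k1_nonneg q b
    unfolding transfer_funpow_add transfer_funpow_cmult 1 2 3 4
    by (simp add: ennreal_mult mult.assoc)
qed

text \<open>By \<open>total\<close> the denominator is the full mass, so this is a
  probability.\<close>

definition Q :: "nat \<Rightarrow> nat \<Rightarrow> real" where "Q n m = enn2real (e n m) / Pf ^ (n * m)"

lemma e_Q: "e n m = ennreal (Pf ^ (n * m) * Q n m)" "0 \<le> Q n m"
proof -
  have "e n m < top" using e_le[of n m] by (simp add: le_less_trans)
  then show "e n m = ennreal (Pf ^ (n * m) * Q n m)" "0 \<le> Q n m"
    using Pf_pos by (simp_all add: Q_def)
qed

text \<open>The coefficients that remain after \<open>e_rec\<close> is divided by the powers of
  \<open>Pf\<close>: \<open>Vu\<close> is \<open>(Pf - k1) / Pf\<close>, by \<open>k1_eq\<close>,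
  and \<open>Ts\<close> comes from the terms with \<open>q * \<beta>\<close>.\<close>

definition Vu :: real where "Vu = 1 / (Pf * \<beta>')"
definition Ts :: real where "Ts = q * \<beta> / Pf"

lemma k1_eq: "k1 = Pf - 1 / \<beta>'"
proof -
  have "\<beta>' - \<beta> \<noteq> 0" "\<beta>' \<noteq> 0" "1 - \<beta> \<noteq> 0" using b by auto
  then show ?thesis
    unfolding k1_def Pf_def r_def by (simp add: divide_simps) (simp add: algebra_simps)
qed

lemma Q_rec: "Q (Suc n) (Suc m) = Vu * Q (Suc n) m + Ts * Q n (Suc m) + (1 - Vu - Ts) * Q n m"
proof -
  note Qs = e_Q(1)[of "Suc n" "Suc m"] e_Q(1)[of "Suc n" m] e_Q(1)[of n m] e_Q(1)[of n "Suc m"]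
  have "Pf ^ (Suc n * Suc m) * Q (Suc n) (Suc m) + k1 * Pf ^ n * (Pf ^ (Suc n * m) * Q (Suc n) m) +
      q * \<beta> * Pf ^ (n + m) * (Pf ^ (n * m) * Q n m) =
    Pf * Pf ^ n * (Pf ^ (Suc n * m) * Q (Suc n) m) + k1 * Pf ^ (n + m) * (Pf ^ (n * m) * Q n m) +
      q * \<beta> * Pf ^ m * (Pf ^ (n * Suc m) * Q n (Suc m))"
    (is "?L = ?R")
  proof -
    have nn: "0 \<le> Pf" "0 \<le> k1" "0 \<le> q" "0 \<le> \<beta>" using Pf_pos k1_nonneg q b by auto
    have "ennreal ?L = ennreal ?R"
      using e_rec[of n m] nn e_Q(2) unfolding Qs
      by (simp add: ennreal_mult[symmetric] ennreal_plus[symmetric] del: ennreal_plus power_Suc mult_Suc mult_Suc_right)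
    moreover have "0 \<le> ?L" "0 \<le> ?R"
      using nn e_Q(2) by (auto intro!: add_nonneg_nonneg mult_nonneg_nonneg)
    ultimately show ?thesis by (simp only: ennreal_inj)
  qed
  moreover define P where "P = Pf ^ (n * m + n + m)"
  ultimately have "P * (Pf * Q (Suc n) (Suc m) + k1 * Q (Suc n) m + q * \<beta> * Q n m) =
      P * (Pf * Q (Suc n) m + k1 * Q n m + q * \<beta> * Q n (Suc m))"
    unfolding P_def by (simp add: power_add algebra_simps)
  moreover have "P \<noteq> 0" using Pf_pos by (simp add: P_def)
  ultimately have "Pf * Q (Suc n) (Suc m) + k1 * Q (Suc n) m + q * \<beta> * Q n m =
      Pf * Q (Suc n) m + k1 * Q n m + q * \<beta> * Q n (Suc m)"
    by simp
  moreover have "Pf * Vu = Pf - k1" "Pf * Ts = q * \<beta>"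
    unfolding Vu_def Ts_def k1_eq using Pf_pos b by simp_all
  then have "Pf * (Vu * Q (Suc n) m + Ts * Q n (Suc m) + (1 - Vu - Ts) * Q n m) =
      (Pf - k1) * Q (Suc n) m + q * \<beta> * Q n (Suc m) + (Pf - (Pf - k1) - q * \<beta>) * Q n m"
    by (simp only: distrib_left right_diff_distrib mult.assoc[symmetric] left_diff_distrib mult_1_right)
  ultimately have "Pf * Q (Suc n) (Suc m) = Pf * (Vu * Q (Suc n) m + Ts * Q n (Suc m) + (1 - Vu - Ts) * Q n m)"
    by (simp add: algebra_simps)
  then show ?thesis using Pf_pos by simp
qed

lemma Q_0: "Q 0 m = 1"
  using Pf_pos by (simp add: Q_def e_0)

lemma Q_n_0: "Q n 0 = \<beta> ^ n"
  using b by (simp add: Q_def e_n_0)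

text \<open>These bounds keep the pole \<open>Ts\<close> of \<open>V\<close> to the left of the
  interval from \<open>\<beta>\<close> to 1 and make the coefficients in the proof of
  \<open>Q_bound\<close> nonnegative.\<close>

lemma Vu_less: "Vu < 1" and Ts_bounds: "0 < Ts" "Ts < \<beta>"
proof -
  have nz: "\<beta>' - \<beta> \<noteq> 0" "\<beta>' \<noteq> 0" using b by auto
  have "0 < \<beta> * (1 - \<beta>') * (1 - q * \<beta>') / (\<beta>' * (\<beta>' - \<beta>))"
    using b qb by (intro divide_pos_pos mult_pos_pos) auto
  also have "\<dots> = Pf - 1 / \<beta>'"
    unfolding Pf_def using nz by (simp add: divide_simps) (simp add: algebra_simps)
  finally have "1 < Pf * \<beta>'" using b by (simp add: divide_simps mult.commute split: if_splits)
  then show "Vu < 1" by (simp add: Vu_def)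
  show "0 < Ts" using q b Pf_pos by (simp add: Ts_def)
  have "Pf * \<beta>' < Pf" using Pf_pos b by simp
  then have "1 < Pf" using \<open>1 < Pf * \<beta>'\<close> by linarith
  then have "q < Pf" using q by simp
  then have "q * \<beta> < Pf * \<beta>" using b by simp
  then show "Ts < \<beta>" unfolding Ts_def using Pf_pos by (simp add: pos_divide_less_eq mult.commute)
qed

definition V :: "real \<Rightarrow> real" where "V x = Vu + (1 - Ts) * (1 - Vu) / (x - Ts)"

text \<open>\<open>(x, V x)\<close> runs through the pairs for which \<open>x ^ n * V x ^ m\<close> solves the recursion \<open>Q_rec\<close>;
  the increment in \<open>m\<close> is compared instead of the recursion itself, since the coefficient
  \<open>1 - Vu - Ts\<close> may be negative.\<close>

lemma Q_bound:
  assumes x: "\<beta> \<le> x" "x \<le> 1"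
  shows "Q n m \<le> x ^ n * V x ^ m"
proof (induction m arbitrary: n)
  case 0
  then show ?case using x b by (simp add: Q_n_0 power_mono)
next
  case (Suc m)
  have den: "0 < x - Ts" and V1: "1 \<le> V x"
  proof -
    show "0 < x - Ts" using Ts_bounds x by linarith
    then have "1 - Vu \<le> (1 - Ts) * (1 - Vu) / (x - Ts)"
      using x Vu_less by (simp add: pos_le_divide_eq mult.commute mult_right_mono)
    then show "1 \<le> V x" by (simp add: V_def)
  qed
  have D: "Q n (Suc m) - Vu * Q n m \<le> (V x - Vu) * (x ^ n * V x ^ m)"
  proof (induction n)
    case 0
    have "1 * (1 - Vu) \<le> V x ^ m * (V x - Vu)"
      using V1 Vu_less by (intro mult_mono) auto
    then show ?case by (simp add: Q_0 mult.commute)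
  next
    case (Suc n)
    \<comment> \<open>For the increment both coefficients are nonnegative, because
      \<open>1 - Vu - Ts + Ts * Vu\<close> factors as \<open>(1 - Ts) * (1 - Vu)\<close>. The
      definition of \<open>V\<close> is the condition that
      \<open>Ts * (V x - Vu) + (1 - Ts) * (1 - Vu)\<close> equals
      \<open>x * (V x - Vu)\<close>.\<close>
    have "Q (Suc n) (Suc m) - Vu * Q (Suc n) m =
        Ts * (Q n (Suc m) - Vu * Q n m) + (1 - Ts) * (1 - Vu) * Q n m"
      by (simp add: Q_rec algebra_simps)
    also have "\<dots> \<le> Ts * ((V x - Vu) * (x ^ n * V x ^ m)) + (1 - Ts) * (1 - Vu) * (x ^ n * V x ^ m)"
    proof (intro add_mono mult_left_mono Suc \<open>\<And>n. Q n m \<le> x ^ n * V x ^ m\<close>)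
      show "0 \<le> Ts" "0 \<le> (1 - Ts) * (1 - Vu)"
        using Ts_bounds Vu_less b by auto
    qed
    also have "\<dots> = (V x - Vu) * (x ^ Suc n * V x ^ m)"
      using den by (simp add: V_def field_simps)
    finally show ?case .
  qed
  have "Vu * Q n m \<le> Vu * (x ^ n * V x ^ m)"
    using Suc[of n] Pf_pos b by (intro mult_left_mono) (auto simp: Vu_def)
  with D have "Q n (Suc m) \<le> (V x - Vu) * (x ^ n * V x ^ m) + Vu * (x ^ n * V x ^ m)"
    by linarith
  then show ?case by (simp add: algebra_simps)
qed

text \<open>\<open>rate\<close> is minus the derivative of \<^term>\<open>V\<close> at \<open>1\<close>.\<close>

definition rate :: real where "rate = \<beta> * (1 - \<beta>') * (1 - q * \<beta>') / (\<beta>' * (1 - \<beta>) * (1 - q * \<beta>))"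

lemma rate_eq: "rate = (1 - Vu) / (1 - Ts)"
proof -
  have nz: "\<beta>' - \<beta> \<noteq> 0" "\<beta>' \<noteq> 0" "1 - \<beta> \<noteq> 0" "1 - q * \<beta> \<noteq> 0" "Pf \<noteq> 0" using b qb Pf_pos by auto
  have 1: "Pf - q * \<beta> = (1 - \<beta>) * (1 - q * \<beta>) / (\<beta>' - \<beta>)"
    unfolding Pf_def using nz by (simp add: divide_simps) (simp add: algebra_simps)
  have 2: "Pf - 1 / \<beta>' = \<beta> * (1 - \<beta>') * (1 - q * \<beta>') / (\<beta>' * (\<beta>' - \<beta>))"
    unfolding Pf_def using nz by (simp add: divide_simps) (simp add: algebra_simps)
  have "(1 - Vu) / (1 - Ts) = (Pf - 1 / \<beta>') / (Pf - q * \<beta>)"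
  proof -
    have "Pf * (1 - Vu) = Pf - 1 / \<beta>'" "Pf * (1 - Ts) = Pf - q * \<beta>"
      unfolding Vu_def Ts_def using nz by (simp_all add: right_diff_distrib)
    then show ?thesis using nz by (metis mult_divide_mult_cancel_left)
  qed
  moreover have "A / (p * x) / (y / x) = A / (p * y)" if "x \<noteq> 0" for A p x y :: real
    using that by simp
  ultimately show ?thesis unfolding 1 2 rate_def mult.assoc[of \<beta>'] using nz by simp
qed

lemma rate_pos: "0 < rate"
  unfolding rate_def using b qb by (intro divide_pos_pos mult_pos_pos) auto

text \<open>The function \<open>x powr \<gamma> * V x\<close> takes the value 1 at x = 1 and has
  derivative \<open>\<gamma> - rate > 0\<close> there, so it is below 1 just to the left.\<close>

lemma exists_decay:
  assumes "rate < \<gamma>"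
  obtains x where "\<beta> \<le> x" "x < 1" "x powr \<gamma> * V x < 1"
proof -
  have "(V has_real_derivative - ((1 - Ts) * (1 - Vu)) / (1 - Ts)\<^sup>2) (at 1)"
    unfolding V_def using Ts_bounds b
    by (auto intro!: derivative_eq_intros simp: power2_eq_square)
  moreover have "- ((1 - Ts) * (1 - Vu)) / (1 - Ts)\<^sup>2 = - rate"
    unfolding rate_eq using Ts_bounds b by (simp add: power2_eq_square)
  ultimately have "(V has_real_derivative - rate) (at 1)" by simp
  moreover have "V 1 = 1" using Ts_bounds b by (simp add: V_def)
  ultimately have "((\<lambda>x. x powr \<gamma> * V x) has_real_derivative (\<gamma> - rate)) (at 1)"
    by (auto intro!: derivative_eq_intros)
  moreover have "0 < \<gamma> - rate" using assms by simp
  ultimately obtain d where d: "0 < d" "\<And>h. 0 < h \<Longrightarrow> h < d \<Longrightarrow> (1 - h) powr \<gamma> * V (1 - h) < 1 powr \<gamma> * V 1"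
    using DERIV_pos_inc_left by blast
  \<comment> \<open>The second bound keeps \<open>1 - h\<close> above \<open>\<beta>\<close>, where
    \<open>Q_bound\<close> applies.\<close>
  define h where "h = min (d / 2) (1 - \<beta>)"
  have "0 < h" "h < d" "h \<le> 1 - \<beta>" using d b by (auto simp: h_def)
  then show ?thesis
    using that[of "1 - h"] d(2)[of h] \<open>V 1 = 1\<close> by simp
qed

end

subsection \<open>Comparison of the first \<open>k\<close> columns with the first one\<close>

abbreviation pc :: "nat \<Rightarrow> nat" where "pc t \<equiv> card (set_decode t)"

text \<open>The part of \<open>row_weight\<close> that lies in the first k columns: \<open>i\<close>
  enters the block on the left, \<open>j\<close> leaves it on the right.\<close>

fun block :: "vertex_weight \<Rightarrow> nat \<Rightarrow> bool \<Rightarrow> nat \<Rightarrow> nat \<Rightarrow> bool \<Rightarrow> real" where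
  "block w 0 i t t' j = of_bool (i = j)"
| "block w (Suc k) i t t' j =
     w (odd t) i (odd t') False * block w k False (t div 2) (t' div 2) j +
     w (odd t) i (odd t') True * block w k True (t div 2) (t' div 2) j"

lemma half_add_power: "(t + 2 ^ Suc k * x) div 2 = t div 2 + 2 ^ k * (x::nat)"
  by simp

lemma sum_even_odd: "(\<Sum>i<2 * m. f i) = (\<Sum>i<m. f (2 * i)) + (\<Sum>i<m. f (2 * i + 1))"
  for f :: "nat \<Rightarrow> 'a :: comm_monoid_add"
  by (induction m) (auto simp: ac_simps)

lemma nn_integral_blocks:
  fixes f :: "nat \<Rightarrow> ennreal"
  shows "(\<integral>\<^sup>+C. f C \<partial>count_space UNIV) = (\<Sum>t<2 ^ k. \<integral>\<^sup>+B. f (t + 2 ^ k * B) \<partial>count_space UNIV)"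
proof (induction k arbitrary: f)
  case (Suc k)
  have "(\<Sum>t<2 ^ Suc k. \<integral>\<^sup>+B. f (t + 2 ^ Suc k * B) \<partial>count_space UNIV) =
     (\<Sum>t<2 ^ k. \<integral>\<^sup>+B. f (2 * (t + 2 ^ k * B)) \<partial>count_space UNIV) +
     (\<Sum>t<2 ^ k. \<integral>\<^sup>+B. f (2 * (t + 2 ^ k * B) + 1) \<partial>count_space UNIV)"
    unfolding power_Suc sum_even_odd by (simp add: algebra_simps)
  then show ?case
    unfolding Suc[of "\<lambda>C. f (2 * C)", symmetric] Suc[of "\<lambda>C. f (2 * C + 1)", symmetric]
    by (simp only: nn_integral_even_odd[of f])
qed simp

lemma pc_le: "t < 2 ^ k \<Longrightarrow> pc t \<le> k"
  and pc_full: "t < 2 ^ k \<Longrightarrow> pc t = k \<Longrightarrow> t = 2 ^ k - 1"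
proof (induction k arbitrary: t)
  case (Suc k)
  { case 1
    then show ?case using Suc(1)[of "t div 2"] by (subst card_set_decode_rec) auto }
  { case 2
    then have h: "t div 2 < 2 ^ k" by auto
    have "odd t" "pc (t div 2) = k"
      using 2 Suc(1)[OF h] card_set_decode_rec[of t] by (cases "odd t"; simp)+
    then have "t = 2 * (2 ^ k - 1) + 1" using Suc(2)[OF h] by (metis odd_two_times_div_two_succ)
    moreover have "(1::nat) \<le> 2 ^ k" by simp
    ultimately show ?case unfolding power_Suc by linarith }
qed auto

lemma ones: "(2 ^ Suc m - 1) div 2 = (2 ^ m - 1 :: nat)" "odd (2 ^ Suc m - 1 :: nat)"
proof -
  have "(1::nat) \<le> 2 ^ m" by simp
  then have "2 ^ Suc m - 1 = 2 * (2 ^ m - 1) + (1::nat)" unfolding power_Suc by linarith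
  then show "(2 ^ Suc m - 1) div 2 = (2 ^ m - 1 :: nat)" "odd (2 ^ Suc m - 1 :: nat)" by simp_all
qed

lemma pc_ones: "pc (2 ^ h - 1) = h"
proof (induction h)
  case (Suc h)
  show ?case using Suc by (subst card_set_decode_rec) (simp only: ones, simp)
qed simp

text \<open>The arrows are packed to the left, except that the first column stays empty as long as \<open>h < k\<close>.\<close>

definition pack :: "nat \<Rightarrow> nat \<Rightarrow> nat" where
  "pack k h = (if h < k then 2 * (2 ^ h - 1) else 2 ^ k - 1)"

lemma pack_less: "pack k h < 2 ^ k"
proof (cases "h < k")
  case True
  then have "(2::nat) ^ Suc h \<le> 2 ^ k" by (intro power_increasing) auto
  moreover have "(1::nat) \<le> 2 ^ h" by simp
  ultimately show ?thesis using True unfolding pack_def power_Suc by (simp only: if_True)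
qed (simp add: pack_def)

lemma pc_pack: "h \<le> k \<Longrightarrow> pc (pack k h) = h"
  by (cases "h < k") (simp_all add: pack_def pc_ones[simplified] card_set_decode_rec[of "2 * _"])

locale ice_pos = ice +
  assumes pos: "\<And>a i c j. of_bool a + of_bool i = (of_bool c + of_bool j :: nat) \<Longrightarrow> 0 < w a i c j"
begin

lemma w_zero: "\<not> of_bool a + of_bool i = (of_bool c + of_bool j :: nat) \<Longrightarrow> w a i c j = 0"
  using conserve by blast

lemma block_nonneg: "0 \<le> block w k i t t' j"
  by (induction k arbitrary: i t t') (auto intro!: add_nonneg_nonneg mult_nonneg_nonneg nonneg)

lemma row_block:
  "row_weight w e i (t + 2 ^ k * A) (t' + 2 ^ k * C) =
    block w k i t t' False * row_weight w e False (t div 2 ^ k + A) (t' div 2 ^ k + C) +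
    block w k i t t' True * row_weight w e True (t div 2 ^ k + A) (t' div 2 ^ k + C)"
proof (induction k arbitrary: i t t')
  case 0
  then show ?case by (cases i) simp_all
next
  case (Suc k)
  show ?case
    unfolding row_rec[of i "t + 2 ^ Suc k * A"] half_add_power Suc
    by (simp add: div_mult2_eq[symmetric] mult.commute algebra_simps)
qed

lemma transfer_block:
  assumes "t < 2 ^ k"
  shows "transfer (row_weight w e i) g (t + 2 ^ k * A) =
    (\<Sum>t'<2 ^ k. ennreal (block w k i t t' False) * transfer (row_weight w e False) (\<lambda>B. g (t' + 2 ^ k * B)) A) +
    (\<Sum>t'<2 ^ k. ennreal (block w k i t t' True) * transfer (row_weight w e True) (\<lambda>B. g (t' + 2 ^ k * B)) A)"
proof -
  have "(\<integral>\<^sup>+B. ennreal (row_weight w e i (t + 2 ^ k * A) (t' + 2 ^ k * B)) * g (t' + 2 ^ k * B) \<partial>count_space UNIV) =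
    ennreal (block w k i t t' False) * transfer (row_weight w e False) (\<lambda>B. g (t' + 2 ^ k * B)) A +
    ennreal (block w k i t t' True) * transfer (row_weight w e True) (\<lambda>B. g (t' + 2 ^ k * B)) A"
    if "t' < 2 ^ k" for t'
  proof -
    have t: "t div 2 ^ k = 0" "t' div 2 ^ k = 0" using assms that by simp_all
    have "ennreal (row_weight w e i (t + 2 ^ k * A) (t' + 2 ^ k * B)) * x =
       ennreal (block w k i t t' False) * (ennreal (row_weight w e False A B) * x) +
       ennreal (block w k i t t' True) * (ennreal (row_weight w e True A B) * x)" for B x
      unfolding row_block t add_0
      using block_nonneg[of k i t t'] row_nonneg
      by (simp add: ennreal_plus ennreal_mult distrib_right mult.assoc)
    then have "(\<integral>\<^sup>+B. ennreal (row_weight w e i (t + 2 ^ k * A) (t' + 2 ^ k * B)) * g (t' + 2 ^ k * B) \<partial>count_space UNIV) =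
       (\<integral>\<^sup>+B. ennreal (block w k i t t' False) * (ennreal (row_weight w e False A B) * g (t' + 2 ^ k * B)) +
         ennreal (block w k i t t' True) * (ennreal (row_weight w e True A B) * g (t' + 2 ^ k * B)) \<partial>count_space UNIV)"
      by (intro nn_integral_cong) blast
    also have "\<dots> = (\<integral>\<^sup>+B. ennreal (block w k i t t' False) * (ennreal (row_weight w e False A B) * g (t' + 2 ^ k * B)) \<partial>count_space UNIV) +
        (\<integral>\<^sup>+B. ennreal (block w k i t t' True) * (ennreal (row_weight w e True A B) * g (t' + 2 ^ k * B)) \<partial>count_space UNIV)"
      by (rule nn_integral_add) simp_all
    finally show ?thesis
      unfolding transfer_def by (simp add: nn_integral_cmult)
  qed
  moreover have "transfer (row_weight w e i) g (t + 2 ^ k * A) =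
    (\<Sum>t'<2 ^ k. \<integral>\<^sup>+B. ennreal (row_weight w e i (t + 2 ^ k * A) (t' + 2 ^ k * B)) * g (t' + 2 ^ k * B) \<partial>count_space UNIV)"
    unfolding transfer_def by (rule nn_integral_blocks)
  ultimately show ?thesis
    by (simp only: sum.distrib[symmetric]) (intro sum.cong refl, simp)
qed

lemma block_card:
  "block w k i t t' j \<noteq> 0 \<Longrightarrow> t < 2 ^ k \<Longrightarrow> t' < 2 ^ k \<Longrightarrow> pc t + of_bool i = pc t' + of_bool j"
proof (induction k arbitrary: i t t')
  case 0
  then show ?case by (simp split: if_splits)
next
  case (Suc k)
  obtain l where l: "w (odd t) i (odd t') l \<noteq> 0" "block w k l (t div 2) (t' div 2) j \<noteq> 0"
    using Suc.prems(1) unfolding block.simps by (metis add.right_neutral mult_zero_left mult_zero_right)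
  have "t div 2 < 2 ^ k" "t' div 2 < 2 ^ k" using Suc.prems by auto
  from Suc.IH[OF l(2) this] conserve[OF l(1)] show ?case
    using card_set_decode_rec[of t] card_set_decode_rec[of t'] by simp
qed

lemma block_triangular:
  "block w k i t t' True \<noteq> 0 \<Longrightarrow> t < 2 ^ k \<Longrightarrow> t' < 2 ^ k \<Longrightarrow> t' + of_bool (\<not> i) \<le> t"
proof (induction k arbitrary: i t t')
  case 0
  then show ?case by (simp split: if_splits)
next
  case (Suc k)
  obtain l where l: "w (odd t) i (odd t') l \<noteq> 0" "block w k l (t div 2) (t' div 2) True \<noteq> 0"
    using Suc.prems(1) unfolding block.simps by (metis add.right_neutral mult_zero_left mult_zero_right)
  have "t div 2 < 2 ^ k" "t' div 2 < 2 ^ k" using Suc.prems by auto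
  note 1 = Suc.IH[OF l(2) this] and 2 = conserve[OF l(1)]
  have "t = 2 * (t div 2) + of_bool (odd t)" "t' = 2 * (t' div 2) + of_bool (odd t')"
    by simp_all
  then show ?case
    using 1 2 by (cases i; cases l; simp split: if_splits)
qed

text \<open>If no column changes, the entering arrow passes straight through all of them, so the
  entry only depends on the number of arrows. In particular it is the same for \<open>t\<close> and
  for \<open>pack k (pc t)\<close>.\<close>

lemma block_diag:
  "t < 2 ^ k \<Longrightarrow> block w k True t t True = w False True False True ^ (k - pc t) * w True True True True ^ pc t"
proof (induction k arbitrary: t)
  case (Suc k)
  have h: "t div 2 < 2 ^ k" using Suc.prems by auto
  have "w (odd t) True (odd t) False = 0" by (intro w_zero) auto
  then show ?case
    using Suc.IH[OF h] pc_le[OF h] card_set_decode_rec[of t]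
    by (cases "odd t") (simp_all add: Suc_diff_le)
qed simp

lemma block_diag_pos: "t < 2 ^ k \<Longrightarrow> 0 < block w k True t t True"
  unfolding block_diag using pos by (intro mult_pos_pos zero_less_power) auto

lemma block_Suc_pos:
  assumes "of_bool (odd t) + of_bool i = (of_bool (odd t') + of_bool l :: nat)"
    and "0 < block w k l (t div 2) (t' div 2) j"
  shows "0 < block w (Suc k) i t t' j"
proof -
  have 1: "0 < w (odd t) i (odd t') l * block w k l (t div 2) (t' div 2) j"
    using assms by (intro mult_pos_pos pos)
  have 2: "0 \<le> w (odd t) i (odd t') l' * block w k l' (t div 2) (t' div 2) j" for l'
    by (intro mult_nonneg_nonneg nonneg block_nonneg)
  show ?thesis
    using 1 2[of "\<not> l"] by (cases l) (simp_all add: add_pos_nonneg add_nonneg_pos)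
qed

text \<open>An explicit history: if \<open>Suc h < k\<close>, the arrow crosses the empty first
  column and the h occupied ones behind it and turns up in the next; if \<open>Suc h = k\<close>, it
  turns up in the first column, the only empty one.\<close>

lemma block_pack_pos:
  assumes "h < k"
  shows "0 < block w k True (pack k h) (pack k (Suc h)) False"
proof -
  have zero: "0 < block w m False 0 0 False" for m
  proof (induction m)
    case (Suc m)
    show ?case by (rule block_Suc_pos[where l = False]) (simp_all add: Suc)
  qed simp
  have full: "0 < block w m False (2 ^ m - 1) (2 ^ m - 1) False" for m
  proof (induction m)
    case (Suc m)
    show ?case
    proof (rule block_Suc_pos[where l = False])
      show "0 < block w m False ((2 ^ Suc m - 1) div 2) ((2 ^ Suc m - 1) div 2) False"
        unfolding ones by (rule Suc)
    qed simp
  qed simp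
  have step: "0 < block w m True (2 ^ n - 1) (2 ^ Suc n - 1) False" if "n < m" for n m
    using that
  proof (induction n arbitrary: m)
    case 0
    then obtain m' where m': "m = Suc m'" by (cases m) auto
    show ?case unfolding m' by (rule block_Suc_pos[where l = False]) (simp_all add: zero)
  next
    case (Suc n)
    then obtain m' where m': "m = Suc m'" "n < m'" by (cases m) auto
    show ?case
      unfolding m'(1)
    proof (rule block_Suc_pos[where l = True])
      show "0 < block w m' True ((2 ^ Suc n - 1) div 2) ((2 ^ Suc (Suc n) - 1) div 2) False"
        unfolding ones by (rule Suc.IH[OF m'(2)])
      show "of_bool (odd (2 ^ Suc n - 1 :: nat)) + of_bool True =
          (of_bool (odd (2 ^ Suc (Suc n) - 1 :: nat)) + of_bool True :: nat)"
        using ones(2)[of n] ones(2)[of "Suc n"] by (simp only: simp_thms)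
    qed
  qed
  obtain m where k: "k = Suc m" and h: "h \<le> m" using assms by (cases k) auto
  show ?thesis
  proof (cases "h < m")
    case True
    then show ?thesis
      using step[OF True] unfolding k
      by (simp add: pack_def del: block.simps) (rule block_Suc_pos[where l = True], simp_all)
  next
    case False
    then have p: "pack k h = 2 * (2 ^ m - 1)" "pack k (Suc h) = 2 ^ Suc m - 1"
      using h by (simp_all add: pack_def k)
    show ?thesis
      unfolding p unfolding k
    proof (rule block_Suc_pos[where l = False])
      show "0 < block w m False (2 * (2 ^ m - 1) div 2) ((2 ^ Suc m - 1) div 2) False"
        unfolding ones using full[of m] by simp
      show "of_bool (odd (2 * (2 ^ m - 1) :: nat)) + of_bool True =
          (of_bool (odd (2 ^ Suc m - 1 :: nat)) + of_bool False :: nat)"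
        using ones(2)[of m] by simp
    qed
  qed
qed

end

context commuting_rows begin

sublocale T: ice_pos "wT q \<beta>" False
proof
  show "0 < wT q \<beta> a i c j" if "of_bool a + of_bool i = (of_bool c + of_bool j :: nat)" for a i c j
    using that q b qb by (cases a; cases i; cases c; cases j) simp_all
qed

sublocale D: ice_pos "wD q \<beta>'" True
proof
  show "0 < wD q \<beta>' a i c j" if "of_bool a + of_bool i = (of_bool c + of_bool j :: nat)" for a i c j
    using that q b qb by (cases a; cases i; cases c; cases j) (simp_all add: wD_def)
qed

end

text \<open>If an arrow leaves the block of columns on the right, then the row replaces \<open>t\<close> by some \<open>t' \<le> t\<close>, so
  that for large \<open>L\<close> the factor \<open>L ^ t\<close> makes everything negligible against the diagonal entry.
  Otherwise the block gains an arrow, and the factor \<open>c ^ (k - pc t)\<close> pays for that. Hence a row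
  multiplies the constant \<open>K\<close> by at most \<open>1 + \<epsilon>\<close>.\<close>

definition dominated :: "nat \<Rightarrow> real \<Rightarrow> real \<Rightarrow> real \<Rightarrow> (nat \<Rightarrow> ennreal) \<Rightarrow> (nat \<Rightarrow> ennreal) \<Rightarrow> bool" where
  "dominated k c L K g g' \<longleftrightarrow> (\<forall>t<2 ^ k. \<forall>A.
     g (t + 2 ^ k * A) \<le> ennreal (K * c ^ (k - pc t) * L ^ t) * g' (pack k (pc t) + 2 ^ k * A))"

lemma sum_ennreal_mult:
  "(\<And>i. i \<in> I \<Longrightarrow> 0 \<le> f i) \<Longrightarrow> (\<Sum>i\<in>I. ennreal (f i) * y) = ennreal (sum f I) * y"
  by (simp add: sum_distrib_right[symmetric])

context ice_pos
begin

lemma block_True_bound: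
  assumes "0 < \<epsilon>"
  obtains L0 where "\<And>L t. L0 \<le> L \<Longrightarrow> 1 \<le> L \<Longrightarrow> t < 2 ^ k \<Longrightarrow>
    (\<Sum>t'<2 ^ k. block w k True t t' True * L ^ t') \<le> (1 + \<epsilon>) * block w k True t t True * L ^ t"
proof
  let ?d = "\<lambda>t. block w k True t t True"
  let ?S = "\<lambda>t. \<Sum>t'<2 ^ k. block w k True t t' True"
  fix L :: real and t :: nat
  \<comment> \<open>This assumption supplies the witness \<open>L0\<close>: a sum over all t, hence
    at least each single quotient.\<close>
  assume L: "(\<Sum>t<2 ^ k. ?S t / (\<epsilon> * ?d t)) \<le> L" "1 \<le> L" and t: "t < 2 ^ k"
  have S: "0 \<le> ?S t" for t by (intro sum_nonneg block_nonneg)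
  have d: "0 < ?d t" by (rule block_diag_pos[OF t])
  have "?S t / (\<epsilon> * ?d t) \<le> (\<Sum>t<2 ^ k. ?S t / (\<epsilon> * ?d t))"
    using t assms S block_nonneg by (intro member_le_sum) auto
  with L have "?S t / (\<epsilon> * ?d t) \<le> L" by linarith
  then have SL: "?S t \<le> \<epsilon> * ?d t * L"
    using assms d by (simp add: pos_divide_le_eq mult.commute)
  have "block w k True t t' True * L ^ t' \<le>
      (if t' = t then ?d t * L ^ t else 0) + block w k True t t' True * (L ^ t / L)" if "t' < 2 ^ k" for t'
  proof (cases "t' = t \<or> block w k True t t' True = 0")
    case True
    then show ?thesis using L block_nonneg[of k True t t' True] by auto
  next
    case False
    then have "t' < t" using block_triangular[of k True t t'] t that by auto
    then have "L ^ t' \<le> L ^ (t - 1)" using L by (intro power_increasing) auto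
    also have "L ^ (t - 1) = L ^ t / L" using L \<open>t' < t\<close> by (cases t) auto
    finally have "L ^ t' \<le> L ^ t / L" .
    from mult_left_mono[OF this block_nonneg[of k True t t' True]] show ?thesis using False by simp
  qed
  then have "(\<Sum>t'<2 ^ k. block w k True t t' True * L ^ t') \<le>
      (\<Sum>t'<2 ^ k. (if t' = t then ?d t * L ^ t else 0) + block w k True t t' True * (L ^ t / L))"
    by (intro sum_mono) auto
  also have "\<dots> = ?d t * L ^ t + ?S t * (L ^ t / L)"
    using t by (simp add: sum.distrib sum_distrib_right sum_divide_distrib)
  also have "?S t * (L ^ t / L) \<le> \<epsilon> * ?d t * L * (L ^ t / L)"
    using SL L by (intro mult_right_mono) auto
  also have "\<epsilon> * ?d t * L * (L ^ t / L) = \<epsilon> * ?d t * L ^ t" using L by simp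
  finally show "(\<Sum>t'<2 ^ k. block w k True t t' True * L ^ t') \<le> (1 + \<epsilon>) * ?d t * L ^ t"
    by (simp add: algebra_simps)
qed

text \<open>The bound \<open>c0\<close> depends on L, so L has to be fixed before c. The divisor is
  positive by \<open>block_pack_pos\<close>.\<close>

lemma block_False_bound:
  assumes "1 \<le> L"
  obtains c0 where "\<And>c t. c0 \<le> c \<Longrightarrow> t < 2 ^ k \<Longrightarrow> pc t < k \<Longrightarrow>
    (\<Sum>t'<2 ^ k. block w k True t t' False * L ^ t') \<le>
      c * block w k True (pack k (pc t)) (pack k (Suc (pc t))) False * L ^ t"
proof
  let ?p = "\<lambda>t. block w k True (pack k (pc t)) (pack k (Suc (pc t))) False"
  let ?S = "\<lambda>t. \<Sum>t'<2 ^ k. block w k True t t' False * L ^ t'"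
  fix c :: real and t :: nat
  assume c: "(\<Sum>t<2 ^ k. ?S t / ?p t) \<le> c" and t: "t < 2 ^ k" "pc t < k"
  have S: "0 \<le> ?S t" for t using assms by (intro sum_nonneg mult_nonneg_nonneg block_nonneg) auto
  have p: "0 < ?p t" by (rule block_pack_pos[OF t(2)])
  have "?S t / ?p t \<le> (\<Sum>t<2 ^ k. ?S t / ?p t)"
    using t S block_nonneg by (intro member_le_sum) auto
  with c have "?S t / ?p t \<le> c" by linarith
  then have 1: "?S t \<le> c * ?p t" using p by (simp add: pos_divide_le_eq)
  also have "c * ?p t * 1 \<le> c * ?p t * L ^ t"
    using 1 S[of t] assms by (intro mult_left_mono) auto
  finally show "?S t \<le> c * ?p t * L ^ t" by simp
qed

lemma dominated_transfer:
  assumes L: "1 \<le> L" and c: "1 \<le> c" and K: "0 \<le> K" and \<epsilon>: "0 < \<epsilon>"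
    and bT: "\<And>t. t < 2 ^ k \<Longrightarrow>
      (\<Sum>t'<2 ^ k. block w k True t t' True * L ^ t') \<le> (1 + \<epsilon>) * block w k True t t True * L ^ t"
    and bF: "\<And>t. t < 2 ^ k \<Longrightarrow> pc t < k \<Longrightarrow>
      (\<Sum>t'<2 ^ k. block w k True t t' False * L ^ t') \<le>
        c * block w k True (pack k (pc t)) (pack k (Suc (pc t))) False * L ^ t"
    and dom: "dominated k c L K g g'"
  shows "dominated k c L ((1 + \<epsilon>) * K) (transfer (row_weight w e True) g) (transfer (row_weight w e True) g')"
  unfolding dominated_def
proof (intro allI impI)
  fix t A :: nat
  assume t: "t < 2 ^ k"
  define h where "h = pc t"
  define p where "p = pack k h"
  have h: "h \<le> k" unfolding h_def by (rule pc_le[OF t])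
  let ?M = "K * c ^ (k - h) * L ^ t"
  have M: "0 \<le> ?M" using K c L by simp
  define X where "X j t' = transfer (row_weight w e j) (\<lambda>B. g (t' + 2 ^ k * B)) A" for j t'
  define Y where "Y j h' = transfer (row_weight w e j) (\<lambda>B. g' (pack k h' + 2 ^ k * B)) A" for j h'
  have XY: "X j t' \<le> ennreal (K * c ^ (k - pc t') * L ^ t') * Y j (pc t')" if "t' < 2 ^ k" for j t'
    unfolding X_def Y_def transfer_cmult[symmetric]
    using dom that by (intro transfer_mono) (auto simp: dominated_def)
  \<comment> \<open>Above the packed block only two of the nonnegative terms are kept: the block is
    unchanged and the arrow leaves it, or the block takes up the arrow and is packed again.\<close>
  have lower: "ennreal (block w k True p p True) * Y True h \<le>
      (\<Sum>t'<2 ^ k. ennreal (block w k True p t' True) * transfer (row_weight w e True) (\<lambda>B. g' (t' + 2 ^ k * B)) A)"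
    unfolding Y_def p_def
    using member_le_sum[of "pack k h" "{..<2 ^ k}" "\<lambda>t'. ennreal (block w k True (pack k h) t' True) *
      transfer (row_weight w e True) (\<lambda>B. g' (t' + 2 ^ k * B)) A"] pack_less by simp
  have lower': "ennreal (block w k True p (pack k (Suc h)) False) * Y False (Suc h) \<le>
      (\<Sum>t'<2 ^ k. ennreal (block w k True p t' False) * transfer (row_weight w e False) (\<lambda>B. g' (t' + 2 ^ k * B)) A)"
    unfolding Y_def
    using member_le_sum[of "pack k (Suc h)" "{..<2 ^ k}" "\<lambda>t'. ennreal (block w k True p t' False) *
      transfer (row_weight w e False) (\<lambda>B. g' (t' + 2 ^ k * B)) A"] pack_less by simp
  have upT: "(\<Sum>t'<2 ^ k. ennreal (block w k True t t' True) * X True t') \<le>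
      ennreal ((1 + \<epsilon>) * ?M) * (ennreal (block w k True p p True) * Y True h)"
  proof -
    have "(\<Sum>t'<2 ^ k. ennreal (block w k True t t' True) * X True t') \<le>
        (\<Sum>t'<2 ^ k. ennreal (block w k True t t' True * (K * c ^ (k - h) * L ^ t')) * Y True h)"
    proof (intro sum_mono)
      fix t' :: nat assume "t' \<in> {..<2 ^ k}"
      then have t': "t' < 2 ^ k" by simp
      show "ennreal (block w k True t t' True) * X True t' \<le>
          ennreal (block w k True t t' True * (K * c ^ (k - h) * L ^ t')) * Y True h"
      proof (cases "block w k True t t' True = 0")
        case False
        then have "pc t' = h" using block_card[of k True t t' True] t t' by (simp add: h_def)
        then show ?thesis
          using mult_left_mono[OF XY[OF t', of True], of "ennreal (block w k True t t' True)"] K c L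
          by (simp add: ennreal_mult'' ennreal_mult block_nonneg mult.assoc)
      qed simp
    qed
    also have "\<dots> = ennreal (\<Sum>t'<2 ^ k. block w k True t t' True * (K * c ^ (k - h) * L ^ t')) * Y True h"
      using K c L by (intro sum_ennreal_mult mult_nonneg_nonneg block_nonneg) auto
    also have "(\<Sum>t'<2 ^ k. block w k True t t' True * (K * c ^ (k - h) * L ^ t')) =
        K * c ^ (k - h) * (\<Sum>t'<2 ^ k. block w k True t t' True * L ^ t')"
      by (simp add: sum_distrib_left ac_simps)
    also have "ennreal (K * c ^ (k - h) * (\<Sum>t'<2 ^ k. block w k True t t' True * L ^ t')) * Y True h \<le>
        ennreal (K * c ^ (k - h) * ((1 + \<epsilon>) * block w k True t t True * L ^ t)) * Y True h"
      using bT[OF t] K c by (intro mult_right_mono ennreal_leI mult_left_mono) auto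
    also have "block w k True t t True = block w k True p p True"
      using h unfolding p_def block_diag[OF t] block_diag[OF pack_less] h_def by (simp only: pc_pack)
    also have "K * c ^ (k - h) * ((1 + \<epsilon>) * block w k True p p True * L ^ t) =
        (1 + \<epsilon>) * ?M * block w k True p p True" by (simp only: ac_simps)
    also have "ennreal ((1 + \<epsilon>) * ?M * block w k True p p True) * Y True h =
        ennreal ((1 + \<epsilon>) * ?M) * (ennreal (block w k True p p True) * Y True h)"
      using M \<epsilon> by (subst ennreal_mult) (auto simp: block_nonneg mult.assoc)
    finally show ?thesis .
  qed
  have upF: "(\<Sum>t'<2 ^ k. ennreal (block w k True t t' False) * X False t') \<le>
      ennreal ((1 + \<epsilon>) * ?M) * (ennreal (block w k True p (pack k (Suc h)) False) * Y False (Suc h))"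
  proof (cases "h < k")
    \<comment> \<open>A full block cannot take up another arrow.\<close>
    case False
    have "block w k True t t' False = 0" if "t' < 2 ^ k" for t'
      using block_card[of k True t t' False] pc_le[OF that] t that False unfolding h_def
      by (cases "block w k True t t' False = 0") auto
    then show ?thesis by simp
  next
    case True
    let ?b = "block w k True p (pack k (Suc h)) False"
    have "(\<Sum>t'<2 ^ k. ennreal (block w k True t t' False) * X False t') \<le>
        (\<Sum>t'<2 ^ k. ennreal (block w k True t t' False * (K * c ^ (k - Suc h) * L ^ t')) * Y False (Suc h))"
    proof (intro sum_mono)
      fix t' :: nat assume "t' \<in> {..<2 ^ k}"
      then have t': "t' < 2 ^ k" by simp
      show "ennreal (block w k True t t' False) * X False t' \<le>
          ennreal (block w k True t t' False * (K * c ^ (k - Suc h) * L ^ t')) * Y False (Suc h)"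
      proof (cases "block w k True t t' False = 0")
        case False
        then have "pc t' = Suc h" using block_card[of k True t t' False] t t' by (simp add: h_def)
        then show ?thesis
          using mult_left_mono[OF XY[OF t', of False], of "ennreal (block w k True t t' False)"] K c L
          by (simp add: ennreal_mult'' ennreal_mult block_nonneg mult.assoc)
      qed simp
    qed
    also have "\<dots> = ennreal (\<Sum>t'<2 ^ k. block w k True t t' False * (K * c ^ (k - Suc h) * L ^ t')) * Y False (Suc h)"
      using K c L by (intro sum_ennreal_mult mult_nonneg_nonneg block_nonneg) auto
    also have "(\<Sum>t'<2 ^ k. block w k True t t' False * (K * c ^ (k - Suc h) * L ^ t')) =
        K * c ^ (k - Suc h) * (\<Sum>t'<2 ^ k. block w k True t t' False * L ^ t')"
      by (simp add: sum_distrib_left ac_simps)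
    also have "ennreal (K * c ^ (k - Suc h) * (\<Sum>t'<2 ^ k. block w k True t t' False * L ^ t')) * Y False (Suc h) \<le>
        ennreal (K * c ^ (k - Suc h) * (c * ?b * L ^ t)) * Y False (Suc h)"
      using bF[OF t] True K c unfolding h_def p_def
      by (intro mult_right_mono ennreal_leI mult_left_mono) auto
    also have "K * c ^ (k - Suc h) * (c * ?b * L ^ t) = 1 * (?M * ?b)"
      using True by (simp add: Suc_diff_Suc[symmetric] ac_simps)
    also have "ennreal (1 * (?M * ?b)) * Y False (Suc h) \<le> ennreal ((1 + \<epsilon>) * (?M * ?b)) * Y False (Suc h)"
      using M \<epsilon> block_nonneg by (intro mult_right_mono ennreal_leI) auto
    also have "(1 + \<epsilon>) * (?M * ?b) = (1 + \<epsilon>) * ?M * ?b" by (simp only: mult.assoc)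
    also have "ennreal ((1 + \<epsilon>) * ?M * ?b) * Y False (Suc h) =
        ennreal ((1 + \<epsilon>) * ?M) * (ennreal ?b * Y False (Suc h))"
      using M \<epsilon> by (subst ennreal_mult) (auto simp: block_nonneg mult.assoc)
    finally show ?thesis .
  qed
  have "transfer (row_weight w e True) g (t + 2 ^ k * A) =
     (\<Sum>t'<2 ^ k. ennreal (block w k True t t' False) * X False t') +
     (\<Sum>t'<2 ^ k. ennreal (block w k True t t' True) * X True t')"
    unfolding X_def by (rule transfer_block[OF t])
  also have "\<dots> \<le>
     ennreal ((1 + \<epsilon>) * ?M) * (ennreal (block w k True p (pack k (Suc h)) False) * Y False (Suc h)) +
     ennreal ((1 + \<epsilon>) * ?M) * (ennreal (block w k True p p True) * Y True h)"
    by (rule add_mono[OF upF upT])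
  also have "\<dots> \<le> ennreal ((1 + \<epsilon>) * ?M) * transfer (row_weight w e True) g' (p + 2 ^ k * A)"
    unfolding transfer_block[OF pack_less[of k h, folded p_def]] distrib_left[symmetric]
    by (intro mult_left_mono add_mono lower lower') simp
  finally show "transfer (row_weight w e True) g (t + 2 ^ k * A) \<le>
      ennreal ((1 + \<epsilon>) * K * c ^ (k - pc t) * L ^ t) * transfer (row_weight w e True) g' (pack k (pc t) + 2 ^ k * A)"
    by (simp add: h_def p_def mult.assoc)
qed

end

context commuting_rows begin

definition full :: "nat \<Rightarrow> nat \<Rightarrow> bool" where "full k C \<longleftrightarrow> C mod 2 ^ k = 2 ^ k - 1"

text \<open>Start from the constant 1 dominated by itself and apply m D-rows. A block that is not
  full is packed into one avoiding the first column, so the right-hand function may be replaced by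
  \<open>ev (F m)\<close> at that moment; then n T-rows follow.\<close>

lemma not_full_bound:
  assumes "0 < \<epsilon>"
  obtains c where "0 \<le> c"
    "\<And>n m. (TT ^^ n) (\<lambda>C. if full k C then 0 else F m C) 0 \<le> ennreal (c * (1 + \<epsilon>) ^ (n + m)) * e n m"
proof -
  obtain L1 where L1: "\<And>L t. L1 \<le> L \<Longrightarrow> 1 \<le> L \<Longrightarrow> t < 2 ^ k \<Longrightarrow>
    (\<Sum>t'<2 ^ k. block (wT q \<beta>) k True t t' True * L ^ t') \<le> (1 + \<epsilon>) * block (wT q \<beta>) k True t t True * L ^ t"
    by (rule T.block_True_bound[OF assms, where k = k]) (erule that)
  obtain L2 where L2: "\<And>L t. L2 \<le> L \<Longrightarrow> 1 \<le> L \<Longrightarrow> t < 2 ^ k \<Longrightarrow>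
    (\<Sum>t'<2 ^ k. block (wD q \<beta>') k True t t' True * L ^ t') \<le> (1 + \<epsilon>) * block (wD q \<beta>') k True t t True * L ^ t"
    by (rule D.block_True_bound[OF assms, where k = k]) (erule that)
  \<comment> \<open>One L, and after it one c, must serve both kinds of rows.\<close>
  define L where "L = max 1 (max L1 L2)"
  have L: "1 \<le> L" "L1 \<le> L" "L2 \<le> L" by (auto simp: L_def)
  obtain c1 where c1: "\<And>c t. c1 \<le> c \<Longrightarrow> t < 2 ^ k \<Longrightarrow> pc t < k \<Longrightarrow>
    (\<Sum>t'<2 ^ k. block (wT q \<beta>) k True t t' False * L ^ t') \<le>
      c * block (wT q \<beta>) k True (pack k (pc t)) (pack k (Suc (pc t))) False * L ^ t"
    by (rule T.block_False_bound[OF L(1), where k = k]) (erule that)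
  obtain c2 where c2: "\<And>c t. c2 \<le> c \<Longrightarrow> t < 2 ^ k \<Longrightarrow> pc t < k \<Longrightarrow>
    (\<Sum>t'<2 ^ k. block (wD q \<beta>') k True t t' False * L ^ t') \<le>
      c * block (wD q \<beta>') k True (pack k (pc t)) (pack k (Suc (pc t))) False * L ^ t"
    by (rule D.block_False_bound[OF L(1), where k = k]) (erule that)
  define c where "c = max 1 (max c1 c2)"
  have c: "1 \<le> c" "c1 \<le> c" "c2 \<le> c" by (auto simp: c_def)
  have stepT: "dominated k c L ((1 + \<epsilon>) * K) (TT g) (TT g')" if "dominated k c L K g g'" "0 \<le> K" for K g g'
    by (rule T.dominated_transfer[OF L(1) c(1) that(2) assms L1[OF L(2) L(1)] c1[OF c(2)] that(1)])
  have stepD: "dominated k c L ((1 + \<epsilon>) * K) (DD g) (DD g')" if "dominated k c L K g g'" "0 \<le> K" for K g g'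
    by (rule D.dominated_transfer[OF L(1) c(1) that(2) assms L2[OF L(3) L(1)] c2[OF c(3)] that(1)])
  have pow: "0 \<le> (1 + \<epsilon>) ^ n" for n using assms by simp
  have Fm: "dominated k c L ((1 + \<epsilon>) ^ m) (F m) (F m)" for m
  proof (induction m)
    case 0
    have "1 \<le> c ^ i * L ^ t" for i t
      using c L mult_mono[of 1 "c ^ i" 1 "L ^ t"] by (simp add: one_le_power)
    then show ?case by (simp add: dominated_def F_def)
  next
    case (Suc m)
    from stepD[OF this pow] show ?case by (simp add: F_def)
  qed
  have ev: "dominated k c L ((1 + \<epsilon>) ^ m) (\<lambda>C. if full k C then 0 else F m C) (ev (F m))" for m
    unfolding dominated_def
  proof (intro allI impI)
    fix t A :: nat assume t: "t < 2 ^ k"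
    show "(if full k (t + 2 ^ k * A) then 0 else F m (t + 2 ^ k * A)) \<le>
      ennreal ((1 + \<epsilon>) ^ m * c ^ (k - pc t) * L ^ t) * ev (F m) (pack k (pc t) + 2 ^ k * A)"
    proof (cases "full k (t + 2 ^ k * A)")
      case False
      then have "t \<noteq> 2 ^ k - 1" using t by (simp add: full_def)
      then have "pc t < k" using pc_le[OF t] pc_full[OF t] by linarith
      then have "even (pack k (pc t) + 2 ^ k * A)" by (auto simp: pack_def)
      then show ?thesis using Fm[of m] t False by (simp add: ev_def dominated_def)
    qed simp
  qed
  have dm: "dominated k c L ((1 + \<epsilon>) ^ (n + m)) ((TT ^^ n) (\<lambda>C. if full k C then 0 else F m C)) ((TT ^^ n) (ev (F m)))" for n m
  proof (induction n)
    case 0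
    then show ?case using ev by simp
  next
    case (Suc n)
    from stepT[OF this pow] show ?case by simp
  qed
  \<comment> \<open>At the empty set the domination factor reduces to \<open>c ^ k\<close>, and
    packing changes nothing.\<close>
  have "(TT ^^ n) (\<lambda>C. if full k C then 0 else F m C) (0 + 2 ^ k * 0) \<le>
      ennreal ((1 + \<epsilon>) ^ (n + m) * c ^ (k - pc 0) * L ^ 0) * (TT ^^ n) (ev (F m)) (pack k (pc 0) + 2 ^ k * 0)" for n m
    using dm[of n m, unfolded dominated_def, THEN spec, of 0, THEN mp, THEN spec, of 0] by simp
  moreover have "pack k 0 = 0" by (simp add: pack_def)
  ultimately show ?thesis
    using c by (intro that[of "c ^ k"]) (simp_all add: e_def mult.commute)
qed

end

subsection \<open>Path collections as flows\<close>

definition strip_edge :: "nat \<Rightarrow> edge \<Rightarrow> bool" where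
  "strip_edge R e \<longleftrightarrow>
     (\<exists>x y. e = ((x, y), (x + 1, y)) \<and> -1 \<le> x \<and> 1 \<le> y \<and> y \<le> int R) \<or>
     (\<exists>x y. e = ((x, y), (x, y + 1)) \<and> 0 \<le> x \<and> 0 \<le> y \<and> y \<le> int R)"

text \<open>What is left of a path collection when the paths are forgotten: finite support and
  conservation at every vertex. Paths are rebuilt from it later, in a way that suits the
  counting.\<close>

definition flow :: "nat \<Rightarrow> config \<Rightarrow> bool" where
  "flow R \<omega> \<longleftrightarrow> (\<forall>e. \<omega> e \<noteq> 0 \<longrightarrow> strip_edge R e) \<and> finite {e. \<omega> e \<noteq> 0} \<and>
     (\<forall>x y. 0 \<le> x \<longrightarrow> 1 \<le> y \<longrightarrow> y \<le> int R \<longrightarrow>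
       \<omega> ((x, y - 1), (x, y)) + \<omega> ((x - 1, y), (x, y)) =
       \<omega> ((x, y), (x, y + 1)) + \<omega> ((x, y), (x + 1, y)))"

text \<open>Conservation determines the horizontal arrows of a row from left to right, given the
  vertical ones and the arrow at the left end.\<close>

lemma flow_eqI:
  assumes "flow R \<omega>" "flow R \<omega>'"
    and vertical: "\<And>x y. 0 \<le> x \<Longrightarrow> 0 \<le> y \<Longrightarrow> y \<le> int R \<Longrightarrow> \<omega> ((x, y), (x, y + 1)) = \<omega>' ((x, y), (x, y + 1))"
    and left: "\<And>y. 1 \<le> y \<Longrightarrow> y \<le> int R \<Longrightarrow> \<omega> ((-1, y), (0, y)) = \<omega>' ((-1, y), (0, y))"
  shows "\<omega> = \<omega>'"
proof
  fix e
  have h: "\<omega> ((int n - 1, y), (int n, y)) = \<omega>' ((int n - 1, y), (int n, y))" if y: "1 \<le> y" "y \<le> int R" for n y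
  proof (induction n)
    case 0
    then show ?case using left[OF y] by simp
  next
    case (Suc n)
    have "\<omega> ((int n, y - 1), (int n, y)) = \<omega>' ((int n, y - 1), (int n, y))"
      "\<omega> ((int n, y), (int n, y + 1)) = \<omega>' ((int n, y), (int n, y + 1))"
      using vertical[of "int n" "y - 1"] vertical[of "int n" y] y by auto
    moreover have "\<omega> ((int n, y - 1), (int n, y)) + \<omega> ((int n - 1, y), (int n, y)) =
       \<omega> ((int n, y), (int n, y + 1)) + \<omega> ((int n, y), (int n + 1, y))"
      "\<omega>' ((int n, y - 1), (int n, y)) + \<omega>' ((int n - 1, y), (int n, y)) =
       \<omega>' ((int n, y), (int n, y + 1)) + \<omega>' ((int n, y), (int n + 1, y))"
      using assms(1,2) y by (auto simp: flow_def)
    ultimately show ?case using Suc by (simp add: add.commute)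
  qed
  show "\<omega> e = \<omega>' e"
  proof (cases "strip_edge R e")
    case False
    then have "\<omega> e = 0" "\<omega>' e = 0" using assms(1,2) unfolding flow_def by blast+
    then show ?thesis by simp
  next
    case True
    then consider x y where "e = ((x, y), (x + 1, y))" "-1 \<le> x" "1 \<le> y" "y \<le> int R"
      | x y where "e = ((x, y), (x, y + 1))" "0 \<le> x" "0 \<le> y" "y \<le> int R"
      unfolding strip_edge_def by blast
    then show ?thesis
    proof cases
      case 1
      then show ?thesis using h[of y "nat (x + 1)"] by simp
    next
      case 2
      then show ?thesis using vertical by simp
    qed
  qed
qed

lemma flow_sum:
  assumes "finite I" "\<And>m. m \<in> I \<Longrightarrow> flow R (f m)"
  shows "flow R (\<lambda>e. \<Sum>m\<in>I. f m e)"
proof -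
  have "{e. (\<Sum>m\<in>I. f m e) \<noteq> 0} \<subseteq> (\<Union>m\<in>I. {e. f m e \<noteq> 0})"
    using assms(1) by auto
  moreover have "finite (\<Union>m\<in>I. {e. f m e \<noteq> 0})"
    using assms by (auto simp: flow_def)
  ultimately have "finite {e. (\<Sum>m\<in>I. f m e) \<noteq> 0}" by (rule finite_subset)
  moreover have "\<exists>m\<in>I. f m e \<noteq> 0" if "(\<Sum>m\<in>I. f m e) \<noteq> 0" for e
    using that by (meson sum.neutral)
  then have "strip_edge R e" if "(\<Sum>m\<in>I. f m e) \<noteq> 0" for e
    using assms(2) that unfolding flow_def by blast
  moreover have "(\<Sum>m\<in>I. f m ((x, y - 1), (x, y))) + (\<Sum>m\<in>I. f m ((x - 1, y), (x, y))) =
       (\<Sum>m\<in>I. f m ((x, y), (x, y + 1))) + (\<Sum>m\<in>I. f m ((x, y), (x + 1, y)))"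
    if "0 \<le> x" "1 \<le> y" "y \<le> int R" for x y
    unfolding sum.distrib[symmetric]
  proof (rule sum.cong[OF refl])
    fix m assume "m \<in> I"
    from assms(2)[OF this] that
    show "f m ((x, y - 1), (x, y)) + f m ((x - 1, y), (x, y)) =
       f m ((x, y), (x, y + 1)) + f m ((x, y), (x + 1, y))"
      unfolding flow_def by blast
  qed
  ultimately show ?thesis unfolding flow_def by blast
qed

lemma arrows_eq_sum: "arrows N p = (\<lambda>e. \<Sum>m\<in>{1..N}. of_bool (e \<in> path_edges (p m)))"
  by (simp add: arrows_def fun_eq_iff of_bool_def sum.If_cases Int_def conj_commute)

lemma path_edges_nth: "path_edges p = {(p ! i, p ! Suc i) | i. Suc i < length p}"
  unfolding path_edges_def set_zip
proof (intro Collect_cong ex_cong1)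
  fix e :: edge and i
  show "(e = (p ! i, tl p ! i) \<and> i < min (length p) (length (tl p))) =
    (e = (p ! i, p ! Suc i) \<and> Suc i < length p)"
    by (cases "Suc i < length p") (auto simp: nth_tl)
qed

locale strip_walk =
  fixes R :: nat and a b c d :: point and p :: "point list"
  assumes walk: "strip_path R (a, b) (c, d) p"
    and ends: "a \<notin> strip R" "d \<notin> strip R" "strip_edge R (a, b)"
begin

lemma step: "Suc i < length p \<Longrightarrow>
    p ! Suc i = (fst (p ! i) + 1, snd (p ! i)) \<or> p ! Suc i = (fst (p ! i), snd (p ! i) + 1)"
proof -
  assume i: "Suc i < length p"
  have "up_right p" using walk unfolding strip_path_def prod.case by (rule conjunct1)
  then have "Suc i < length p \<longrightarrow>
      (case p ! i of (x, y) \<Rightarrow> p ! Suc i = (x + 1, y) \<or> p ! Suc i = (x, y + 1))"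
    unfolding up_right_def by (rule spec)
  from this i have "case p ! i of (x, y) \<Rightarrow> p ! Suc i = (x + 1, y) \<or> p ! Suc i = (x, y + 1)"
    by (rule mp)
  then show ?thesis by (simp only: case_prod_beta)
qed

text \<open>The sum of the coordinates grows by one with every step; hence a path visits each vertex
  at most once, which makes its edge indicator a flow.\<close>

lemma height: "i < length p \<Longrightarrow> fst (p ! i) + snd (p ! i) = fst (p ! 0) + snd (p ! 0) + int i"
proof (induction i)
  case (Suc i)
  have "fst (p ! i) + snd (p ! i) = fst (p ! 0) + snd (p ! 0) + int i"
    using Suc by simp
  then show ?case using step[OF Suc.prems] by (elim disjE) simp_all
qed simp

lemma nth_inj: "i < length p \<Longrightarrow> j < length p \<Longrightarrow> p ! i = p ! j \<Longrightarrow> i = j"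
proof -
  assume "i < length p" "j < length p" "p ! i = p ! j"
  then have "fst (p ! 0) + snd (p ! 0) + int i = fst (p ! 0) + snd (p ! 0) + int j"
    using height[of i] height[of j] by metis
  then show ?thesis by simp
qed

lemma first: "2 < length p" "p ! 0 = a" "p ! 1 = b"
  and last: "p ! (length p - 1) = d" "p ! (length p - 2) = c"
  and inner: "\<And>i. 0 < i \<Longrightarrow> Suc i < length p \<Longrightarrow> p ! i \<in> strip R"
proof -
  obtain r' where p: "p = a # r' @ [d]" and r: "r' \<noteq> []" "hd r' = b" "List.last r' = c" "set r' \<subseteq> strip R"
    using conjunct2[OF walk[unfolded strip_path_def prod.case]] by blast
  show "2 < length p" using p r by (cases r') auto
  show "p ! 0 = a" "p ! 1 = b" using p r by (auto simp: hd_conv_nth nth_append)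
  show "p ! (length p - 1) = d" using p by simp
  show "p ! (length p - 2) = c" using p r by (cases r' rule: rev_cases) (auto simp: nth_append)
  show "p ! i \<in> strip R" if i: "0 < i" "Suc i < length p" for i
  proof -
    obtain k where k: "i = Suc k" using i by (cases i) auto
    have "k < length r'" using i p k by simp
    then show ?thesis using subsetD[OF r(4) nth_mem] p k by (simp add: nth_append)
  qed
qed

lemma edge_strip: "e \<in> path_edges p \<Longrightarrow> strip_edge R e"
proof -
  assume "e \<in> path_edges p"
  then obtain i where i: "e = (p ! i, p ! Suc i)" "Suc i < length p" by (auto simp: path_edges_nth)
  show ?thesis
  proof (cases "i = 0")
    case True
    then show ?thesis using i first ends by simp
  next
    case False
    then have "p ! i \<in> strip R" using inner i by simp
    then show ?thesis using step[OF i(2)] unfolding i(1) strip_edge_def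
      by (cases "p ! i") (auto simp: strip_def)
  qed
qed

lemma edge_from_outside: "(z, z') \<in> path_edges p \<Longrightarrow> z \<notin> strip R \<Longrightarrow> (z, z') = (a, b)"
proof -
  assume e: "(z, z') \<in> path_edges p" and z: "z \<notin> strip R"
  then obtain i where i: "z = p ! i" "z' = p ! Suc i" "Suc i < length p" by (auto simp: path_edges_nth)
  have "i = 0" using inner[of i] z i by auto
  then show ?thesis using i first by simp
qed

lemma edge_to_outside: "(z, z') \<in> path_edges p \<Longrightarrow> z' \<notin> strip R \<Longrightarrow> (z, z') = (c, d)"
proof -
  assume e: "(z, z') \<in> path_edges p" and z': "z' \<notin> strip R"
  then obtain i where i: "z = p ! i" "z' = p ! Suc i" "Suc i < length p" by (auto simp: path_edges_nth)
  have "\<not> Suc (Suc i) < length p" using inner[of "Suc i"] z' i by auto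
  then have "Suc i = length p - 1" "i = length p - 2" using i by auto
  then show ?thesis using i last by simp
qed

lemma first_edge: "(a, b) \<in> path_edges p"
  using first by (auto simp: path_edges_nth intro!: exI[of _ 0])

lemma last_edge: "(c, d) \<in> path_edges p"
  using first last unfolding path_edges_nth
  by (auto intro!: exI[of _ "length p - 2"] simp: Suc_diff_Suc numeral_2_eq_2)

lemma conservation:
  assumes "(x, y) \<in> strip R"
  shows "of_bool (((x, y - 1), (x, y)) \<in> path_edges p) + of_bool (((x - 1, y), (x, y)) \<in> path_edges p) =
    (of_bool (((x, y), (x, y + 1)) \<in> path_edges p) + of_bool (((x, y), (x + 1, y)) \<in> path_edges p) :: nat)"
proof (cases "(x, y) \<in> set p")
  case False
  have "(z, (x, y)) \<notin> path_edges p" "((x, y), z) \<notin> path_edges p" for z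
    using False set_zip_leftD[of _ _ p "tl p"] set_zip_rightD[of _ _ p "tl p"] list.set_sel(2)[of p]
    unfolding path_edges_def by (metis list.sel(2))+
  then show ?thesis by simp
next
  case True
  then obtain i where i: "i < length p" "p ! i = (x, y)" by (metis in_set_conv_nth)
  have "i \<noteq> 0" using ends(1) first(2) i(2) assms by metis
  moreover have i': "i \<noteq> length p - 1" using ends(2) last(1) i(2) assms by metis
  ultimately obtain j where j: "i = Suc j" by (cases i) auto
  have Si: "Suc i < length p" using i(1) i' by simp
  have e: "(p ! k, p ! Suc k) \<in> path_edges p" if "Suc k < length p" for k
    using that unfolding path_edges_nth by blast
  have in_edge: "(z, (x, y)) \<in> path_edges p \<longleftrightarrow> z = p ! j" for z
  proof
    assume "(z, (x, y)) \<in> path_edges p"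
    then obtain k where k: "z = p ! k" "(x, y) = p ! Suc k" "Suc k < length p"
      unfolding path_edges_nth by blast
    have "Suc k = i" by (rule nth_inj[OF k(3) i(1)]) (simp only: k(2)[symmetric] i(2))
    then show "z = p ! j" using k(1) j by simp
  next
    assume "z = p ! j"
    then show "(z, (x, y)) \<in> path_edges p" using e[of j] i j by simp
  qed
  have out_edge: "((x, y), z) \<in> path_edges p \<longleftrightarrow> z = p ! Suc i" for z
  proof
    assume "((x, y), z) \<in> path_edges p"
    then obtain k where k: "z = p ! Suc k" "(x, y) = p ! k" "Suc k < length p"
      unfolding path_edges_nth by blast
    have "k = i" by (rule nth_inj[OF Suc_lessD[OF k(3)] i(1)]) (simp only: k(2)[symmetric] i(2))
    then show "z = p ! Suc i" using k(1) by simp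
  next
    assume "z = p ! Suc i"
    then show "((x, y), z) \<in> path_edges p" using e[OF Si] i(2) by simp
  qed
  have "p ! j = (x - 1, y) \<or> p ! j = (x, y - 1)"
    using step[of j] i j by (cases "p ! j") auto
  moreover have "p ! Suc i = (x + 1, y) \<or> p ! Suc i = (x, y + 1)"
    using step[OF Si] unfolding i(2) by simp
  ultimately show ?thesis unfolding in_edge out_edge by (elim disjE) simp_all
qed

lemma indicator_flow: "flow R (\<lambda>e. of_bool (e \<in> path_edges p))"
  unfolding flow_def
proof (intro conjI allI impI)
  show "strip_edge R e" if "of_bool (e \<in> path_edges p) \<noteq> (0::nat)" for e
    using that edge_strip by simp
  show "finite {e. of_bool (e \<in> path_edges p) \<noteq> (0::nat)}"
    by (simp add: path_edges_def)
qed (intro conservation, simp add: strip_def)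

lemma edge_le_end: "((x, y), z) \<in> path_edges p \<Longrightarrow> x \<le> fst d"
proof -
  assume "((x, y), z) \<in> path_edges p"
  then obtain i where i: "(x, y) = p ! i" "Suc i < length p" by (auto simp: path_edges_nth)
  have "fst (p ! i) \<le> fst (p ! (i + k))" if "i + k < length p" for k
    using that
  proof (induction k)
    case (Suc k)
    then show ?case using step[of "i + k"] by auto
  qed simp
  from this[of "length p - 1 - i"] have "fst (p ! i) \<le> fst (p ! (length p - 1))" using i(2) by simp
  then show ?thesis using i(1) last(1) by (metis fst_conv)
qed

end

section \<open>Rebuilding a path from the columns in which it leaves the successive rows\<close>

fun row_path :: "int \<Rightarrow> int \<Rightarrow> int list \<Rightarrow> point list" where
  "row_path y x [] = [(x, y)]"
| "row_path y x (x' # xs) = map (\<lambda>i. (i, y)) [x..x'] @ row_path (y + 1) x' xs"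

definition unit_step :: "point \<Rightarrow> point \<Rightarrow> bool" where
  "unit_step z z' \<longleftrightarrow> z' = (fst z + 1, snd z) \<or> z' = (fst z, snd z + 1)"

lemma up_right_successively: "up_right p \<longleftrightarrow> successively unit_step p"
  unfolding up_right_def successively_conv_nth unit_step_def case_prod_beta ..

lemma path_edges_Cons: "path_edges (a # b # r) = insert (a, b) (path_edges (b # r))"
  by (simp add: path_edges_def)

lemma path_edges_single: "path_edges [a] = {}"
  by (simp add: path_edges_def)

lemma path_edges_append:
  "p \<noteq> [] \<Longrightarrow> r \<noteq> [] \<Longrightarrow> path_edges (p @ r) = path_edges p \<union> {(last p, hd r)} \<union> path_edges r"
proof (induction p rule: induct_list012)
  case (2 a)
  then show ?case by (cases r) (simp_all add: path_edges_Cons path_edges_single)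
next
  case (3 a b p)
  then show ?case by (simp add: path_edges_Cons insert_commute)
qed simp

lemma row_path_not_Nil: "row_path y x xs \<noteq> []"
proof (induction xs arbitrary: x y)
  case (Cons x' xs)
  then show ?case by simp
qed simp

lemma hd_row_path: "sorted (x # xs) \<Longrightarrow> hd (row_path y x xs) = (x, y)"
proof (cases xs)
  case (Cons x' xs')
  assume "sorted (x # xs)"
  then have "[x..x'] = x # [x + 1..x']" using Cons by (intro upto_rec1) simp
  then show ?thesis using Cons by simp
qed simp

lemma last_row_path: "last (row_path y x xs) = (last (x # xs), y + int (length xs))"
proof (induction xs arbitrary: x y)
  case (Cons x' xs)
  then show ?case by (simp add: row_path_not_Nil)
qed simp

lemma last_row:
  assumes "x \<le> x'" shows "last (map (\<lambda>i. (i, y)) [x..x']) = (x', y)" "[x..x'] \<noteq> []"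
  using assms upto_rec2[OF assms] by simp_all

lemma last_butlast_row_path:
  "sorted (x # xs) \<Longrightarrow> xs \<noteq> [] \<Longrightarrow>
    last (butlast (row_path y x xs)) = (last xs, y + int (length xs) - 1) \<and> butlast (row_path y x xs) \<noteq> []"
proof (induction xs arbitrary: x y)
  case (Cons x' xs)
  have le: "x \<le> x'" and s: "sorted (x' # xs)" using Cons.prems by simp_all
  show ?case
  proof (cases "xs = []")
    case True
    then show ?thesis using last_row(1)[OF le, of y] last_row(2)[OF le] by simp
  next
    case False
    then show ?thesis
      using Cons.IH[OF s False, of "y + 1"] last_row(1)[OF le, of y] last_row(2)[OF le]
      by (simp add: butlast_append row_path_not_Nil)
  qed
qed simp

lemma set_butlast_row_path:
  "sorted (x # xs) \<Longrightarrow> z \<in> set (butlast (row_path y x xs)) \<Longrightarrow>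
    x \<le> fst z \<and> y \<le> snd z \<and> snd z < y + int (length xs)"
proof (induction xs arbitrary: x y)
  case (Cons x' xs)
  have le: "x \<le> x'" and s: "sorted (x' # xs)" using Cons.prems by simp_all
  have "z \<in> set (map (\<lambda>i. (i, y)) [x..x']) \<or> z \<in> set (butlast (row_path (y + 1) x' xs))"
    using Cons.prems(2) by (simp add: butlast_append row_path_not_Nil)
  then show ?case
  proof
    assume "z \<in> set (map (\<lambda>i. (i, y)) [x..x'])"
    then show ?thesis by auto
  next
    assume "z \<in> set (butlast (row_path (y + 1) x' xs))"
    from Cons.IH[OF s this] le show ?thesis by auto
  qed
qed simp

lemma successively_row: "successively unit_step (map (\<lambda>i. (i, y)) [x..x'])"
  unfolding successively_conv_nth by (simp add: unit_step_def nth_upto)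

lemma successively_row_path: "sorted (x # xs) \<Longrightarrow> successively unit_step (row_path y x xs)"
proof (induction xs arbitrary: x y)
  case (Cons x' xs)
  have le: "x \<le> x'" and s: "sorted (x' # xs)" using Cons.prems by simp_all
  show ?case
    unfolding row_path.simps successively_append_iff hd_row_path[OF s] last_row(1)[OF le]
    using successively_row Cons.IH[OF s] by (simp add: unit_step_def)
qed simp

lemma path_edges_subset: "(z, z') \<in> path_edges p \<Longrightarrow> z \<in> set p \<and> z' \<in> set p"
  unfolding path_edges_def by (cases p) (auto dest: set_zip_leftD set_zip_rightD)

lemma vertical_row_path:
  "sorted (x # xs) \<Longrightarrow> ((X, Y), (X, Y + 1)) \<in> path_edges (row_path y x xs) \<longleftrightarrow>
    (\<exists>k<length xs. Y = y + int k \<and> X = xs ! k)"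
proof (induction xs arbitrary: x y)
  case Nil
  then show ?case by (simp add: path_edges_single)
next
  case (Cons x' xs)
  have le: "x \<le> x'" and s: "sorted (x' # xs)" using Cons.prems by simp_all
  have "((X, Y), (X, Y + 1)) \<notin> path_edges (map (\<lambda>i. (i, y)) [x..x'])"
    using path_edges_subset[of "(X, Y)" "(X, Y + 1)" "map (\<lambda>i. (i, y)) [x..x']"] by auto
  moreover have "path_edges (row_path y x (x' # xs)) =
      path_edges (map (\<lambda>i. (i, y)) [x..x']) \<union> {((x', y), (x', y + 1))} \<union> path_edges (row_path (y + 1) x' xs)"
  proof -
    have "path_edges (map (\<lambda>i. (i, y)) [x..x'] @ row_path (y + 1) x' xs) =
      path_edges (map (\<lambda>i. (i, y)) [x..x']) \<union>
      {(last (map (\<lambda>i. (i, y)) [x..x']), hd (row_path (y + 1) x' xs))} \<union> path_edges (row_path (y + 1) x' xs)"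
      using last_row(2)[OF le] by (intro path_edges_append row_path_not_Nil) simp
    then show ?thesis
      by (simp only: row_path.simps hd_row_path[OF s] last_row(1)[OF le])
  qed
  ultimately have "((X, Y), (X, Y + 1)) \<in> path_edges (row_path y x (x' # xs)) \<longleftrightarrow>
     (X = x' \<and> Y = y) \<or> ((X, Y), (X, Y + 1)) \<in> path_edges (row_path (y + 1) x' xs)"
    by blast
  also have "\<dots> \<longleftrightarrow> (X = x' \<and> Y = y) \<or> (\<exists>k<length xs. Y = y + 1 + int k \<and> X = xs ! k)"
    by (simp only: Cons.IH[OF s])
  also have "\<dots> \<longleftrightarrow> (\<exists>k<length (x' # xs). Y = y + int k \<and> X = (x' # xs) ! k)"
    unfolding length_Cons Ex_less_Suc2 by (simp add: add.assoc) blast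
  finally show ?case .
qed

text \<open>\<open>row_path\<close> ends one row above the strip; without that last point it is the
  part of the path inside the strip.\<close>

lemma strip_path_row_path:
  assumes "sorted (x # xs)" "xs \<noteq> []" "0 \<le> x" "1 \<le> y" "y + int (length xs) = int R + 1"
    and "unit_step a (x, y)"
  shows "strip_path R (a, (x, y)) ((last xs, int R), (last xs, int R + 1)) (a # row_path y x xs)"
proof -
  let ?r = "butlast (row_path y x xs)"
  have r: "row_path y x xs = ?r @ [(last xs, int R + 1)]"
    using append_butlast_last_id[OF row_path_not_Nil, of y x xs] last_row_path[of y x xs] assms by simp
  have l: "last ?r = (last xs, int R)" "?r \<noteq> []"
    using last_butlast_row_path[OF assms(1,2), of y] assms(5) by auto
  have h: "hd ?r = (x, y)"
    using hd_row_path[OF assms(1), of y] l(2) r by (metis hd_append2)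
  have st: "set ?r \<subseteq> strip R"
  proof
    fix z assume "z \<in> set ?r"
    from set_butlast_row_path[OF assms(1) this] assms show "z \<in> strip R"
      by (cases z) (auto simp: strip_def)
  qed
  have ur: "up_right (a # row_path y x xs)"
    unfolding up_right_successively successively_Cons
    using successively_row_path[OF assms(1)] hd_row_path[OF assms(1)] assms(6) by simp
  show ?thesis
    unfolding strip_path_def prod.case
    using ur r l h st by (intro conjI exI[of _ ?r]) simp_all
qed

section \<open>Enumeration of a finite set from the largest element, matching the parts of a
  signature\<close>

definition en :: "nat set \<Rightarrow> nat \<Rightarrow> nat" where
  "en S m = rev (sorted_list_of_set S) ! (m - 1)"

lemma en_bij:
  assumes "finite S" shows "bij_betw (en S) {1..card S} S"
proof -
  let ?l = "rev (sorted_list_of_set S)"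
  have "bij_betw ((!) ?l) {..<card S} S"
    using bij_betw_nth[of ?l "{..<card S}" S] assms by simp
  moreover have "bij_betw (\<lambda>m. m - 1) {1..card S} {..<card S}"
    by (rule bij_betwI[of _ _ _ Suc]) auto
  ultimately have "bij_betw ((!) ?l \<circ> (\<lambda>m. m - 1)) {1..card S} S" by (rule bij_betw_trans[rotated])
  then show ?thesis by (simp add: en_def[abs_def] o_def)
qed

lemma en_greater:
  assumes "finite S" "m \<in> {1..card S}" "m' \<in> {1..card S}" "m < m'"
  shows "en S m' < en S m"
proof -
  let ?l = "rev (sorted_list_of_set S)"
  have "sorted_wrt (>) ?l"
    using strict_sorted_list_of_set[of S] by (simp add: sorted_wrt_rev)
  from sorted_wrt_nth_less[OF this, of "m - 1" "m' - 1"] show ?thesis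
    using assms unfolding en_def by simp
qed

lemma card_above_en:
  assumes "finite S" "m \<in> {1..card S}"
  shows "card {y \<in> S. en S m \<le> y} = m"
proof -
  have "{y \<in> S. en S m \<le> y} = en S ` {1..m}"
  proof
    show "{y \<in> S. en S m \<le> y} \<subseteq> en S ` {1..m}"
    proof
      fix y assume y: "y \<in> {y \<in> S. en S m \<le> y}"
      then obtain m' where m': "m' \<in> {1..card S}" "y = en S m'"
        using en_bij[OF assms(1)] by (metis (no_types, lifting) bij_betw_imp_surj_on imageE mem_Collect_eq)
      then have "\<not> m < m'" using en_greater[OF assms m'(1)] y by auto
      then show "y \<in> en S ` {1..m}" using m' by auto
    qed
    show "en S ` {1..m} \<subseteq> {y \<in> S. en S m \<le> y}"
    proof
      fix y assume "y \<in> en S ` {1..m}"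
      then obtain m' where m': "m' \<in> {1..m}" "y = en S m'" by auto
      then have "m' \<in> {1..card S}" using assms by auto
      moreover from this have "y \<in> S" using en_bij[OF assms(1)] m' by (auto simp: bij_betw_def)
      moreover have "en S m \<le> y"
        using en_greater[OF assms(1) calculation(1) assms(2)] m' by (cases "m' = m") auto
      ultimately show "y \<in> {y \<in> S. en S m \<le> y}" by simp
    qed
  qed
  moreover have "inj_on (en S) {1..m}"
    using en_bij[OF assms(1)] assms(2) by (auto simp: bij_betw_def elim!: inj_on_subset)
  ultimately show ?thesis by (simp add: card_image)
qed

text \<open>The m-th largest element is at least x exactly if at least m elements are. Applied to
  consecutive levels it shows that the m-th path moves weakly to the right.\<close>

lemma en_mono:
  assumes "finite S" "finite S'" "m \<in> {1..card S}" "m \<in> {1..card S'}"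
    and le: "\<And>x. card {y \<in> S. x \<le> y} \<le> card {y \<in> S'. x \<le> y}"
  shows "en S m \<le> en S' m"
proof (rule ccontr)
  assume "\<not> en S m \<le> en S' m"
  then have lt: "en S' m < en S m" by simp
  have "m \<le> card {y \<in> S'. en S m \<le> y}"
    using le[of "en S m"] card_above_en[OF assms(1,3)] by simp
  moreover have "{y \<in> S'. en S m \<le> y} \<subseteq> {y \<in> S'. en S' m \<le> y} - {en S' m}" using lt by auto
  then have "card {y \<in> S'. en S m \<le> y} \<le> card ({y \<in> S'. en S' m \<le> y} - {en S' m})"
    using assms(2) by (intro card_mono) auto
  moreover have "en S' m \<in> S'" using en_bij[OF assms(2)] assms(4) by (auto simp: bij_betw_def)
  then have "card ({y \<in> S'. en S' m \<le> y} - {en S' m}) = m - 1"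
    using card_above_en[OF assms(2,4)] by (subst card_Diff_singleton) auto
  ultimately have "m \<le> m - 1" by linarith
  then show False using assms(3) by (cases m) auto
qed

lemma card_en_eq:
  assumes "finite S"
  shows "card {m \<in> {1..card S}. int (en S m) = X} = of_bool (0 \<le> X \<and> nat X \<in> S)"
proof (cases "0 \<le> X \<and> nat X \<in> S")
  case True
  then obtain m where m: "m \<in> {1..card S}" "en S m = nat X"
    using en_bij[OF assms] by (metis bij_betw_imp_surj_on imageE)
  have "m' = m" if "m' \<in> {1..card S}" "int (en S m') = X" for m'
  proof (rule inj_onD[OF bij_betw_imp_inj_on[OF en_bij[OF assms]] _ that(1) m(1)])
    show "en S m' = en S m" using that(2) m(2) by linarith
  qed
  moreover have "int (en S m) = X" using m(2) True by simp
  ultimately have "{m \<in> {1..card S}. int (en S m) = X} = {m}"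
    using m(1) by blast
  then show ?thesis using True by simp
next
  case False
  have "{m \<in> {1..card S}. int (en S m) = X} = {}"
    using False bij_betwE[OF en_bij[OF assms]] by force
  then show ?thesis unfolding of_bool_def if_not_P[OF False] by (simp only: card.empty)
qed

text \<open>\<open>i\<close> is the number of arrows entering each row from the left: 1 for the
  u-rows, 0 for the v-rows.\<close>

definition binflow :: "nat \<Rightarrow> nat \<Rightarrow> config \<Rightarrow> bool" where
  "binflow R i \<omega> \<longleftrightarrow> flow R \<omega> \<and> (\<forall>e. \<omega> e \<le> 1) \<and>
     (\<forall>y. 1 \<le> y \<longrightarrow> y \<le> int R \<longrightarrow> \<omega> ((-1, y), (0, y)) = i)"

definition lev :: "config \<Rightarrow> nat \<Rightarrow> nat set" where
  "lev \<omega> n = {x. \<omega> ((int x, int n), (int x, int n + 1)) \<noteq> 0}"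

definition hor :: "config \<Rightarrow> nat \<Rightarrow> nat \<Rightarrow> nat" where
  "hor \<omega> n x = \<omega> ((int x - 1, int n), (int x, int n))"

definition lst :: "nat set \<Rightarrow> int list" where
  "lst S = map int (rev (sorted_list_of_set S))"

lemma part_lst: "finite S \<Longrightarrow> m \<in> {1..card S} \<Longrightarrow> part (lst S) m = int (en S m)"
  unfolding part_def lst_def en_def by (subst nth_map) auto

lemma card_above_rec:
  "finite C \<Longrightarrow> card {y \<in> C. x \<le> y} = of_bool (x \<in> C) + card {y \<in> C. Suc x \<le> (y::nat)}"
proof -
  assume "finite C"
  moreover have "{y \<in> C. x \<le> y} = (if x \<in> C then {x} else {}) \<union> {y \<in> C. Suc x \<le> y}"
    by (auto simp: Suc_le_eq nat_less_le)
  ultimately show ?thesis by (simp add: card_insert_if)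
qed

text \<open>Balance for everything to the right of x: the gain of the upper level is what crosses
  into column x horizontally. The induction runs downwards from a column beyond which all is
  empty.\<close>

lemma card_above:
  assumes "finite A" "finite C"
    and rec: "\<And>x. of_bool (x \<in> A) + h x = of_bool (x \<in> C) + h (Suc x)"
    and zero: "\<And>x. n \<le> x \<Longrightarrow> h x = (0::nat)"
  shows "card {y \<in> C. x \<le> y} = card {y \<in> A. x \<le> y} + h x"
proof -
  obtain b where b: "\<And>y. y \<in> A \<union> C \<Longrightarrow> y < b"
    using assms(1,2) by (metis finite_UnI finite_nat_set_iff_bounded)
  define k where "k = max n b"
  show ?thesis
  proof (induction "k - x" arbitrary: x)
    case 0
    then have "k \<le> x" by simp
    then have "{y \<in> C. x \<le> y} = {}" "{y \<in> A. x \<le> y} = {}" "h x = 0"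
      using b zero by (force simp: k_def)+
    then show ?case by (simp only: card.empty)
  next
    case (Suc d)
    then have "card {y \<in> C. Suc x \<le> y} = card {y \<in> A. Suc x \<le> y} + h (Suc x)" by simp
    then show ?case
      using rec[of x] card_above_rec[OF assms(1), of x] card_above_rec[OF assms(2), of x] by simp
  qed
qed

lemma finite_lev: "flow R \<omega> \<Longrightarrow> finite (lev \<omega> n)"
proof -
  assume "flow R \<omega>"
  then have "finite {e. \<omega> e \<noteq> 0}" by (simp add: flow_def)
  then show ?thesis
    unfolding lev_def
    by (rule finite_surj[where f = "\<lambda>((x, y), z). nat x"]) (force simp: image_iff)
qed

lemma hor_eventually: "flow R \<omega> \<Longrightarrow> \<exists>k. \<forall>x\<ge>k. hor \<omega> n x = 0"
proof -
  assume "flow R \<omega>"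
  then have "finite {e. \<omega> e \<noteq> 0}" by (simp add: flow_def)
  then have "finite {x. hor \<omega> n x \<noteq> 0}"
    unfolding hor_def
    by (rule finite_surj[where f = "\<lambda>(z, (x, y)). nat x"]) (force simp: image_iff)
  then obtain k where k: "\<forall>x\<in>{x. hor \<omega> n x \<noteq> 0}. x < k"
    unfolding finite_nat_set_iff_bounded by blast
  show ?thesis
  proof (intro exI allI impI)
    fix x assume "k \<le> x"
    then show "hor \<omega> n x = 0" using bspec[OF k, of x] by (cases "hor \<omega> n x = 0") simp_all
  qed
qed

lemma lev_iff:
  assumes "\<forall>e. \<omega> e \<le> 1"
  shows "\<omega> ((int x, int n), (int x, int n + 1)) = of_bool (x \<in> lev \<omega> n)"
proof -
  have "\<omega> ((int x, int n), (int x, int n + 1)) \<le> 1" using assms by (rule spec)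
  then show ?thesis unfolding lev_def of_bool_def mem_Collect_eq by presburger
qed

lemma binflow_rec:
  assumes "binflow R i \<omega>" "1 \<le> n" "n \<le> R"
  shows "of_bool (x \<in> lev \<omega> (n - 1)) + hor \<omega> n x = of_bool (x \<in> lev \<omega> n) + hor \<omega> n (Suc x)"
    and "hor \<omega> n 0 = i" and "hor \<omega> n x \<le> 1"
proof -
  have le: "\<forall>e. \<omega> e \<le> 1" using assms by (simp add: binflow_def)
  have "\<omega> ((int x, int n - 1), (int x, int n)) + \<omega> ((int x - 1, int n), (int x, int n)) =
    \<omega> ((int x, int n), (int x, int n + 1)) + \<omega> ((int x, int n), (int x + 1, int n))"
    using assms unfolding binflow_def flow_def by simp
  moreover have "\<omega> ((int x, int n - 1), (int x, int n)) = of_bool (x \<in> lev \<omega> (n - 1))"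
    using lev_iff[OF le, of x "n - 1"] assms(2) by (simp add: of_nat_diff)
  ultimately show "of_bool (x \<in> lev \<omega> (n - 1)) + hor \<omega> n x = of_bool (x \<in> lev \<omega> n) + hor \<omega> n (Suc x)"
    using lev_iff[OF le, of x n] by (simp add: hor_def add.commute)
  show "hor \<omega> n 0 = i" "hor \<omega> n x \<le> 1" using assms by (simp_all add: hor_def binflow_def)
qed

lemma binflow_card:
  assumes "binflow R i \<omega>" "1 \<le> n" "n \<le> R"
  shows "card {y \<in> lev \<omega> n. x \<le> y} = card {y \<in> lev \<omega> (n - 1). x \<le> y} + hor \<omega> n x"
    and "card (lev \<omega> n) = card (lev \<omega> (n - 1)) + i"
proof -
  have f: "flow R \<omega>" using assms by (simp add: binflow_def)
  obtain k where k: "\<And>x. k \<le> x \<Longrightarrow> hor \<omega> n x = 0" using hor_eventually[OF f] by blast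
  show *: "card {y \<in> lev \<omega> n. x \<le> y} = card {y \<in> lev \<omega> (n - 1). x \<le> y} + hor \<omega> n x" for x
    by (rule card_above[OF finite_lev[OF f] finite_lev[OF f] binflow_rec(1)[OF assms] k])
  show "card (lev \<omega> n) = card (lev \<omega> (n - 1)) + i"
    using *[of 0] binflow_rec(2)[OF assms] by simp
qed

section \<open>Path collections correspond to flows with at most one arrow per edge\<close>

lemma arrows_flow:
  assumes "\<And>m. m \<in> {1..N} \<Longrightarrow> strip_walk R (a m) (b m) (c m) (d m) (p m)"
  shows "flow R (arrows N p)"
  unfolding arrows_eq_sum by (intro flow_sum strip_walk.indicator_flow) (auto intro: assms)

lemma disjoint_of_arrows_le:
  assumes "\<And>e. arrows N p e \<le> 1"
  shows "disjoint_family_on (\<lambda>m. path_edges (p m)) {1..N}"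
proof (unfold disjoint_family_on_def, intro ballI impI equals0I)
  fix m n e assume mn: "m \<in> {1..N}" "n \<in> {1..N}" "m \<noteq> n" "e \<in> path_edges (p m) \<inter> path_edges (p n)"
  then have "{m, n} \<subseteq> {m \<in> {1..N}. e \<in> path_edges (p m)}" by auto
  then have "card {m, n} \<le> arrows N p e" unfolding arrows_def by (intro card_mono) auto
  then show False using assms[of e] mn(3) by simp
qed

lemma horizontal_edges_subset: "horizontal_edges p \<subseteq> path_edges p"
  by (auto simp: horizontal_edges_def)

lemma disjoint_horizontal_of_arrows_le:
  "(\<And>e. arrows N p e \<le> 1) \<Longrightarrow> disjoint_family_on (\<lambda>m. horizontal_edges (p m)) {1..N}"
  by (rule disjoint_family_on_bisimulation[OF disjoint_of_arrows_le])
    (use horizontal_edges_subset in blast)+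

lemma card_le_1: "finite A \<Longrightarrow> (\<And>m n. m \<in> A \<Longrightarrow> n \<in> A \<Longrightarrow> m = n) \<Longrightarrow> card A \<le> 1"
  by (metis One_nat_def card_le_Suc0_iff_eq)

lemma path_collections_binflow:
  assumes "\<omega> \<in> path_collections N"
  shows "binflow N 1 \<omega>" "lev \<omega> 0 = {}"
proof -
  obtain p where p: "\<omega> = arrows N p" "\<And>m. m \<in> {1..N} \<Longrightarrow> \<exists>x. strip_path N ((-1, int m), (0, int m)) ((x, int N), (x, int N + 1)) (p m)"
    and dis: "disjoint_family_on (\<lambda>m. path_edges (p m)) {1..N}"
    using assms unfolding path_collections_def by blast
  obtain xf where xf: "\<And>m. m \<in> {1..N} \<Longrightarrow> strip_path N ((-1, int m), (0, int m)) ((xf m, int N), (xf m, int N + 1)) (p m)"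
    using p(2) by metis
  have W: "strip_walk N (-1, int m) (0, int m) (xf m, int N) (xf m, int N + 1) (p m)" if "m \<in> {1..N}" for m
    using xf[OF that] that by unfold_locales (auto simp: strip_def strip_edge_def)
  have "flow N \<omega>" unfolding p(1) by (rule arrows_flow[OF W])
  moreover have "\<omega> e \<le> 1" for e
    unfolding p(1) arrows_def
  proof (rule card_le_1)
    fix m n assume "m \<in> {m \<in> {1..N}. e \<in> path_edges (p m)}" "n \<in> {m \<in> {1..N}. e \<in> path_edges (p m)}"
    then show "m = n" using dis unfolding disjoint_family_on_def by blast
  qed simp
  moreover have "\<omega> ((-1, y), (0, y)) = 1" if y: "1 \<le> y" "y \<le> int N" for y
  proof -
    have "((-1, y), (0, y)) \<in> path_edges (p m) \<longleftrightarrow> m = nat y" if m: "m \<in> {1..N}" for m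
    proof
      interpret strip_walk N "(-1, int m)" "(0, int m)" "(xf m, int N)" "(xf m, int N + 1)" "p m" by (rule W[OF m])
      { assume "((-1, y), (0, y)) \<in> path_edges (p m)"
        from edge_from_outside[OF this] show "m = nat y" by (simp add: strip_def) }
      { assume "m = nat y"
        then show "((-1, y), (0, y)) \<in> path_edges (p m)" using first_edge y by simp }
    qed
    moreover have "nat y \<in> {1..N}" using y by auto
    ultimately have "{m \<in> {1..N}. ((-1, y), (0, y)) \<in> path_edges (p m)} = {nat y}" by blast
    then show ?thesis by (simp add: p(1) arrows_def)
  qed
  ultimately show "binflow N 1 \<omega>" by (simp add: binflow_def)
  have "((int x, 0), (int x, 1)) \<notin> path_edges (p m)" if m: "m \<in> {1..N}" for m x
    using strip_walk.edge_from_outside[OF W[OF m], of "(int x, 0)" "(int x, 1)"] by (auto simp: strip_def)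
  then show "lev \<omega> 0 = {}" by (auto simp: lev_def p(1) arrows_def)
qed

lemma path_edges_Cons': "r \<noteq> [] \<Longrightarrow> path_edges (a # r) = insert (a, hd r) (path_edges r)"
  by (cases r) (simp_all add: path_edges_Cons)

lemma sorted_map_upt:
  "(\<And>n. r \<le> n \<Longrightarrow> n < R \<Longrightarrow> f n \<le> f (Suc n)) \<Longrightarrow> sorted (map f [r..<R + 1])"
  for f :: "nat \<Rightarrow> int"
  unfolding sorted_iff_nth_Suc by (simp del: upt_Suc)

lemma vertical_row_path_upt:
  assumes "sorted (x # map f [r..<R + 1])"
  shows "((X, Y), (X, Y + 1)) \<in> path_edges (row_path (int r) x (map f [r..<R + 1])) \<longleftrightarrow>
    (\<exists>n. r \<le> n \<and> n \<le> R \<and> Y = int n \<and> X = f n)"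
  unfolding vertical_row_path[OF assms]
proof
  assume "\<exists>k<length (map f [r..<R + 1]). Y = int r + int k \<and> X = map f [r..<R + 1] ! k"
  then obtain k where k: "k < R + 1 - r" "Y = int r + int k" "X = map f [r..<R + 1] ! k" by (auto simp del: upt_Suc)
  then show "\<exists>n. r \<le> n \<and> n \<le> R \<and> Y = int n \<and> X = f n"
    by (intro exI[of _ "r + k"]) (simp del: upt_Suc)
next
  assume "\<exists>n. r \<le> n \<and> n \<le> R \<and> Y = int n \<and> X = f n"
  then obtain n where n: "r \<le> n" "n \<le> R" "Y = int n" "X = f n" by blast
  then show "\<exists>k<length (map f [r..<R + 1]). Y = int r + int k \<and> X = map f [r..<R + 1] ! k"
    by (intro exI[of _ "n - r"]) (simp del: upt_Suc)
qed

text \<open>Path m occupies the m-th largest element of every level n \<ge> m; a path that has just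
  entered is the leftmost one. Its columns increase with n because the counts to the right of any
  point do. The arrows agree with \<omega> on vertical edges and on the left boundary, hence
  everywhere, and edge-disjointness is then read off from \<omega> \<le> 1.\<close>

lemma binflow_path_collections:
  assumes bf: "binflow N 1 \<omega>" and l0: "lev \<omega> 0 = {}"
  shows "\<omega> \<in> path_collections N"
proof -
  have fl: "flow N \<omega>" and le: "\<forall>e. \<omega> e \<le> 1" using bf by (auto simp: binflow_def)
  note fin = finite_lev[OF fl]
  have card: "card (lev \<omega> n) = n" if "n \<le> N" for n
    using that
  proof (induction n)
    case (Suc n)
    then show ?case using binflow_card(2)[OF bf, of "Suc n"] by simp
  qed (simp add: l0)
  define f where "f m n = int (en (lev \<omega> n) m)" for m n
  have step: "f m n \<le> f m (Suc n)" if "1 \<le> m" "m \<le> n" "n < N" for m n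
    unfolding f_def
  proof (intro iffD2[OF of_nat_le_iff] en_mono fin)
    show "m \<in> {1..card (lev \<omega> n)}" "m \<in> {1..card (lev \<omega> (Suc n))}" using card that by auto
    show "card {y \<in> lev \<omega> n. x \<le> y} \<le> card {y \<in> lev \<omega> (Suc n). x \<le> y}" for x
      using binflow_card(1)[OF bf, of "Suc n" x] that by simp
  qed
  define xs where "xs m = map (f m) [m..<N + 1]" for m
  define p where "p m = (-1, int m) # row_path (int m) 0 (xs m)" for m
  have so: "sorted (0 # xs m)" if "m \<in> {1..N}" for m
  proof -
    have "sorted (xs m)" unfolding xs_def by (rule sorted_map_upt) (use step that in auto)
    then show ?thesis by (auto simp: xs_def f_def simp del: upt_Suc)
  qed
  have ne: "xs m \<noteq> []" "last (xs m) = f m N" if "m \<in> {1..N}" for m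
    using that by (simp_all add: xs_def last_map)
  have SP: "strip_path N ((-1, int m), (0, int m)) ((f m N, int N), (f m N, int N + 1)) (p m)" if m: "m \<in> {1..N}" for m
    unfolding p_def ne(2)[OF m, symmetric]
    by (rule strip_path_row_path[OF so[OF m] ne(1)[OF m]])
      (use m in \<open>auto simp: xs_def unit_step_def simp del: upt_Suc\<close>)
  have W: "strip_walk N (-1, int m) (0, int m) (f m N, int N) (f m N, int N + 1) (p m)" if "m \<in> {1..N}" for m
    using SP[OF that] that by unfold_locales (auto simp: strip_def strip_edge_def)
  have vert: "((X, Y), (X, Y + 1)) \<in> path_edges (p m) \<longleftrightarrow> (\<exists>n. m \<le> n \<and> n \<le> N \<and> Y = int n \<and> X = f m n)"
    if m: "m \<in> {1..N}" for m X Y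
    unfolding p_def path_edges_Cons'[OF row_path_not_Nil] hd_row_path[OF so[OF m]]
    using vertical_row_path_upt[OF so[OF m, unfolded xs_def], of X Y] unfolding xs_def by auto
  have eq: "arrows N p = \<omega>"
  proof (rule flow_eqI[OF arrows_flow[OF W] fl])
    fix x y :: int assume xy: "0 \<le> x" "0 \<le> y" "y \<le> int N"
    define n where "n = nat y"
    have n: "y = int n" "n \<le> N" using xy by (auto simp: n_def)
    have "{m \<in> {1..N}. ((x, y), (x, y + 1)) \<in> path_edges (p m)} = {m \<in> {1..card (lev \<omega> n)}. int (en (lev \<omega> n) m) = x}"
      using vert n card[of n] by (auto simp: f_def)
    then have "arrows N p ((x, y), (x, y + 1)) = of_bool (nat x \<in> lev \<omega> n)"
      unfolding arrows_def using card_en_eq[OF fin[of n], of x] xy by simp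
    then show "arrows N p ((x, y), (x, y + 1)) = \<omega> ((x, y), (x, y + 1))"
      using lev_iff[OF le, of "nat x" n] xy n by simp
  next
    fix y :: int assume y: "1 \<le> y" "y \<le> int N"
    have "((-1, y), (0, y)) \<in> path_edges (p m) \<longleftrightarrow> m = nat y" if m: "m \<in> {1..N}" for m
    proof
      { assume "((-1, y), (0, y)) \<in> path_edges (p m)"
        from strip_walk.edge_from_outside[OF W[OF m] this] show "m = nat y" by (simp add: strip_def) }
      { assume "m = nat y"
        then show "((-1, y), (0, y)) \<in> path_edges (p m)" using strip_walk.first_edge[OF W[OF m]] y by simp }
    qed
    moreover have "nat y \<in> {1..N}" using y by auto
    ultimately have "{m \<in> {1..N}. ((-1, y), (0, y)) \<in> path_edges (p m)} = {nat y}" by blast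
    then have "arrows N p ((-1, y), (0, y)) = 1" by (simp add: arrows_def)
    then show "arrows N p ((-1, y), (0, y)) = \<omega> ((-1, y), (0, y))" using bf y by (simp add: binflow_def)
  qed
  have "arrows N p e \<le> 1" for e unfolding eq using le by (rule spec)
  then have "disjoint_family_on (\<lambda>m. path_edges (p m)) {1..N}"
    by (rule disjoint_of_arrows_le)
  then show ?thesis
    unfolding path_collections_def using eq SP by blast
qed

lemma strip_walk_skew:
  assumes "strip_path M ((x, 0), (x, 1)) ((x', int M), (x', int M + 1)) p" "0 \<le> x"
  shows "strip_walk M (x, 0) (x, 1) (x', int M) (x', int M + 1) p"
  using assms by unfold_locales (auto simp: strip_def strip_edge_def)

text \<open>The same decomposition, with all N paths present from level 0 on since nothing enters
  from the left.\<close>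

lemma binflow_skew_collections:
  assumes bf: "binflow M 0 \<omega>" and M: "1 \<le> M" and cN: "card (lev \<omega> 0) = N"
  shows "\<omega> \<in> skew_collections N M (lst (lev \<omega> M)) (lst (lev \<omega> 0))"
proof -
  have fl: "flow M \<omega>" and le: "\<forall>e. \<omega> e \<le> 1" using bf by (auto simp: binflow_def)
  note fin = finite_lev[OF fl]
  have card: "card (lev \<omega> n) = N" if "n \<le> M" for n
    using that
  proof (induction n)
    case (Suc n)
    then show ?case using binflow_card(2)[OF bf, of "Suc n"] by simp
  qed (simp add: cN)
  define f where "f m n = int (en (lev \<omega> n) m)" for m n
  have step: "f m n \<le> f m (Suc n)" if "m \<in> {1..N}" "n < M" for m n
    unfolding f_def
  proof (intro iffD2[OF of_nat_le_iff] en_mono fin)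
    show "m \<in> {1..card (lev \<omega> n)}" "m \<in> {1..card (lev \<omega> (Suc n))}" using card that by auto
    show "card {y \<in> lev \<omega> n. x \<le> y} \<le> card {y \<in> lev \<omega> (Suc n). x \<le> y}" for x
      using binflow_card(1)[OF bf, of "Suc n" x] that by simp
  qed
  define xs where "xs m = map (f m) [1..<M + 1]" for m
  define p where "p m = (f m 0, 0) # row_path 1 (f m 0) (xs m)" for m
  have so: "sorted (f m 0 # xs m)" if "m \<in> {1..N}" for m
  proof -
    have "sorted (map (f m) [0..<M + 1])" by (rule sorted_map_upt) (use step that in auto)
    moreover have "[0..<M + 1] = 0 # [1..<M + 1]" using upt_conv_Cons[of 0 "M + 1"] by simp
    ultimately show ?thesis by (simp add: xs_def del: upt_Suc)
  qed
  have ne: "xs m \<noteq> []" "last (xs m) = f m M" for m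
    using M by (simp_all add: xs_def last_map)
  have SP: "strip_path M ((f m 0, 0), (f m 0, 1)) ((f m M, int M), (f m M, int M + 1)) (p m)" if m: "m \<in> {1..N}" for m
    unfolding p_def ne(2)[of m, symmetric]
    by (rule strip_path_row_path[OF so[OF m] ne(1)])
      (use m in \<open>auto simp: xs_def f_def unit_step_def simp del: upt_Suc\<close>)
  have W: "strip_walk M (f m 0, 0) (f m 0, 1) (f m M, int M) (f m M, int M + 1) (p m)" if "m \<in> {1..N}" for m
    using SP[OF that] by (rule strip_walk_skew) (simp add: f_def)
  have vert: "((X, Y), (X, Y + 1)) \<in> path_edges (p m) \<longleftrightarrow> (\<exists>n\<le>M. Y = int n \<and> X = f m n)"
    if m: "m \<in> {1..N}" for m X Y
  proof -
    have "((X, Y), (X, Y + 1)) \<in> path_edges (p m) \<longleftrightarrow> (X = f m 0 \<and> Y = 0) \<or> (\<exists>n. 1 \<le> n \<and> n \<le> M \<and> Y = int n \<and> X = f m n)"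
      unfolding p_def path_edges_Cons'[OF row_path_not_Nil] hd_row_path[OF so[OF m]]
      using vertical_row_path_upt[OF so[OF m, unfolded xs_def], of X Y] unfolding xs_def by auto
    also have "\<dots> \<longleftrightarrow> (\<exists>n\<le>M. Y = int n \<and> X = f m n)"
    proof
      assume "\<exists>n\<le>M. Y = int n \<and> X = f m n"
      then obtain n where "n \<le> M" "Y = int n" "X = f m n" by blast
      then show "(X = f m 0 \<and> Y = 0) \<or> (\<exists>n. 1 \<le> n \<and> n \<le> M \<and> Y = int n \<and> X = f m n)"
        by (cases "n = 0") auto
    qed (auto intro: exI[of _ 0])
    finally show ?thesis .
  qed
  have eq: "arrows N p = \<omega>"
  proof (rule flow_eqI[OF arrows_flow[OF W] fl])
    fix x y :: int assume xy: "0 \<le> x" "0 \<le> y" "y \<le> int M"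
    define n where "n = nat y"
    have n: "y = int n" "n \<le> M" using xy by (auto simp: n_def)
    have "{m \<in> {1..N}. ((x, y), (x, y + 1)) \<in> path_edges (p m)} = {m \<in> {1..card (lev \<omega> n)}. int (en (lev \<omega> n) m) = x}"
      using vert n card[of n] by (auto simp: f_def)
    then have "arrows N p ((x, y), (x, y + 1)) = of_bool (nat x \<in> lev \<omega> n)"
      unfolding arrows_def using card_en_eq[OF fin[of n], of x] xy by simp
    then show "arrows N p ((x, y), (x, y + 1)) = \<omega> ((x, y), (x, y + 1))"
      using lev_iff[OF le, of "nat x" n] xy n by simp
  next
    fix y :: int assume y: "1 \<le> y" "y \<le> int M"
    have "((-1, y), (0, y)) \<notin> path_edges (p m)" if m: "m \<in> {1..N}" for m
      using strip_walk.edge_from_outside[OF W[OF m], of "(-1, y)" "(0, y)"] by (auto simp: strip_def f_def)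
    then have "arrows N p ((-1, y), (0, y)) = 0" by (auto simp: arrows_def)
    then show "arrows N p ((-1, y), (0, y)) = \<omega> ((-1, y), (0, y))" using bf y by (simp add: binflow_def)
  qed
  have "arrows N p e \<le> 1" for e unfolding eq using le by (rule spec)
  then have "disjoint_family_on (\<lambda>m. horizontal_edges (p m)) {1..N}"
    by (rule disjoint_horizontal_of_arrows_le)
  moreover have "part (lst (lev \<omega> 0)) m = f m 0" "part (lst (lev \<omega> M)) m = f m M" if "m \<in> {1..N}" for m
    using part_lst[OF fin] card[of 0] card[of M] that by (auto simp: f_def)
  ultimately show ?thesis
    unfolding skew_collections_def using eq SP by force
qed

subsection \<open>Products over rows\<close>

text \<open>Conservation fixes the horizontal states one after another from the left, so the sum
  hidden in \<open>row_weight\<close> has a single possibly nonzero term.\<close>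

lemma (in ice) row_prod:
  assumes "set_decode A \<subseteq> {..<n}" "set_decode C \<subseteq> {..<n}" "h n = e"
    and "\<And>x. of_bool (x \<in> set_decode A) + of_bool (h x) = (of_bool (x \<in> set_decode C) + of_bool (h (Suc x)) :: nat)"
  shows "(\<Prod>x<n. w (x \<in> set_decode A) (h x) (x \<in> set_decode C) (h (Suc x))) = row_weight w e (h 0) A C"
  using assms
proof (induction n arbitrary: A C h)
  case 0
  have *: "B = 0" if "set_decode B \<subseteq> {..<0}" for B
  proof -
    have "set_decode B = {}" using that by (simp only: lessThan_0 subset_empty)
    then have "set_encode (set_decode B) = set_encode {}" by (rule arg_cong)
    then show ?thesis by (simp only: set_decode_inverse set_encode_empty)
  qed
  have "row_weight w e (h 0) A C = row_weight w e e 0 0"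
    unfolding *[OF 0(1)] *[OF 0(2)] 0(3) ..
  then show ?case by (simp add: row_zero)
next
  case (Suc n)
  have half: "set_decode (B div 2) \<subseteq> {..<n}" if "set_decode B \<subseteq> {..<Suc n}" for B
  proof
    fix x assume "x \<in> set_decode (B div 2)"
    then have "Suc x \<in> set_decode B" by (simp only: set_decode_Suc)
    then show "x \<in> {..<n}" using subsetD[OF that, of "Suc x"] by simp
  qed
  note sub = half[OF Suc.prems(1)] half[OF Suc.prems(2)]
  have IH: "(\<Prod>x<n. w (Suc x \<in> set_decode A) (h (Suc x)) (Suc x \<in> set_decode C) (h (Suc (Suc x)))) =
      row_weight w e (h (Suc 0)) (A div 2) (C div 2)"
  proof -
    have "of_bool (x \<in> set_decode (A div 2)) + of_bool (h (Suc x)) =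
        (of_bool (x \<in> set_decode (C div 2)) + of_bool (h (Suc (Suc x))) :: nat)" for x
      using Suc.prems(4)[of "Suc x"] by (simp only: set_decode_Suc)
    from Suc.IH[OF sub, of "\<lambda>x. h (Suc x)", OF Suc.prems(3) this]
    show ?thesis by (simp only: set_decode_Suc)
  qed
  have z: "w (odd A) (h 0) (odd C) (\<not> h (Suc 0)) = 0"
  proof (rule ccontr)
    assume "w (odd A) (h 0) (odd C) (\<not> h (Suc 0)) \<noteq> 0"
    from conserve[OF this] Suc.prems(4)[of 0] show False by (cases "h (Suc 0)") (simp_all add: set_decode_0)
  qed
  have "row_weight w e (h 0) A C = w (odd A) (h 0) (odd C) (h (Suc 0)) * row_weight w e (h (Suc 0)) (A div 2) (C div 2)"
    using z unfolding row_rec[of "h 0" A C] by (cases "h (Suc 0)") simp_all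
  then show ?case
    unfolding prod.lessThan_Suc_shift IH by (simp only: set_decode_0)
qed

lemma (in ice) row_exists:
  "row_weight w e i A C \<noteq> 0 \<Longrightarrow> \<exists>h n. h 0 = i \<and> (\<forall>x\<ge>n. h x = e) \<and>
    (\<forall>x. of_bool (x \<in> set_decode A) + of_bool (h x) = (of_bool (x \<in> set_decode C) + of_bool (h (Suc x)) :: nat))"
proof (induction "A + C" arbitrary: i A C rule: less_induct)
  case less
  show ?case
  proof (cases "A = 0 \<and> C = 0")
    case True
    then have "i = e" using less.prems by (auto simp: row_zero)
    then show ?thesis using True by (intro exI[of _ "\<lambda>_. e"] exI[of _ 0]) simp
  next
    case False
    have lt: "A div 2 + C div 2 < A + C" using False by presburger
    obtain j where j: "w (odd A) i (odd C) j \<noteq> 0" "row_weight w e j (A div 2) (C div 2) \<noteq> 0"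
      using less.prems unfolding row_rec[of i A C]
      by (metis add.right_neutral mult_zero_left mult_zero_right)
    obtain h n where h: "h 0 = j" "\<forall>x\<ge>n. h x = e"
      "\<And>x. of_bool (x \<in> set_decode (A div 2)) + of_bool (h x) =
         (of_bool (x \<in> set_decode (C div 2)) + of_bool (h (Suc x)) :: nat)"
      using less.hyps[OF lt j(2)] by blast
    let ?h = "\<lambda>x. case x of 0 \<Rightarrow> i | Suc y \<Rightarrow> h y"
    have "of_bool (x \<in> set_decode A) + of_bool (?h x) = (of_bool (x \<in> set_decode C) + of_bool (?h (Suc x)) :: nat)" for x
    proof (cases x)
      case 0
      then show ?thesis using conserve[OF j(1)] h(1) by (simp add: set_decode_0)
    next
      case (Suc y)
      then show ?thesis using h(3)[of y] by (simp add: set_decode_Suc)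
    qed
    moreover have "\<forall>x\<ge>Suc n. ?h x = e"
      using h(2) by (auto split: nat.splits)
    moreover have "?h 0 = i" by simp
    ultimately show ?thesis by blast
  qed
qed

lemma flow_bounded: "flow R \<omega> \<Longrightarrow> \<exists>k. \<forall>n x. k \<le> x \<longrightarrow> x \<notin> lev \<omega> n \<and> hor \<omega> n x = 0"
proof -
  assume "flow R \<omega>"
  then have "finite ((\<lambda>e. nat (fst (snd e))) ` {e. \<omega> e \<noteq> 0})" by (simp add: flow_def)
  then obtain k where k: "\<And>y. y \<in> (\<lambda>e. nat (fst (snd e))) ` {e. \<omega> e \<noteq> 0} \<Longrightarrow> y < k"
    unfolding finite_nat_set_iff_bounded by blast
  have *: "\<omega> (z, (int x, y)) = 0" if "k \<le> x" for z x y
  proof (rule ccontr)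
    assume "\<omega> (z, (int x, y)) \<noteq> 0"
    then have "x \<in> (\<lambda>e. nat (fst (snd e))) ` {e. \<omega> e \<noteq> 0}"
      by (intro image_eqI[of _ _ "(z, (int x, y))"]) simp_all
    then show False using k that by (metis linorder_not_less)
  qed
  show ?thesis
    by (intro exI[of _ k]) (simp add: lev_def hor_def *)
qed

definition code :: "config \<Rightarrow> nat \<Rightarrow> nat" where "code \<omega> n = set_encode (lev \<omega> n)"

lemma set_decode_code: "flow R \<omega> \<Longrightarrow> set_decode (code \<omega> n) = lev \<omega> n"
  unfolding code_def by (rule set_encode_inverse[OF finite_lev])

lemma vertex_type_binflow:
  assumes "binflow R i \<omega>" "1 \<le> j" "j \<le> R"
  shows "vertex_type \<omega> (int x) (int j) =
    (of_bool (x \<in> lev \<omega> (j - 1)), of_bool (hor \<omega> j x = 1), of_bool (x \<in> lev \<omega> j), of_bool (hor \<omega> j (Suc x) = 1))"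
proof -
  have le: "\<forall>e. \<omega> e \<le> 1" using assms by (simp add: binflow_def)
  have h: "\<omega> ((int x - 1, int j), (int x, int j)) = of_bool (hor \<omega> j x = 1)" for x
    using le[rule_format, of "((int x - 1, int j), (int x, int j))"] by (auto simp: hor_def)
  show ?thesis
    unfolding vertex_type_def
    using lev_iff[OF le, of x "j - 1"] lev_iff[OF le, of x j] h[of x] h[of "Suc x"] assms(2)
    by (simp add: of_nat_diff add.commute)
qed

lemma prodinf_rows:
  fixes W :: "nat \<Rightarrow> nat \<times> nat \<times> nat \<times> nat \<Rightarrow> real"
  assumes fl: "flow R \<omega>" and W: "\<And>j. W j (0, 0, 0, 0) = 1"
    and k: "\<And>n x. k \<le> x \<Longrightarrow> x \<notin> lev \<omega> n \<and> hor \<omega> n x = 0"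
  shows "(\<Prod>i. \<Prod>j=1..R. W j (vertex_type \<omega> (int i) (int j))) =
    (\<Prod>j=1..R. \<Prod>x<k. W j (vertex_type \<omega> (int x) (int j)))"
proof -
  have "vertex_type \<omega> (int x) (int j) = (0, 0, 0, 0)" if "k \<le> x" "1 \<le> j" for x j
    using k[OF that(1), of "j - 1"] k[OF that(1), of j] k[of "Suc x" j] that
    unfolding vertex_type_def by (simp add: lev_def hor_def of_nat_diff add.commute)
  then have "(\<Prod>j=1..R. W j (vertex_type \<omega> (int x) (int j))) = 1" if "x \<notin> {..<k}" for x
    using that W by (intro prod.neutral) auto
  then have "(\<Prod>i. \<Prod>j=1..R. W j (vertex_type \<omega> (int i) (int j))) =
      (\<Prod>i<k. \<Prod>j=1..R. W j (vertex_type \<omega> (int i) (int j)))"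
    by (intro prodinf_finite) auto
  also have "\<dots> = (\<Prod>j=1..R. \<Prod>x<k. W j (vertex_type \<omega> (int x) (int j)))"
    by (rule prod.swap)
  finally show ?thesis .
qed

text \<open>Each horizontal step raises the sum of the abscissae by one. The edge entering at column
  0 is not counted, in keeping with an arrow that starts there at abscissa 0.\<close>

lemma count_horizontal:
  fixes h :: "nat \<Rightarrow> bool"
  assumes "finite A" "finite C" "A \<subseteq> {..<n}" "C \<subseteq> {..<n}" "\<not> h n"
    and "\<And>x. of_bool (x \<in> A) + of_bool (h x) = (of_bool (x \<in> C) + of_bool (h (Suc x)) :: nat)"
  shows "card {x. x < n \<and> h (Suc x)} + \<Sum>A = \<Sum>C"
proof -
  \<comment> \<open>Summation by parts; the boundary term accounts for an arrow still under way at
    column m.\<close>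
  have "(\<Sum>x<m. of_bool (h (Suc x))) + (\<Sum>x<m. x * of_bool (x \<in> A)) =
      (\<Sum>x<m. x * of_bool (x \<in> C)) + m * (of_bool (h m) :: nat)" for m
  proof (induction m)
    case (Suc m)
    have "m * (of_bool (m \<in> A) + of_bool (h m)) = m * (of_bool (m \<in> C) + of_bool (h (Suc m)) :: nat)"
      using assms(6)[of m] by (simp only:)
    then show ?case using Suc by (simp add: distrib_left)
  qed simp
  from this[of n] have "(\<Sum>x<n. of_bool (h (Suc x))) + (\<Sum>x<n. x * of_bool (x \<in> A)) = (\<Sum>x<n. x * of_bool (x \<in> C))"
    using assms(5) by simp
  moreover have "(\<Sum>x<n. x * of_bool (x \<in> B)) = \<Sum>B" if "B \<subseteq> {..<n}" for B
    using that by (simp add: of_bool_def sum.If_cases Int_absorb1 if_distrib cong: if_cong)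
  moreover have "(\<Sum>x<n. of_bool (h (Suc x))) = card {x. x < n \<and> h (Suc x)}"
    by (simp add: of_bool_def sum.If_cases Int_def)
  ultimately show ?thesis using assms(3,4) by simp
qed

text \<open>The stochastic six vertex weights and the given ones differ by a factor which only depends on
  the two ends of a row.\<close>

lemma gauge_row:
  fixes t g :: real and w' :: "bool \<Rightarrow> bool \<Rightarrow> bool \<Rightarrow> bool \<Rightarrow> real"
  assumes A: "set_decode A \<subseteq> {..<n}" and C: "set_decode C \<subseteq> {..<n}" and h: "\<not> h n"
    and cons: "\<And>x. of_bool (x \<in> set_decode A) + of_bool (h x) = (of_bool (x \<in> set_decode C) + of_bool (h (Suc x)) :: nat)"
    and t: "t \<noteq> 0" and g: "g \<noteq> 0"
    and W: "\<And>a i c j. W (of_bool a, of_bool i, of_bool c, of_bool j) =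
        (if j then t else 1) * ((if j then g else 1) / (if i then g else 1)) * w' a i c j"
  shows "(\<Prod>x<n. W (of_bool (x \<in> set_decode A), of_bool (h x), of_bool (x \<in> set_decode C), of_bool (h (Suc x)))) =
     t ^ \<Sum>(set_decode C) / t ^ \<Sum>(set_decode A) / (if h 0 then g else 1) *
     (\<Prod>x<n. w' (x \<in> set_decode A) (h x) (x \<in> set_decode C) (h (Suc x)))"
proof -
  have "(\<Prod>x<n. if h (Suc x) then t else 1) = t ^ card {x. x < n \<and> h (Suc x)}"
    by (simp add: prod.If_cases Int_def)
  moreover have "t ^ card {x. x < n \<and> h (Suc x)} = t ^ \<Sum>(set_decode C) / t ^ \<Sum>(set_decode A)"
  proof -
    have "card {x. x < n \<and> h (Suc x)} + \<Sum>(set_decode A) = \<Sum>(set_decode C)"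
      by (rule count_horizontal[OF finite_set_decode finite_set_decode A C h cons])
    then have "t ^ card {x. x < n \<and> h (Suc x)} * t ^ \<Sum>(set_decode A) = t ^ \<Sum>(set_decode C)"
      by (simp only: power_add[symmetric])
    then show ?thesis using t by (simp add: nonzero_eq_divide_eq)
  qed
  moreover have "(\<Prod>x<n. (if h (Suc x) then g else 1) / (if h x then g else 1)) =
      (if h n then g else 1) / (if h 0 then g else 1)"
    using prod_lessThan_telescope[of n "\<lambda>x. if h x then g else 1"] g by simp
  ultimately show ?thesis
    unfolding W prod.distrib by (simp only: h if_False divide_divide_eq_left times_divide_eq_left times_divide_eq_right mult_1_left mult_1_right)
qed

lemma prod_telescope_atLeastAtMost:
  fixes f :: "nat \<Rightarrow> 'a :: field"
  assumes "\<And>n. f n \<noteq> 0"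
  shows "(\<Prod>j=1..R. f j / f (j - 1)) = f R / f 0"
  using assms by (induction R) simp_all

text \<open>Consecutive rows share only the occupied set between them, so horizontal states can be
  chosen for each row separately and glued.\<close>

lemma exists_binflow:
  assumes i: "i \<le> 1"
    and row: "\<And>j. 1 \<le> j \<Longrightarrow> j \<le> R \<Longrightarrow> \<exists>h n. h 0 = (i = (1::nat)) \<and> (\<forall>x\<ge>n. \<not> h x) \<and>
      (\<forall>x. of_bool (x \<in> set_decode (c (j - 1))) + of_bool (h x) =
        (of_bool (x \<in> set_decode (c j)) + of_bool (h (Suc x)) :: nat))"
  shows "\<exists>\<omega>. binflow R i \<omega> \<and> (\<forall>n\<le>R. code \<omega> n = c n)"
proof -
  obtain h n where h: "\<And>j. 1 \<le> j \<Longrightarrow> j \<le> R \<Longrightarrow> h j 0 = (i = 1)"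
    and n: "\<And>j x. 1 \<le> j \<Longrightarrow> j \<le> R \<Longrightarrow> n j \<le> x \<Longrightarrow> \<not> h j x"
    and hc: "\<And>j x. 1 \<le> j \<Longrightarrow> j \<le> R \<Longrightarrow> of_bool (x \<in> set_decode (c (j - 1))) + of_bool (h j x) =
        (of_bool (x \<in> set_decode (c j)) + of_bool (h j (Suc x)) :: nat)"
    using row by metis
  define E where "E = {((x, y), (x', y')) | x y x' y'. (x' = x \<and> y' = y + 1 \<and> 0 \<le> x \<and> 0 \<le> y \<and> y \<le> int R \<and> nat x \<in> set_decode (c (nat y))) \<or>
      (x' = x + 1 \<and> y' = y \<and> -1 \<le> x \<and> 1 \<le> y \<and> y \<le> int R \<and> h (nat y) (nat (x + 1)))}"
  define \<omega> where "\<omega> e = (of_bool (e \<in> E) :: nat)" for e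
  have vE: "((x, y), (x, y + 1)) \<in> E \<longleftrightarrow> 0 \<le> x \<and> 0 \<le> y \<and> y \<le> int R \<and> nat x \<in> set_decode (c (nat y))" for x y
    by (auto simp: E_def)
  have hE: "((x, y), (x + 1, y)) \<in> E \<longleftrightarrow> -1 \<le> x \<and> 1 \<le> y \<and> y \<le> int R \<and> h (nat y) (nat (x + 1))" for x y
    by (auto simp: E_def)
  have "finite E"
  proof (rule finite_subset)
    let ?X = "\<Union>j\<le>R. set_decode (c j)" and ?m = "\<Sum>j\<in>{1..R}. n j"
    let ?P = "\<lambda>(x, y). {((int x, int y), (int x, int y + 1)), ((int x - 1, int y), (int x, int y))}"
    show "E \<subseteq> (\<Union>z\<in>(?X \<union> {..?m}) \<times> {..R}. ?P z)"
    proof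
      fix e assume "e \<in> E"
      then consider (v) x y where "e = ((x, y), (x, y + 1))" "0 \<le> x" "0 \<le> y" "y \<le> int R" "nat x \<in> set_decode (c (nat y))"
        | (h) x y where "e = ((x, y), (x + 1, y))" "-1 \<le> x" "1 \<le> y" "y \<le> int R" "h (nat y) (nat (x + 1))"
        unfolding E_def by blast
      then show "e \<in> (\<Union>z\<in>(?X \<union> {..?m}) \<times> {..R}. ?P z)"
      proof cases
        case v
        then have "(nat x, nat y) \<in> (?X \<union> {..?m}) \<times> {..R}" by auto
        moreover have "e \<in> ?P (nat x, nat y)" using v by simp
        ultimately show ?thesis by (rule UN_I)
      next
        case h
        then have "nat y \<in> {1..R}" by auto
        then have "n (nat y) \<le> ?m" by (intro member_le_sum) auto
        moreover have "nat (x + 1) < n (nat y)" using n[of "nat y" "nat (x + 1)"] h \<open>nat y \<in> {1..R}\<close> by force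
        ultimately have "(nat (x + 1), nat y) \<in> (?X \<union> {..?m}) \<times> {..R}" using \<open>nat y \<in> {1..R}\<close> by auto
        moreover have "e \<in> ?P (nat (x + 1), nat y)" using h by simp
        ultimately show ?thesis by (rule UN_I)
      qed
    qed
    show "finite (\<Union>z\<in>(?X \<union> {..?m}) \<times> {..R}. ?P z)" by auto
  qed
  then have "finite {e. \<omega> e \<noteq> 0}" by (simp add: \<omega>_def)
  moreover have "strip_edge R e" if "\<omega> e \<noteq> 0" for e
    using that unfolding \<omega>_def E_def strip_edge_def by (auto split: if_splits)
  moreover have "\<omega> ((x, y - 1), (x, y)) + \<omega> ((x - 1, y), (x, y)) = \<omega> ((x, y), (x, y + 1)) + \<omega> ((x, y), (x + 1, y))"
    if xy: "0 \<le> x" "1 \<le> y" "y \<le> int R" for x y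
  proof -
    define X Y where "X = nat x" and "Y = nat y"
    have XY: "x = int X" "y = int Y" "1 \<le> Y" "Y \<le> R" using xy by (auto simp: X_def Y_def)
    have "\<omega> ((x, y - 1), (x, y)) = of_bool (X \<in> set_decode (c (Y - 1)))"
      using vE[of x "y - 1"] XY unfolding \<omega>_def by (simp add: nat_diff_distrib)
    moreover have "\<omega> ((x - 1, y), (x, y)) = of_bool (h Y X)"
      using hE[of "x - 1" y] XY unfolding \<omega>_def by simp
    moreover have "\<omega> ((x, y), (x, y + 1)) = of_bool (X \<in> set_decode (c Y))"
      using vE[of x y] XY unfolding \<omega>_def by simp
    moreover have "\<omega> ((x, y), (x + 1, y)) = of_bool (h Y (Suc X))"
      using hE[of x y] XY unfolding \<omega>_def by (simp add: nat_add_distrib)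
    ultimately show ?thesis using hc[OF XY(3,4), of X] by simp
  qed
  ultimately have fl: "flow R \<omega>" unfolding flow_def by blast
  have "\<omega> ((-1, y), (0, y)) = i" if y: "1 \<le> y" "y \<le> int R" for y
    using hE[of "-1" y] h[of "nat y"] y i unfolding \<omega>_def by (cases i) auto
  then have "binflow R i \<omega>" using fl by (simp add: binflow_def \<omega>_def)
  moreover have "lev \<omega> m = set_decode (c m)" if "m \<le> R" for m
    using that vE unfolding lev_def \<omega>_def by auto
  ultimately show ?thesis by (intro exI[of _ \<omega>]) (simp add: code_def)
qed

subsection \<open>Sums over path collections\<close>

fun chain :: "(nat \<Rightarrow> nat \<Rightarrow> real) \<Rightarrow> nat \<Rightarrow> nat list \<Rightarrow> real" where
  "chain K A [] = 1"
| "chain K A (C # xs) = K A C * chain K C xs"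

lemma chain_snoc: "chain K A (xs @ [y]) = chain K A xs * K (last (A # xs)) y"
  by (induction xs arbitrary: A) auto

lemma last_map_upt: "last (c 0 # map c [1..<N + 1]) = c N"
  by (cases N) (simp_all add: last_map)

lemma chain_upt: "chain K (c 0) (map c [1..<N + 1]) = (\<Prod>j=1..N. K (c (j - 1)) (c j))"
proof (induction N)
  case (Suc N)
  have "map c [1..<Suc N + 1] = map c [1..<N + 1] @ [c (Suc N)]" by simp
  then have "chain K (c 0) (map c [1..<Suc N + 1]) =
      (\<Prod>j=1..N. K (c (j - 1)) (c j)) * K (c N) (c (Suc N))"
    by (simp only: chain_snoc Suc last_map_upt)
  then show ?case by simp
qed simp

lemma chain_nonneg: "(\<And>A C. 0 \<le> K A C) \<Longrightarrow> 0 \<le> chain K A xs"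
  by (induction xs arbitrary: A) auto

lemma nn_integral_chain:
  assumes K: "\<And>A C. 0 \<le> K A C"
  shows "(\<integral>\<^sup>+xs. ennreal (chain K A xs) * g (last (A # xs)) * indicator {xs. length xs = n} xs \<partial>count_space UNIV) =
    (transfer K ^^ n) g A"
proof (induction n arbitrary: A)
  case 0
  have "(\<integral>\<^sup>+xs. ennreal (chain K A xs) * g (last (A # xs)) * indicator {xs. length xs = 0} xs \<partial>count_space UNIV) =
    (\<integral>\<^sup>+xs. ennreal (chain K A xs) * g (last (A # xs)) \<partial>count_space {[]})"
    by (subst nn_integral_count_space_indicator) (auto simp: indicator_def intro!: nn_integral_cong)
  then show ?case by (simp add: nn_integral_count_space_finite)
next
  case (Suc n)
  let ?f = "\<lambda>xs. ennreal (chain K A xs) * g (last (A # xs)) * indicator {xs. length xs = Suc n} xs"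
  have bij: "bij_betw (\<lambda>(C, xs). C # xs) (UNIV :: (nat \<times> nat list) set) (- {[]})"
  proof (rule bij_betwI')
    fix y :: "nat list" assume "y \<in> - {[]}"
    then obtain C xs where "y = C # xs" by (cases y) auto
    then show "\<exists>x\<in>UNIV. y = (case x of (C, xs) \<Rightarrow> C # xs)" by (intro bexI[of _ "(C, xs)"]) auto
  qed auto
  have "(\<integral>\<^sup>+xs. ?f xs \<partial>count_space UNIV) = (\<integral>\<^sup>+xs. ?f xs \<partial>count_space (- {[]}))"
    by (rule nn_integral_count_space_eq) auto
  also have "\<dots> = (\<integral>\<^sup>+z. ?f (case z of (C, xs) \<Rightarrow> C # xs) \<partial>count_space UNIV)"
    by (rule nn_integral_bij_count_space[OF bij, symmetric])
  also have "\<dots> = (\<integral>\<^sup>+C. \<integral>\<^sup>+xs. ?f (C # xs) \<partial>count_space UNIV \<partial>count_space UNIV)"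
    by (subst nn_integral_fst_count_space[symmetric]) simp
  also have "\<dots> = (\<integral>\<^sup>+C. ennreal (K A C) * (\<integral>\<^sup>+xs. ennreal (chain K C xs) * g (last (C # xs)) *
       indicator {xs. length xs = n} xs \<partial>count_space UNIV) \<partial>count_space UNIV)"
  proof (rule nn_integral_cong)
    fix C
    have "?f (C # xs) = ennreal (K A C) * (ennreal (chain K C xs) * g (last (C # xs)) * indicator {xs. length xs = n} xs)" for xs
      using K chain_nonneg[OF K] by (simp add: ennreal_mult mult.assoc indicator_def)
    then show "(\<integral>\<^sup>+xs. ?f (C # xs) \<partial>count_space UNIV) = ennreal (K A C) *
       (\<integral>\<^sup>+xs. ennreal (chain K C xs) * g (last (C # xs)) * indicator {xs. length xs = n} xs \<partial>count_space UNIV)"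
      by (simp only: nn_integral_cmult borel_measurable_count_space)
  qed
  also have "\<dots> = (transfer K ^^ Suc n) g A"
    unfolding Suc by (simp add: transfer_def)
  finally show ?case .
qed

definition codes :: "nat \<Rightarrow> config \<Rightarrow> nat list" where
  "codes N \<omega> = map (code \<omega>) [1..<N + 1]"

lemma binflow_eqI:
  assumes "binflow R i \<omega>" "binflow R i \<omega>'" "\<And>n. n \<le> R \<Longrightarrow> code \<omega> n = code \<omega>' n"
  shows "\<omega> = \<omega>'"
proof (rule flow_eqI)
  show fl: "flow R \<omega>" "flow R \<omega>'" using assms(1,2) by (simp_all add: binflow_def)
  have le: "\<forall>e. \<omega> e \<le> 1" "\<forall>e. \<omega>' e \<le> 1" using assms(1,2) by (simp_all add: binflow_def)
  show "\<omega> ((-1, y), (0, y)) = \<omega>' ((-1, y), (0, y))" if "1 \<le> y" "y \<le> int R" for y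
    using assms(1,2) that by (simp add: binflow_def)
  fix x y :: int assume xy: "0 \<le> x" "0 \<le> y" "y \<le> int R"
  define X Y where "X = nat x" and "Y = nat y"
  have XY: "x = int X" "y = int Y" "Y \<le> R" using xy by (auto simp: X_def Y_def)
  have "lev \<omega> Y = lev \<omega>' Y"
    using assms(3)[OF XY(3)] set_decode_code[OF fl(1), of Y] set_decode_code[OF fl(2), of Y] by simp
  then show "\<omega> ((x, y), (x, y + 1)) = \<omega>' ((x, y), (x, y + 1))"
    unfolding XY using lev_iff[OF le(1), of X Y] lev_iff[OF le(2), of X Y] by simp
qed

lemma binflow_row:
  assumes "binflow R i \<omega>" "1 \<le> j" "j \<le> R"
  defines "h x \<equiv> hor \<omega> j x = 1"
  shows "of_bool (x \<in> set_decode (code \<omega> (j - 1))) + of_bool (h x) =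
      (of_bool (x \<in> set_decode (code \<omega> j)) + of_bool (h (Suc x)) :: nat)"
    and "h 0 \<longleftrightarrow> i = 1"
proof -
  have fl: "flow R \<omega>" using assms by (simp add: binflow_def)
  have "of_bool (h x) = hor \<omega> j x" for x
    using binflow_rec(3)[OF assms(1-3), of x] unfolding h_def of_bool_def by presburger
  then show "of_bool (x \<in> set_decode (code \<omega> (j - 1))) + of_bool (h x) =
      (of_bool (x \<in> set_decode (code \<omega> j)) + of_bool (h (Suc x)) :: nat)"
    using binflow_rec(1)[OF assms(1-3), of x] by (simp only: set_decode_code[OF fl])
  show "h 0 \<longleftrightarrow> i = 1" using binflow_rec(2)[OF assms(1-3)] by (simp add: h_def)
qed

context commuting_rows begin

lemma T_row_binflow:
  assumes bf: "binflow R 1 \<omega>" and j: "1 \<le> j" "j \<le> R"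
    and k: "\<And>n x. k \<le> x \<Longrightarrow> x \<notin> lev \<omega> n \<and> hor \<omega> n x = 0"
  shows "(\<Prod>x<k. wT q \<beta> (x \<in> set_decode (code \<omega> (j - 1))) (hor \<omega> j x = 1) (x \<in> set_decode (code \<omega> j)) (hor \<omega> j (Suc x) = 1)) =
      T True (code \<omega> (j - 1)) (code \<omega> j)"
    and "T True (code \<omega> (j - 1)) (code \<omega> j) \<noteq> 0"
proof -
  have fl: "flow R \<omega>" using bf by (simp add: binflow_def)
  have sub: "set_decode (code \<omega> n) \<subseteq> {..<k}" for n
    unfolding set_decode_code[OF fl] using k by (metis linorder_not_less lessThan_iff subsetI)
  show *: "(\<Prod>x<k. wT q \<beta> (x \<in> set_decode (code \<omega> (j - 1))) (hor \<omega> j x = 1) (x \<in> set_decode (code \<omega> j)) (hor \<omega> j (Suc x) = 1)) =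
      T True (code \<omega> (j - 1)) (code \<omega> j)"
    using T.row_prod[OF sub sub _ binflow_row(1)[OF bf j]] binflow_row(2)[OF bf j] k[of k j] by simp
  have "0 < wT q \<beta> (x \<in> set_decode (code \<omega> (j - 1))) (hor \<omega> j x = 1) (x \<in> set_decode (code \<omega> j)) (hor \<omega> j (Suc x) = 1)" for x
    by (rule T.pos[OF binflow_row(1)[OF bf j]])
  then show "T True (code \<omega> (j - 1)) (code \<omega> j) \<noteq> 0"
    unfolding *[symmetric] by (intro less_imp_neq[symmetric] prod_pos) blast
qed

lemma D_row_binflow:
  assumes bf: "binflow R 0 \<omega>" and j: "1 \<le> j" "j \<le> R"
    and k: "\<And>n x. k \<le> x \<Longrightarrow> x \<notin> lev \<omega> n \<and> hor \<omega> n x = 0"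
  shows "(\<Prod>x<k. wD q \<beta>' (x \<in> set_decode (code \<omega> j)) (\<not> hor \<omega> j x = 1) (x \<in> set_decode (code \<omega> (j - 1))) (\<not> hor \<omega> j (Suc x) = 1)) =
      D True (code \<omega> j) (code \<omega> (j - 1))"
    and "D True (code \<omega> j) (code \<omega> (j - 1)) \<noteq> 0"
proof -
  have fl: "flow R \<omega>" using bf by (simp add: binflow_def)
  have sub: "set_decode (code \<omega> n) \<subseteq> {..<k}" for n
    unfolding set_decode_code[OF fl] using k by (metis linorder_not_less lessThan_iff subsetI)
  have cons: "of_bool (x \<in> set_decode (code \<omega> j)) + of_bool (\<not> hor \<omega> j x = 1) =
      (of_bool (x \<in> set_decode (code \<omega> (j - 1))) + of_bool (\<not> hor \<omega> j (Suc x) = 1) :: nat)" for x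
    using binflow_row(1)[OF bf j, of x]
    by (cases "hor \<omega> j x = 1"; cases "hor \<omega> j (Suc x) = 1") simp_all
  show *: "(\<Prod>x<k. wD q \<beta>' (x \<in> set_decode (code \<omega> j)) (\<not> hor \<omega> j x = 1) (x \<in> set_decode (code \<omega> (j - 1))) (\<not> hor \<omega> j (Suc x) = 1)) =
      D True (code \<omega> j) (code \<omega> (j - 1))"
    using D.row_prod[OF sub sub _ cons] binflow_row(2)[OF bf j] k[of k j] by simp
  have "0 < wD q \<beta>' (x \<in> set_decode (code \<omega> j)) (\<not> hor \<omega> j x = 1) (x \<in> set_decode (code \<omega> (j - 1))) (\<not> hor \<omega> j (Suc x) = 1)" for x
    by (rule D.pos[OF cons])
  then show "D True (code \<omega> j) (code \<omega> (j - 1)) \<noteq> 0"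
    unfolding *[symmetric] by (intro less_imp_neq[symmetric] prod_pos) blast
qed

text \<open>A collection is determined by its levels. Conversely all vertices allowed by the ice
  rule have positive weight, so a list of sets is a sequence of levels exactly if its chain weight
  does not vanish.\<close>

lemma codes_bij:
  "bij_betw (codes N) (path_collections N) {xs. length xs = N \<and> chain (T True) 0 xs \<noteq> 0}"
proof (rule bij_betwI')
  fix \<omega> \<omega>' assume w: "\<omega> \<in> path_collections N" "\<omega>' \<in> path_collections N"
  show "codes N \<omega> = codes N \<omega>' \<longleftrightarrow> \<omega> = \<omega>'"
  proof
    assume eq: "codes N \<omega> = codes N \<omega>'"
    show "\<omega> = \<omega>'"
    proof (rule binflow_eqI[OF path_collections_binflow(1)[OF w(1)] path_collections_binflow(1)[OF w(2)]])
      fix n assume "n \<le> N"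
      show "code \<omega> n = code \<omega>' n"
      proof (cases "n = 0")
        case True
        then show ?thesis
          using path_collections_binflow(2)[OF w(1)] path_collections_binflow(2)[OF w(2)] by (simp add: code_def)
      next
        case False
        then have "n \<in> set [1..<N + 1]" using \<open>n \<le> N\<close> by auto
        then show ?thesis using eq unfolding codes_def map_eq_conv by blast
      qed
    qed
  qed simp
next
  fix \<omega> assume w: "\<omega> \<in> path_collections N"
  note bf = path_collections_binflow(1)[OF w]
  have c0: "code \<omega> 0 = 0" using path_collections_binflow(2)[OF w] by (simp add: code_def)
  obtain k where k: "\<And>n x. k \<le> x \<Longrightarrow> x \<notin> lev \<omega> n \<and> hor \<omega> n x = 0"
    using flow_bounded bf unfolding binflow_def by blast
  have "chain (T True) (code \<omega> 0) (codes N \<omega>) \<noteq> 0"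
    unfolding codes_def chain_upt using T_row_binflow(2)[OF bf _ _ k] by (simp add: prod_zero_iff)
  then show "codes N \<omega> \<in> {xs. length xs = N \<and> chain (T True) 0 xs \<noteq> 0}"
    using c0 by (simp add: codes_def del: upt_Suc)
next
  fix xs assume "xs \<in> {xs. length xs = N \<and> chain (T True) 0 xs \<noteq> 0}"
  then have xs: "length xs = N" "chain (T True) 0 xs \<noteq> 0" by auto
  define c where "c n = (0 # xs) ! n" for n
  have m: "map c [1..<N + 1] = xs"
    by (rule nth_equalityI) (simp_all add: xs(1) c_def del: upt_Suc)
  have "c 0 = 0" by (simp add: c_def)
  then have "(\<Prod>j=1..N. T True (c (j - 1)) (c j)) \<noteq> 0"
    using xs(2) chain_upt[of "T True" c N] m by simp
  then have nz: "T True (c (j - 1)) (c j) \<noteq> 0" if "1 \<le> j" "j \<le> N" for j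
    using that by (simp add: prod_zero_iff)
  have "\<exists>\<omega>. binflow N 1 \<omega> \<and> (\<forall>n\<le>N. code \<omega> n = c n)"
  proof (rule exists_binflow)
    fix j assume "1 \<le> j" "j \<le> N"
    from T.row_exists[OF nz[OF this]]
    show "\<exists>h n. h 0 = (1 = (1::nat)) \<and> (\<forall>x\<ge>n. \<not> h x) \<and>
      (\<forall>x. of_bool (x \<in> set_decode (c (j - 1))) + of_bool (h x) =
        (of_bool (x \<in> set_decode (c j)) + of_bool (h (Suc x)) :: nat))" by simp
  qed simp
  then obtain \<omega> where w: "binflow N 1 \<omega>" "\<And>n. n \<le> N \<Longrightarrow> code \<omega> n = c n" by blast
  have fl: "flow N \<omega>" using w by (simp add: binflow_def)
  have "lev \<omega> 0 = {}"
    using set_decode_code[OF fl, of 0] w(2)[of 0] \<open>c 0 = 0\<close> by simp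
  then have "\<omega> \<in> path_collections N" by (rule binflow_path_collections[OF w(1)])
  moreover have "codes N \<omega> = map c [1..<N + 1]" unfolding codes_def by (rule map_cong) (use w(2) in auto)
  then have "xs = codes N \<omega>" using m by simp
  ultimately show "\<exists>\<omega>\<in>path_collections N. xs = codes N \<omega>" by blast
qed

lemma nn_integral_path_collections:
  "(\<integral>\<^sup>+\<omega>. ennreal (chain (T True) 0 (codes N \<omega>)) * g (code \<omega> N) \<partial>count_space (path_collections N)) = (TT ^^ N) g 0"
proof -
  let ?f = "\<lambda>xs. ennreal (chain (T True) 0 xs) * g (last (0 # xs)) * indicator {xs. length xs = N} xs"
  have "(\<integral>\<^sup>+\<omega>. ennreal (chain (T True) 0 (codes N \<omega>)) * g (code \<omega> N) \<partial>count_space (path_collections N)) =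
      (\<integral>\<^sup>+\<omega>. ?f (codes N \<omega>) \<partial>count_space (path_collections N))"
  proof (rule nn_integral_cong)
    fix \<omega> assume "\<omega> \<in> space (count_space (path_collections N))"
    then have "code \<omega> 0 = 0" using path_collections_binflow(2)[of \<omega> N] by (simp add: code_def)
    then have "last (0 # codes N \<omega>) = code \<omega> N"
      using last_map_upt[of "code \<omega>" N] unfolding codes_def by (simp only:)
    moreover have "length (codes N \<omega>) = N" by (simp add: codes_def del: upt_Suc)
    ultimately show "ennreal (chain (T True) 0 (codes N \<omega>)) * g (code \<omega> N) = ?f (codes N \<omega>)" by simp
  qed
  also have "\<dots> = (\<integral>\<^sup>+xs. ?f xs \<partial>count_space {xs. length xs = N \<and> chain (T True) 0 xs \<noteq> 0})"
    by (rule nn_integral_bij_count_space[OF codes_bij])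
  also have "\<dots> = (\<integral>\<^sup>+xs. ?f xs \<partial>count_space UNIV)"
    by (rule nn_integral_count_space_eq) (auto simp: indicator_def)
  also have "\<dots> = (TT ^^ N) g 0" by (rule nn_integral_chain[OF T.row_nonneg])
  finally show ?thesis .
qed

end

section \<open>Skew collections and the reduction to one arrow per edge\<close>

lemma skew_walks:
  assumes "\<omega> \<in> skew_collections N M lam nu" and nu: "\<And>m. m \<in> {1..N} \<Longrightarrow> 0 \<le> part nu m"
  shows "\<exists>p. \<omega> = arrows N p \<and>
    (\<forall>m\<in>{1..N}. strip_walk M (part nu m, 0) (part nu m, 1) (part lam m, int M) (part lam m, int M + 1) (p m)) \<and>
    disjoint_family_on (\<lambda>m. horizontal_edges (p m)) {1..N}"
proof -
  obtain p where p: "\<omega> = arrows N p" "\<forall>m\<in>{1..N}. strip_path M ((part nu m, 0), (part nu m, 1))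
        ((part lam m, int M), (part lam m, int M + 1)) (p m)"
    "disjoint_family_on (\<lambda>m. horizontal_edges (p m)) {1..N}"
    using assms(1) unfolding skew_collections_def by blast
  have "strip_walk M (part nu m, 0) (part nu m, 1) (part lam m, int M) (part lam m, int M + 1) (p m)" if "m \<in> {1..N}" for m
    by (rule strip_walk_skew[OF bspec[OF p(2) that] nu[OF that]])
  with p(1,3) show ?thesis by (intro exI[of _ p] conjI ballI)
qed

lemma skew_collections_props:
  assumes w: "\<omega> \<in> skew_collections N M lam nu" and nu: "\<And>m. m \<in> {1..N} \<Longrightarrow> 0 \<le> part nu m"
  shows "flow M \<omega>"
    and "\<omega> ((x, y), (x + 1, y)) \<le> 1"
    and "\<omega> ((-1, y), (0, y)) = 0"
    and "\<omega> ((x, 0), (x, 1)) = card {m \<in> {1..N}. part nu m = x}"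
    and "\<omega> ((x, int M), (x, int M + 1)) = card {m \<in> {1..N}. part lam m = x}"
    and "\<omega> e \<le> N"
    and "\<omega> e \<noteq> 0 \<Longrightarrow> \<exists>m\<in>{1..N}. fst (fst e) \<le> part lam m"
proof -
  obtain p where p: "\<omega> = arrows N p"
    and W': "\<forall>m\<in>{1..N}. strip_walk M (part nu m, 0) (part nu m, 1) (part lam m, int M) (part lam m, int M + 1) (p m)"
    and dis: "disjoint_family_on (\<lambda>m. horizontal_edges (p m)) {1..N}"
    using skew_walks[OF assms] by blast
  note W = bspec[OF W']
  show "flow M \<omega>" unfolding p by (rule arrows_flow[OF W])
  show "\<omega> ((x, y), (x + 1, y)) \<le> 1"
    unfolding p arrows_def
  proof (rule card_le_1)
    fix m n assume mn: "m \<in> {m \<in> {1..N}. ((x, y), (x + 1, y)) \<in> path_edges (p m)}"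
      "n \<in> {m \<in> {1..N}. ((x, y), (x + 1, y)) \<in> path_edges (p m)}"
    then have "((x, y), (x + 1, y)) \<in> horizontal_edges (p m) \<inter> horizontal_edges (p n)"
      by (simp add: horizontal_edges_def)
    then show "m = n" using dis mn unfolding disjoint_family_on_def by blast
  qed simp
  have "((-1, y), (0, y)) \<notin> path_edges (p m)" if "m \<in> {1..N}" for m
    using strip_walk.edge_from_outside[OF W[OF that], of "(-1, y)" "(0, y)"] nu[OF that] by (auto simp: strip_def)
  then have "{m \<in> {1..N}. ((-1, y), (0, y)) \<in> path_edges (p m)} = {}" by blast
  then show "\<omega> ((-1, y), (0, y)) = 0" unfolding p arrows_def by simp
  have "((x, 0), (x, 1)) \<in> path_edges (p m) \<longleftrightarrow> part nu m = x" if m: "m \<in> {1..N}" for m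
    using strip_walk.edge_from_outside[OF W[OF m], of "(x, 0)" "(x, 1)"] strip_walk.first_edge[OF W[OF m]]
    by (auto simp: strip_def)
  then show "\<omega> ((x, 0), (x, 1)) = card {m \<in> {1..N}. part nu m = x}"
    unfolding p arrows_def by (intro arg_cong[where f = card]) blast
  have "((x, int M), (x, int M + 1)) \<in> path_edges (p m) \<longleftrightarrow> part lam m = x" if m: "m \<in> {1..N}" for m
    using strip_walk.edge_to_outside[OF W[OF m], of "(x, int M)" "(x, int M + 1)"] strip_walk.last_edge[OF W[OF m]]
    by (auto simp: strip_def)
  then show "\<omega> ((x, int M), (x, int M + 1)) = card {m \<in> {1..N}. part lam m = x}"
    unfolding p arrows_def by (intro arg_cong[where f = card]) blast
  have "card {m \<in> {1..N}. e \<in> path_edges (p m)} \<le> card {1..N}" by (intro card_mono) auto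
  then show "\<omega> e \<le> N" unfolding p arrows_def by simp
  assume "\<omega> e \<noteq> 0"
  then have "{m \<in> {1..N}. e \<in> path_edges (p m)} \<noteq> {}" unfolding p arrows_def by (metis card.empty)
  then obtain m where m: "m \<in> {1..N}" "e \<in> path_edges (p m)" by blast
  obtain a b z where e: "e = ((a, b), z)" by (metis surj_pair)
  show "\<exists>m\<in>{1..N}. fst (fst e) \<le> part lam m"
    using strip_walk.edge_le_end[OF W[OF m(1)]] m unfolding e by (intro bexI[of _ m]) simp_all
qed

text \<open>A path never passes the abscissa of its end, so only finitely many edges are available.
  Finiteness matters because the sum in \<open>Gc\<close> would be 0 by default over an infinite
  set.\<close>

lemma finite_skew_collections:
  assumes nu: "\<And>m. m \<in> {1..N} \<Longrightarrow> 0 \<le> part nu m"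
  shows "finite (skew_collections N M lam nu)"
proof -
  let ?L = "\<Union>m\<in>{1..N}. {-1..part lam m}"
  let ?E = "(\<lambda>(x, y). ((x, y), (x + 1, y))) ` (?L \<times> {0..int M}) \<union> (\<lambda>(x, y). ((x, y), (x, y + 1))) ` (?L \<times> {0..int M})"
  have "\<omega> \<in> {f. \<forall>e. (e \<in> ?E \<longrightarrow> f e \<in> {..N}) \<and> (e \<notin> ?E \<longrightarrow> f e = 0)}"
    if w: "\<omega> \<in> skew_collections N M lam nu" for \<omega>
  proof -
    have "e \<in> ?E" if nz: "\<omega> e \<noteq> 0" for e
    proof -
      obtain m where m: "m \<in> {1..N}" "fst (fst e) \<le> part lam m"
        using skew_collections_props(7)[OF w nu nz] by blast
      have "strip_edge M e" using skew_collections_props(1)[OF w nu] nz unfolding flow_def by blast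
      then show ?thesis using m unfolding strip_edge_def by (force simp: image_iff)
    qed
    then show ?thesis using skew_collections_props(6)[OF w nu] by blast
  qed
  moreover have "finite {f. \<forall>e. (e \<in> ?E \<longrightarrow> f e \<in> {..N}) \<and> (e \<notin> ?E \<longrightarrow> f e = (0::nat))}"
    by (rule finite_set_of_finite_funs) auto
  ultimately show ?thesis by (meson finite_subset subsetI)
qed

lemma skew_binflow:
  assumes w: "\<omega> \<in> skew_collections N M (lst B) (lst A)" and fin: "finite A" "finite B" "card A = N" "card B = N"
    and le: "\<forall>e. \<omega> e \<le> 1"
  shows "binflow M 0 \<omega>" "lev \<omega> 0 = A" "lev \<omega> M = B"
proof -
  have nu: "0 \<le> part (lst A) m" if "m \<in> {1..N}" for m
    using part_lst[of A m] fin that by simp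
  note props = skew_collections_props[OF w nu]
  show "binflow M 0 \<omega>" unfolding binflow_def using props(1,3) le by simp
  have "card {m \<in> {1..N}. part (lst S) m = int x} = of_bool (x \<in> S)" if "finite S" "card S = N" for S x
  proof -
    have "{m \<in> {1..N}. part (lst S) m = int x} = {m \<in> {1..card S}. int (en S m) = int x}"
      using part_lst[OF that(1)] that(2) by auto
    then show ?thesis using card_en_eq[OF that(1), of "int x"] by simp
  qed
  then show "lev \<omega> 0 = A" "lev \<omega> M = B"
    using props(4,5) fin by (auto simp: lev_def)
qed

text \<open>The first row in which two arrows leave a vertex upwards makes the weight vanish there, as
  \<open>s\<^sup>2 q = 1\<close>.\<close>

lemma weight_c_zero:
  assumes s: "0 < s" and fl: "flow M \<omega>" and h: "\<And>x y. \<omega> ((x, y), (x + 1, y)) \<le> 1"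
    and l0: "\<And>x. \<omega> ((x, 0), (x, 1)) \<le> 1" and big: "\<not> (\<forall>e. \<omega> e \<le> 1)"
  shows "\<exists>x j. 1 \<le> j \<and> j \<le> M \<and> weight_c s v (vertex_type \<omega> (int x) (int j)) = 0"
proof -
  obtain e where e: "\<not> \<omega> e \<le> 1" using big by blast
  then have "strip_edge M e" using fl unfolding flow_def by (metis le0)
  then obtain x y where xy: "e = ((x, y), (x, y + 1))" "0 \<le> x" "0 \<le> y" "y \<le> int M"
    using h e unfolding strip_edge_def by blast
  let ?P = "\<lambda>j. 1 < \<omega> ((x, int j), (x, int j + 1))"
  have P: "?P (nat y)" using e xy by simp
  define j where "j = (LEAST j. ?P j)"
  have j: "?P j" "j \<le> nat y" and min: "\<And>i. i < j \<Longrightarrow> \<not> ?P i"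
    unfolding j_def using LeastI[of ?P, OF P] Least_le[of ?P, OF P] not_less_Least[of _ ?P] by blast+
  have "j \<noteq> 0" using l0[of x] j(1) by (cases j) simp_all
  then have j1: "1 \<le> j" "j \<le> M" using j(2) xy by auto
  have below: "\<omega> ((x, int j - 1), (x, int j)) \<le> 1"
    using min[of "j - 1"] j1 by (simp add: of_nat_diff)
  have "\<omega> ((x, int j - 1), (x, int j)) + \<omega> ((x - 1, int j), (x, int j)) =
      \<omega> ((x, int j), (x, int j + 1)) + \<omega> ((x, int j), (x + 1, int j))"
    using fl j1 xy unfolding flow_def by simp
  moreover have "\<omega> ((x - 1, int j), (x, int j)) \<le> 1" using h[of "x - 1" "int j"] by simp
  ultimately have "vertex_type \<omega> x (int j) = (1, 1, 2, 0)"
    using below j(1) unfolding vertex_type_def by simp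
  moreover have "s\<^sup>2 * qpar s = 1" using s by (simp add: qpar_def power_int_minus)
  ultimately have "weight_c s v (vertex_type \<omega> x (int j)) = 0" by (simp add: weight_c_def)
  then show ?thesis using j1 xy(2) by (intro exI[of _ "nat x"] exI[of _ j]) simp
qed

subsection \<open>The measure on path collections\<close>

locale six_vertex_measure =
  fixes s u v :: real
  assumes s: "1 < s" and u: "s < u" and v: "0 < v" "v < inverse u"
begin

definition q :: real where "q = qpar s"
text \<open>One function of the spectral parameter, taken at u and at 1/v. It increases on the
  parameters in question, so u v < 1 becomes \<open>\<beta> < \<beta>'\<close>.\<close>

definition \<beta> :: real where "\<beta> = (u - s) / (u - s * q)"
definition \<beta>' :: real where "\<beta>' = (1 / v - s) / (1 / v - s * q)"

lemma q_eq: "q = 1 / s\<^sup>2" "s * q = 1 / s"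
proof -
  show "q = 1 / s\<^sup>2" by (simp add: q_def qpar_def power_int_minus inverse_eq_divide)
  then show "s * q = 1 / s" using s by (simp add: power2_eq_square)
qed

lemma uv: "u < 1 / v"
proof -
  have "v * u < inverse u * u" using v s u by (intro mult_strict_right_mono) auto
  then have "u * v < 1" using s u by (simp add: mult.commute)
  then show ?thesis using v by (simp add: pos_less_divide_eq)
qed

lemma s_inv: "1 / s < 1" using s by simp

lemma beta_eq: "\<beta> = s * (u - s) / (s * u - 1)"
proof -
  have "u - s * q = (s * u - 1) / s" using s by (simp add: q_eq(2) field_simps)
  then show ?thesis unfolding \<beta>_def by (simp add: mult.commute)
qed

lemma beta'_eq: "\<beta>' = (1 - s * v) / (1 - v / s)"
proof -
  have "1 / v - s * q = (1 - v / s) / v" "1 / v - s = (1 - s * v) / v" using v s by (simp_all add: q_eq(2) field_simps)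
  then show ?thesis unfolding \<beta>'_def using v by simp
qed

lemma nonzero: "0 < s * u - 1" "0 < 1 - s * v"
proof -
  have "1 * 1 < s * u" using s u by (intro mult_strict_mono) auto
  then show "0 < s * u - 1" by simp
  have "s < 1 / v" using uv u by linarith
  then show "0 < 1 - s * v" using v by (simp add: pos_less_divide_eq)
qed

lemma commuting_rows: "commuting_rows q \<beta> \<beta>'"
proof
  have sq: "1 < s\<^sup>2" using s by (simp add: one_less_power)
  then show "0 < q" "q < 1" using s by (simp_all add: q_eq(1))
  have d: "0 < u - s * q" "0 < 1 / v - s * q" using s_inv s u uv unfolding q_eq(2) by linarith+
  show "0 < \<beta>" unfolding \<beta>_def using u d by (intro divide_pos_pos) auto
  have "(w - s) * (u - k) - (u - s) * (w - k) = (w - u) * (s - k)" for w k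
    by (simp add: algebra_simps)
  then have "(1 / v - s) * (u - s * q) - (u - s) * (1 / v - s * q) = (1 / v - u) * (s - s * q)" .
  moreover have "0 < (1 / v - u) * (s - s * q)" using uv less_trans[OF s_inv s] unfolding q_eq(2) by (intro mult_pos_pos) linarith+
  ultimately have "(u - s) * (1 / v - s * q) < (1 / v - s) * (u - s * q)" by linarith
  then show "\<beta> < \<beta>'" unfolding \<beta>_def \<beta>'_def using d by (simp add: divide_simps mult.commute)
  show "\<beta>' < 1" unfolding \<beta>'_def using d less_trans[OF s_inv s] by (simp add: q_eq(2))
qed

sublocale commuting_rows q \<beta> \<beta>' by (rule commuting_rows)

text \<open>The factor \<open>- 1 / s\<close> per outgoing horizontal arrow is read off from the
  crossing of an empty column, and \<open>- s\<^sup>2\<close> from the turns. Only the turns see the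
  latter, so it telescopes along a row.\<close>

lemma weight_gauge:
  "weight s u (of_bool a, of_bool i, of_bool c, of_bool j) =
     (if j then - 1 / s else 1) * ((if j then - s\<^sup>2 else 1) / (if i then - s\<^sup>2 else 1)) * wT q \<beta> a i c j"
proof -
  have nz: "1 - s * u \<noteq> 0" "s * u - 1 \<noteq> 0" "s \<noteq> 0" using nonzero s by auto
  show ?thesis
    unfolding beta_eq using nz
    by (cases a; cases i; cases c; cases j;
        simp add: weight_def q_def[symmetric] q_eq power2_eq_square divide_simps)
      (simp_all add: algebra_simps)
qed

text \<open>Above and below are exchanged and the horizontal states negated. The factor
  \<open>- s\<close> is inverse to the one of the u-rows, so the two cancel at the level where the
  rows meet.\<close>

lemma weight_c_gauge:
  "weight_c s v (of_bool a, of_bool i, of_bool c, of_bool j) =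
     (if j then - s else 1) * ((if j then - 1 / s\<^sup>2 else 1) / (if i then - 1 / s\<^sup>2 else 1)) * wD q \<beta>' c (\<not> i) a (\<not> j)"
proof -
  have nz: "1 - s * v \<noteq> 0" "s \<noteq> 0" "s - v \<noteq> 0" "1 - v / s \<noteq> 0"
  proof -
    show "1 - s * v \<noteq> 0" "s \<noteq> 0" using nonzero s by auto
    have "s * v < 1" using nonzero by simp
    moreover have "1 * v \<le> s * v" using s v by (intro mult_right_mono) auto
    ultimately have "v < 1" by simp
    then show "s - v \<noteq> 0" "1 - v / s \<noteq> 0" using s by (auto simp: field_simps)
  qed
  show ?thesis
    unfolding beta'_eq wD_def using nz
    by (cases a; cases i; cases c; cases j;
        simp add: weight_c_def q_def[symmetric] q_eq power2_eq_square divide_simps)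
      (simp_all add: algebra_simps)
qed

end

section \<open>The v-rows read from top to bottom\<close>

abbreviation wsum :: "nat \<Rightarrow> nat" where "wsum C \<equiv> \<Sum>(set_decode C)"

definition codes_down :: "nat \<Rightarrow> config \<Rightarrow> nat list" where
  "codes_down M \<omega> = map (\<lambda>k. code \<omega> (M - k)) [1..<M + 1]"

lemma sorted_list_of_set_unique': "finite A \<Longrightarrow> sorted_wrt (<) l \<Longrightarrow> set l = A \<Longrightarrow> sorted_list_of_set A = l"
  for l :: "'a :: linorder list"
  by (metis sorted_list_of_set.idem_if_sorted_distinct strict_sorted_iff)

lemma set_lst: "finite S \<Longrightarrow> set (lst S) = int ` S"
  by (simp add: lst_def)

lemma lst_inj: "finite S \<Longrightarrow> finite S' \<Longrightarrow> lst S = lst S' \<Longrightarrow> S = S'"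
  by (metis set_lst inj_image_eq_iff inj_of_nat)

lemma level_lst:
  assumes "flow N \<omega>" shows "level N \<omega> = lst (lev \<omega> N)"
proof -
  have "0 \<le> x" if "0 < \<omega> ((x, int N), (x, int N + 1))" for x
  proof -
    have "strip_edge N ((x, int N), (x, int N + 1))" using assms that unfolding flow_def by simp
    then show ?thesis by (auto simp: strip_edge_def)
  qed
  then have "{x. 0 < \<omega> ((x, int N), (x, int N + 1))} = int ` lev \<omega> N"
    unfolding lev_def by (auto simp: image_iff) (metis nat_0_le)
  moreover have "sorted_list_of_set (int ` lev \<omega> N) = map int (sorted_list_of_set (lev \<omega> N))"
    using finite_lev[OF assms, of N]
    by (intro sorted_list_of_set_unique') (simp_all add: sorted_wrt_map)
  ultimately show ?thesis by (simp add: level_def lst_def rev_map)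
qed

text \<open>The counterpart of \<open>codes_bij\<close>. The horizontal states \<open>h\<close> of
  the kernel are complements of arrows, hence full at both ends of a row. The top level L is the
  starting point of the chain and not in the list, whose last entry is the bottom level B.\<close>

lemma codes_down_bij:
  assumes M: "1 \<le> M" and N: "card (set_decode L) = N" "card (set_decode B) = N"
    and K: "\<And>A C. K A C \<noteq> 0 \<Longrightarrow> \<exists>h n. h 0 \<and> (\<forall>x\<ge>n. h x) \<and>
      (\<forall>x. of_bool (x \<in> set_decode A) + of_bool (h x) = (of_bool (x \<in> set_decode C) + of_bool (h (Suc x)) :: nat))"
    and K': "\<And>\<omega> j. binflow M 0 \<omega> \<Longrightarrow> 1 \<le> j \<Longrightarrow> j \<le> M \<Longrightarrow> K (code \<omega> j) (code \<omega> (j - 1)) \<noteq> (0::real)"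
  defines "S \<equiv> {\<omega> \<in> skew_collections N M (lst (set_decode L)) (lst (set_decode B)). \<forall>e. \<omega> e \<le> 1}"
  shows "bij_betw (codes_down M) S {xs. length xs = M \<and> last xs = B \<and> chain K L xs \<noteq> 0}"
    and "\<And>\<omega>. \<omega> \<in> S \<Longrightarrow> binflow M 0 \<omega> \<and> code \<omega> 0 = B \<and> code \<omega> M = L"
proof -
  show props: "binflow M 0 \<omega> \<and> code \<omega> 0 = B \<and> code \<omega> M = L" if "\<omega> \<in> S" for \<omega>
    using skew_binflow[of \<omega> N M "set_decode L" "set_decode B"] that N unfolding S_def code_def
    by (simp add: set_decode_inverse)
  show "bij_betw (codes_down M) S {xs. length xs = M \<and> last xs = B \<and> chain K L xs \<noteq> 0}"
  proof (rule bij_betwI')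
    fix \<omega> \<omega>' assume w: "\<omega> \<in> S" "\<omega>' \<in> S"
    show "codes_down M \<omega> = codes_down M \<omega>' \<longleftrightarrow> \<omega> = \<omega>'"
    proof
      assume eq: "codes_down M \<omega> = codes_down M \<omega>'"
      show "\<omega> = \<omega>'"
      proof (rule binflow_eqI)
        show "binflow M 0 \<omega>" "binflow M 0 \<omega>'" using props w by auto
        fix n assume n: "n \<le> M"
        show "code \<omega> n = code \<omega>' n"
        proof (cases "n = M")
          case True
          then show ?thesis using props w by metis
        next
          case False
          then have "M - n \<in> set [1..<M + 1]" using n by auto
          then have "code \<omega> (M - (M - n)) = code \<omega>' (M - (M - n))"
            using eq unfolding codes_down_def map_eq_conv by blast
          then show ?thesis using n by simp
        qed
      qed
    qed simp
  next
    fix \<omega> assume w: "\<omega> \<in> S"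
    have bf: "binflow M 0 \<omega>" and c: "code \<omega> 0 = B" "code \<omega> M = L" using props[OF w] by auto
    have l: "length (codes_down M \<omega>) = M" by (simp add: codes_down_def del: upt_Suc)
    have "last (code \<omega> (M - 0) # codes_down M \<omega>) = code \<omega> (M - M)"
      unfolding codes_down_def by (rule last_map_upt[of "\<lambda>k. code \<omega> (M - k)"])
    moreover have "codes_down M \<omega> \<noteq> []" using l M by auto
    ultimately have "last (codes_down M \<omega>) = B" using c by simp
    moreover have "K (code \<omega> (M - (k - 1))) (code \<omega> (M - k)) \<noteq> 0" if "1 \<le> k" "k \<le> M" for k
      using K'[OF bf, of "M - (k - 1)"] that by (simp add: Suc_diff_le)
    then have "chain K (code \<omega> (M - 0)) (codes_down M \<omega>) \<noteq> 0"
      unfolding codes_down_def chain_upt[of K "\<lambda>k. code \<omega> (M - k)" M] by (simp add: prod_zero_iff)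
    ultimately show "codes_down M \<omega> \<in> {xs. length xs = M \<and> last xs = B \<and> chain K L xs \<noteq> 0}"
      using l c by simp
  next
    fix xs assume "xs \<in> {xs. length xs = M \<and> last xs = B \<and> chain K L xs \<noteq> 0}"
    then have xs: "length xs = M" "last xs = B" "chain K L xs \<noteq> 0" by auto
    define c where "c n = (L # xs) ! (M - n)" for n
    have m: "map (\<lambda>k. c (M - k)) [1..<M + 1] = xs"
      by (rule nth_equalityI) (simp_all add: xs(1) c_def del: upt_Suc)
    have cM: "c M = L" by (simp add: c_def)
    have c0: "c 0 = B" using xs(1,2) M by (cases xs rule: rev_cases) (auto simp: c_def nth_append)
    have "(\<Prod>k=1..M. K (c (M - (k - 1))) (c (M - k))) \<noteq> 0"
      using xs(3) chain_upt[of K "\<lambda>k. c (M - k)" M] unfolding m by (simp add: cM)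
    then have nz': "K (c (M - (k - 1))) (c (M - k)) \<noteq> 0" if "1 \<le> k" "k \<le> M" for k
      using that by (simp add: prod_zero_iff)
    have nz: "K (c j) (c (j - 1)) \<noteq> 0" if j: "1 \<le> j" "j \<le> M" for j
    proof -
      have e: "M - (M - j + 1 - 1) = j" "M - (M - j + 1) = j - 1" "1 \<le> M - j + 1" "M - j + 1 \<le> M"
        using j by auto
      show ?thesis using nz'[OF e(3,4)] unfolding e(1) e(2) .
    qed
    have "\<exists>\<omega>. binflow M 0 \<omega> \<and> (\<forall>n\<le>M. code \<omega> n = c n)"
    proof (rule exists_binflow)
      fix j assume "1 \<le> j" "j \<le> M"
      from K[OF nz[OF this]] obtain h n where h: "h 0" "\<forall>x\<ge>n. h x"
        "\<And>x. of_bool (x \<in> set_decode (c j)) + of_bool (h x) = (of_bool (x \<in> set_decode (c (j - 1))) + of_bool (h (Suc x)) :: nat)"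
        by blast
      have "of_bool (x \<in> set_decode (c (j - 1))) + of_bool (\<not> h x) =
        (of_bool (x \<in> set_decode (c j)) + of_bool (\<not> h (Suc x)) :: nat)" for x
        using h(3)[of x] by (cases "h x"; cases "h (Suc x)") simp_all
      then show "\<exists>h n. h 0 = (0 = (1::nat)) \<and> (\<forall>x\<ge>n. \<not> h x) \<and>
        (\<forall>x. of_bool (x \<in> set_decode (c (j - 1))) + of_bool (h x) =
        (of_bool (x \<in> set_decode (c j)) + of_bool (h (Suc x)) :: nat))"
        using h(1,2) by (intro exI[of _ "\<lambda>x. \<not> h x"] exI[of _ n]) simp
    qed simp
    then obtain \<omega> where w: "binflow M 0 \<omega>" "\<And>n. n \<le> M \<Longrightarrow> code \<omega> n = c n" by blast
    have fl: "flow M \<omega>" and le: "\<forall>e. \<omega> e \<le> 1" using w by (simp_all add: binflow_def)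
    have l: "lev \<omega> 0 = set_decode B" "lev \<omega> M = set_decode L"
      using set_decode_code[OF fl, of 0] set_decode_code[OF fl, of M] w(2)[of 0] w(2)[of M] c0 cM by simp_all
    have "\<omega> \<in> skew_collections N M (lst (lev \<omega> M)) (lst (lev \<omega> 0))"
      by (rule binflow_skew_collections[OF w(1) M]) (simp add: l N)
    then have "\<omega> \<in> S" using le unfolding S_def l by simp
    moreover have "codes_down M \<omega> = map (\<lambda>k. c (M - k)) [1..<M + 1]"
      unfolding codes_down_def by (rule map_cong) (use w(2) in auto)
    then have "xs = codes_down M \<omega>" using m by simp
    ultimately show "\<exists>\<omega>\<in>S. xs = codes_down M \<omega>" by blast
  qed
qed

lemma chain_codes_down:
  "chain K (code \<omega> M) (codes_down M \<omega>) = (\<Prod>j=1..M. K (code \<omega> j) (code \<omega> (j - 1)))"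
proof -
  have "chain K (code \<omega> (M - 0)) (codes_down M \<omega>) = (\<Prod>k=1..M. K (code \<omega> (M - (k - 1))) (code \<omega> (M - k)))"
    unfolding codes_down_def by (rule chain_upt[of K "\<lambda>k. code \<omega> (M - k)" M])
  also have "\<dots> = (\<Prod>k=1..M. K (code \<omega> (M + 1 - k)) (code \<omega> (M + 1 - k - 1)))"
    by (rule prod.cong) (auto simp: Suc_diff_le)
  also have "\<dots> = (\<Prod>j=1..M. K (code \<omega> j) (code \<omega> (j - 1)))"
    by (rule prod.atLeastAtMost_rev[symmetric])
  finally show ?thesis by simp
qed

context six_vertex_measure begin

lemma rows_c:
  assumes bf: "binflow M 0 \<omega>"
  shows "(\<Prod>i. \<Prod>j=1..M. weight_c s v (vertex_type \<omega> (int i) (int j))) =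
    (- s) ^ wsum (code \<omega> M) / (- s) ^ wsum (code \<omega> 0) * chain (D True) (code \<omega> M) (codes_down M \<omega>)"
proof -
  have fl: "flow M \<omega>" using bf by (simp add: binflow_def)
  obtain k where k: "\<And>n x. k \<le> x \<Longrightarrow> x \<notin> lev \<omega> n \<and> hor \<omega> n x = 0"
    using flow_bounded[OF fl] by blast
  have sub: "set_decode (code \<omega> n) \<subseteq> {..<k}" for n
    unfolding set_decode_code[OF fl] using k by (metis linorder_not_less lessThan_iff subsetI)
  have w0: "weight_c s v (0, 0, 0, 0) = 1" using nonzero by (simp add: weight_c_def)
  let ?r = "\<lambda>j. (- s) ^ wsum (code \<omega> j) / (- s) ^ wsum (code \<omega> (j - 1)) * D True (code \<omega> j) (code \<omega> (j - 1))"
  have row: "(\<Prod>x<k. weight_c s v (vertex_type \<omega> (int x) (int j))) = ?r j" if j: "1 \<le> j" "j \<le> M" for j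
  proof -
    have "(\<Prod>x<k. weight_c s v (vertex_type \<omega> (int x) (int j))) =
      (\<Prod>x<k. weight_c s v (of_bool (x \<in> set_decode (code \<omega> (j - 1))), of_bool (hor \<omega> j x = 1),
        of_bool (x \<in> set_decode (code \<omega> j)), of_bool (hor \<omega> j (Suc x) = 1)))"
      unfolding vertex_type_binflow[OF bf j] set_decode_code[OF fl] ..
    also have "\<dots> = (- s) ^ wsum (code \<omega> j) / (- s) ^ wsum (code \<omega> (j - 1)) / (if hor \<omega> j 0 = 1 then - 1 / s\<^sup>2 else 1) *
       (\<Prod>x<k. wD q \<beta>' (x \<in> set_decode (code \<omega> j)) (\<not> hor \<omega> j x = 1) (x \<in> set_decode (code \<omega> (j - 1))) (\<not> hor \<omega> j (Suc x) = 1))"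
      by (rule gauge_row[where w' = "\<lambda>a i c j. wD q \<beta>' c (\<not> i) a (\<not> j)" and h = "\<lambda>x. hor \<omega> j x = 1",
          OF sub sub _ binflow_row(1)[OF bf j] _ _ weight_c_gauge])
        (use k[of k j] s in auto)
    also have "hor \<omega> j 0 = 0" using binflow_rec(2)[OF bf j] .
    also note D_row_binflow(1)[OF bf j k]
    finally show ?thesis by simp
  qed
  have "(\<Prod>i. \<Prod>j=1..M. weight_c s v (vertex_type \<omega> (int i) (int j))) = (\<Prod>j=1..M. \<Prod>x<k. weight_c s v (vertex_type \<omega> (int x) (int j)))"
    by (rule prodinf_rows[where W = "\<lambda>_. weight_c s v", OF fl w0 k])
  also have "\<dots> = (\<Prod>j=1..M. ?r j)" by (rule prod.cong) (use row in auto)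
  also have "\<dots> = (- s) ^ wsum (code \<omega> M) / (- s) ^ wsum (code \<omega> 0) * (\<Prod>j=1..M. D True (code \<omega> j) (code \<omega> (j - 1)))"
    unfolding prod.distrib using s by (subst prod_telescope_atLeastAtMost) simp_all
  finally show ?thesis by (simp only: chain_codes_down)
qed

lemma rows_u:
  assumes w: "\<omega> \<in> path_collections N"
  shows "(\<Prod>i. \<Prod>j=1..N. weight s u (vertex_type \<omega> (int i) (int j))) =
    (- 1 / s) ^ wsum (code \<omega> N) * (1 / (- s\<^sup>2)) ^ N * chain (T True) 0 (codes N \<omega>)"
proof -
  note bf = path_collections_binflow(1)[OF w]
  have fl: "flow N \<omega>" using bf by (simp add: binflow_def)
  have c0: "code \<omega> 0 = 0" using path_collections_binflow(2)[OF w] by (simp add: code_def)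
  obtain k where k: "\<And>n x. k \<le> x \<Longrightarrow> x \<notin> lev \<omega> n \<and> hor \<omega> n x = 0"
    using flow_bounded[OF fl] by blast
  have sub: "set_decode (code \<omega> n) \<subseteq> {..<k}" for n
    unfolding set_decode_code[OF fl] using k by (metis linorder_not_less lessThan_iff subsetI)
  have w0: "weight s u (0, 0, 0, 0) = 1" using nonzero by (simp add: weight_def)
  let ?r = "\<lambda>j. (- 1 / s) ^ wsum (code \<omega> j) / (- 1 / s) ^ wsum (code \<omega> (j - 1)) * (1 / (- s\<^sup>2)) * T True (code \<omega> (j - 1)) (code \<omega> j)"
  have row: "(\<Prod>x<k. weight s u (vertex_type \<omega> (int x) (int j))) = ?r j" if j: "1 \<le> j" "j \<le> N" for j
  proof -
    have "(\<Prod>x<k. weight s u (vertex_type \<omega> (int x) (int j))) =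
      (\<Prod>x<k. weight s u (of_bool (x \<in> set_decode (code \<omega> (j - 1))), of_bool (hor \<omega> j x = 1),
        of_bool (x \<in> set_decode (code \<omega> j)), of_bool (hor \<omega> j (Suc x) = 1)))"
      unfolding vertex_type_binflow[OF bf j] set_decode_code[OF fl] ..
    also have "\<dots> = (- 1 / s) ^ wsum (code \<omega> j) / (- 1 / s) ^ wsum (code \<omega> (j - 1)) / (if hor \<omega> j 0 = 1 then - s\<^sup>2 else 1) *
       (\<Prod>x<k. wT q \<beta> (x \<in> set_decode (code \<omega> (j - 1))) (hor \<omega> j x = 1) (x \<in> set_decode (code \<omega> j)) (hor \<omega> j (Suc x) = 1))"
      by (rule gauge_row[where w' = "wT q \<beta>" and h = "\<lambda>x. hor \<omega> j x = 1",
          OF sub sub _ binflow_row(1)[OF bf j] _ _ weight_gauge])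
        (use k[of k j] s in auto)
    also have "hor \<omega> j 0 = 1" using binflow_rec(2)[OF bf j] .
    also note T_row_binflow(1)[OF bf j k]
    finally show ?thesis by simp
  qed
  have "(\<Prod>i. \<Prod>j=1..N. weight s u (vertex_type \<omega> (int i) (int j))) = (\<Prod>j=1..N. \<Prod>x<k. weight s u (vertex_type \<omega> (int x) (int j)))"
    by (rule prodinf_rows[where W = "\<lambda>_. weight s u", OF fl w0 k])
  also have "\<dots> = (\<Prod>j=1..N. ?r j)" by (rule prod.cong) (use row in auto)
  also have "\<dots> = (- 1 / s) ^ wsum (code \<omega> N) / (- 1 / s) ^ wsum (code \<omega> 0) * (1 / (- s\<^sup>2)) ^ N *
      (\<Prod>j=1..N. T True (code \<omega> (j - 1)) (code \<omega> j))"
    unfolding prod.distrib using s by (subst prod_telescope_atLeastAtMost) simp_all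
  also have "(\<Prod>j=1..N. T True (code \<omega> (j - 1)) (code \<omega> j)) = chain (T True) (code \<omega> 0) (codes N \<omega>)"
    unfolding codes_def by (rule chain_upt[symmetric])
  finally show ?thesis by (simp add: c0)
qed

definition Dsum :: "nat \<Rightarrow> nat \<Rightarrow> nat \<Rightarrow> real" where
  "Dsum M L B = (\<Sum>xs\<in>{xs. length xs = M \<and> last xs = B \<and> chain (D True) L xs \<noteq> 0}. chain (D True) L xs)"

text \<open>Skew collections may share vertical edges, but by \<open>weight_c_zero\<close> those
  that do have weight 0, as the entries from below are distinct. The others match chains of D-rows
  up to the telescoped gauge factor.\<close>

lemma Gc_eq:
  assumes M: "1 \<le> M" and N: "card (set_decode L) = N" "card (set_decode B) = N"
  shows "Gc s N M (\<lambda>_. v) (lst (set_decode L)) (lst (set_decode B)) =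
    (- s) ^ wsum L / (- s) ^ wsum B * Dsum M L B"
proof -
  let ?sk = "skew_collections N M (lst (set_decode L)) (lst (set_decode B))"
  let ?S = "{\<omega> \<in> ?sk. \<forall>e. \<omega> e \<le> 1}"
  let ?P = "\<lambda>\<omega>. \<Prod>i. \<Prod>j=1..M. weight_c s v (vertex_type \<omega> (int i) (int j))"
  have nu: "0 \<le> part (lst (set_decode B)) m" if "m \<in> {1..N}" for m
    using part_lst[of "set_decode B" m] N that by simp
  have zero: "?P \<omega> = 0" if w: "\<omega> \<in> ?sk - ?S" for \<omega>
  proof -
    have sk: "\<omega> \<in> ?sk" and big: "\<not> (\<forall>e. \<omega> e \<le> 1)" using w by auto
    note props = skew_collections_props[OF sk nu]
    have l0: "\<omega> ((x, 0), (x, 1)) \<le> 1" for x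
    proof -
      have eq: "{m \<in> {1..N}. part (lst (set_decode B)) m = x} = {m \<in> {1..card (set_decode B)}. int (en (set_decode B) m) = x}"
        using part_lst[of "set_decode B"] N by auto
      have "\<omega> ((x, 0), (x, 1)) = of_bool (0 \<le> x \<and> nat x \<in> set_decode B)"
        using props(4)[of x] card_en_eq[OF finite_set_decode, of B x] unfolding eq by (simp only:)
      then show ?thesis by simp
    qed
    obtain x j where xj: "1 \<le> j" "j \<le> M" "weight_c s v (vertex_type \<omega> (int x) (int j)) = 0"
      using weight_c_zero[OF _ props(1,2) l0 big, of s v] s by auto
    obtain k where k: "\<And>n y. k \<le> y \<Longrightarrow> y \<notin> lev \<omega> n \<and> hor \<omega> n y = 0"
      using flow_bounded[OF props(1)] by blast
    \<comment> \<open>The range is extended to contain the column x of the vanishing vertex.\<close>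
    have "?P \<omega> = (\<Prod>j=1..M. \<Prod>x<max k (Suc x). weight_c s v (vertex_type \<omega> (int x) (int j)))"
      by (rule prodinf_rows[OF props(1)]) (use k nonzero in \<open>auto simp: weight_c_def\<close>)
    moreover have "(\<Prod>y<max k (Suc x). weight_c s v (vertex_type \<omega> (int y) (int j))) = 0"
      by (rule prod_zero) (use xj in \<open>auto intro!: bexI[of _ x]\<close>)
    then have "\<exists>j\<in>{1..M}. (\<Prod>y<max k (Suc x). weight_c s v (vertex_type \<omega> (int y) (int j))) = 0"
      using xj by (intro bexI[of _ j]) auto
    note prod_zero[OF finite_atLeastAtMost this]
    ultimately show ?thesis by (simp only:)
  qed
  note bij = codes_down_bij[OF M N, of "D True"]
  have K: "\<exists>h n. h 0 \<and> (\<forall>x\<ge>n. h x) \<and>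
      (\<forall>x. of_bool (x \<in> set_decode A) + of_bool (h x) = (of_bool (x \<in> set_decode C) + of_bool (h (Suc x)) :: nat))"
    if "D True A C \<noteq> 0" for A C
    using D.row_exists[OF that] by simp
  have K': "D True (code \<omega> j) (code \<omega> (j - 1)) \<noteq> 0" if "binflow M 0 \<omega>" "1 \<le> j" "j \<le> M" for \<omega> j
  proof -
    have "flow M \<omega>" using that by (simp add: binflow_def)
    then obtain k where "\<And>n x. k \<le> x \<Longrightarrow> x \<notin> lev \<omega> n \<and> hor \<omega> n x = 0" using flow_bounded by blast
    from D_row_binflow(2)[OF that this] show ?thesis .
  qed
  have "Gc s N M (\<lambda>_. v) (lst (set_decode L)) (lst (set_decode B)) = (\<Sum>\<omega>\<in>?sk. ?P \<omega>)"
    by (simp add: Gc_def)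
  also have "\<dots> = (\<Sum>\<omega>\<in>?S. ?P \<omega>)"
    by (rule sum.mono_neutral_right[OF finite_skew_collections[OF nu]]) (use zero in auto)
  also have "\<dots> = (\<Sum>\<omega>\<in>?S. (- s) ^ wsum L / (- s) ^ wsum B * chain (D True) L (codes_down M \<omega>))"
  proof (rule sum.cong[OF refl])
    fix \<omega> assume "\<omega> \<in> ?S"
    then have "binflow M 0 \<omega>" "code \<omega> 0 = B" "code \<omega> M = L" using bij(2)[OF K K'] by auto
    then show "?P \<omega> = (- s) ^ wsum L / (- s) ^ wsum B * chain (D True) L (codes_down M \<omega>)"
      using rows_c[of M \<omega>] by simp
  qed
  also have "\<dots> = (- s) ^ wsum L / (- s) ^ wsum B * Dsum M L B"
    unfolding sum_distrib_left[symmetric] Dsum_def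
    by (subst sum.reindex_bij_betw[OF bij(1)[OF K K'], symmetric]) simp_all
  finally show ?thesis .
qed

end

text \<open>Strictly decreasing sequences are sets, and all parts being at least 1 means that column
  0 is empty, that is, that the code is even.\<close>

lemma lst_bij:
  "bij_betw (\<lambda>C. lst (set_decode C)) {C. even C \<and> card (set_decode C) = N}
     {nu \<in> Sign N. sorted_wrt (>) nu \<and> (\<forall>x\<in>set nu. 1 \<le> x)}"
proof (rule bij_betwI')
  fix C B :: nat
  show "lst (set_decode C) = lst (set_decode B) \<longleftrightarrow> C = B"
    using lst_inj[of "set_decode C" "set_decode B"] by (metis finite_set_decode set_decode_inverse)
next
  fix C assume C: "C \<in> {C. even C \<and> card (set_decode C) = N}"
  let ?nu = "lst (set_decode C)"
  have s: "sorted_wrt (>) ?nu"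
    using strict_sorted_list_of_set[of "set_decode C"] by (simp add: lst_def sorted_wrt_map sorted_wrt_rev)
  have ge: "1 \<le> x" if "x \<in> set ?nu" for x
  proof -
    obtain y where y: "x = int y" "y \<in> set_decode C" using \<open>x \<in> set ?nu\<close> by (auto simp: set_lst)
    then have "y \<noteq> 0" using C by (auto simp: set_decode_0 intro: ccontr)
    then show ?thesis using y by simp
  qed
  moreover have "sorted_wrt (\<ge>) ?nu"
    by (rule sorted_wrt_mono_rel[OF _ s]) simp
  moreover have "length ?nu = N" using C by (simp add: lst_def)
  ultimately show "?nu \<in> {nu \<in> Sign N. sorted_wrt (>) nu \<and> (\<forall>x\<in>set nu. 1 \<le> x)}"
    using s by (force simp: Sign_def)
next
  fix nu assume "nu \<in> {nu \<in> Sign N. sorted_wrt (>) nu \<and> (\<forall>x\<in>set nu. 1 \<le> x)}"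
  then have nu: "length nu = N" "sorted_wrt (>) nu" "\<And>x. x \<in> set nu \<Longrightarrow> 1 \<le> x" by (auto simp: Sign_def)
  define l where "l = rev (map nat nu)"
  have id: "map int (map nat nu) = nu" using nu(3) by (induction nu) (auto, force)
  have sl: "sorted_wrt (<) l"
    unfolding l_def sorted_wrt_rev sorted_wrt_map
    by (rule sorted_wrt_mono_rel[OF _ nu(2)]) (use nu(3) in force)
  have un: "sorted_list_of_set (set l) = l" by (rule sorted_list_of_set_unique'[OF _ sl]) simp_all
  define C where "C = set_encode (set l)"
  have dC: "set_decode C = set l" by (simp add: C_def set_encode_inverse)
  have "lst (set_decode C) = nu" unfolding dC lst_def un by (simp add: l_def id[unfolded map_map])
  moreover have "card (set l) = N"
    using distinct_card[of l] sl nu(1) by (simp add: strict_sorted_iff l_def)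
  moreover have "0 \<notin> set l" using nu(3) by (force simp: l_def)
  then have "even C" using dC set_decode_0[of C] by simp
  ultimately show "\<exists>C\<in>{C. even C \<and> card (set_decode C) = N}. nu = lst (set_decode C)"
    using dC by (intro bexI[of _ C]) auto
qed

lemma infsum_nn_integral:
  fixes f :: "'a \<Rightarrow> real"
  assumes "\<And>x. 0 \<le> f x" "(\<integral>\<^sup>+x. ennreal (f x) \<partial>count_space A) = ennreal c" "0 \<le> c"
  shows "infsum f A = c"
proof -
  have int: "integrable (count_space A) f"
    by (rule integrableI_nn_integral_finite[OF _ _ assms(2)]) (use assms(1) in auto)
  then have "Infinite_Set_Sum.abs_summable_on f A"
    by (simp add: Infinite_Set_Sum.abs_summable_on_def)
  then have "infsum f A = infsetsum f A" by (rule infsetsum_infsum[symmetric])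
  also have "\<dots> = enn2real (\<integral>\<^sup>+x. ennreal (f x) \<partial>count_space A)"
    unfolding infsetsum_def by (rule integral_eq_nn_integral) (use assms(1) in auto)
  finally show ?thesis using assms by simp
qed

lemma (in commuting_rows) full_bits:
  "full k C \<Longrightarrow> x < k \<Longrightarrow> x \<in> set_decode C"
proof (induction x arbitrary: C k)
  case 0
  then obtain k' where k: "k = Suc k'" by (cases k) auto
  have "C mod 2 ^ k mod 2 = C mod 2" unfolding k by (simp add: mod_mod_cancel)
  moreover have "odd (2 ^ k - 1 :: nat)" unfolding k by (rule ones)
  then have "odd (C mod 2 ^ k)" unfolding 0(1)[unfolded full_def] .
  ultimately have "odd C" by (metis odd_iff_mod_2_eq_one)
  then show ?case by (simp add: set_decode_0)
next
  case (Suc x)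
  then obtain k' where k: "k = Suc k'" by (cases k) auto
  have "(C mod 2 ^ k) div 2 = (C div 2) mod 2 ^ k'"
    unfolding k by (simp add: mod_mult2_eq)
  then have "full k' (C div 2)" using Suc.prems(1) ones(1)[of k'] unfolding full_def k by simp
  then show ?case using Suc.IH[of k' "C div 2"] Suc.prems(2) k by (simp add: set_decode_Suc)
qed

section \<open>The boundary weight as a power of \<open>DD\<close>\<close>

context six_vertex_measure begin

text \<open>The boundary weight without its signs and powers of s. The indicator applied first
  encodes the condition that nu avoids column 0.\<close>

definition Gf :: "nat \<Rightarrow> nat \<Rightarrow> real" where
  "Gf M L = enn2real ((DD ^^ M) (ev (\<lambda>_. 1)) L)"

lemma chain_D_bounded: "chain (D True) A xs \<noteq> 0 \<Longrightarrow> set xs \<subseteq> {..A}"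
proof (induction xs arbitrary: A)
  case (Cons C xs)
  then have "D True A C \<noteq> 0" "chain (D True) C xs \<noteq> 0" by auto
  moreover from this(1) have "C + of_bool (\<not> True) \<le> A"
    by (intro row_triangular[OF D.conserve]) auto
  ultimately show ?case using Cons.IH[of C] by auto
qed simp

lemma chain_D_card: "chain (D True) A xs \<noteq> 0 \<Longrightarrow> card (set_decode (last (A # xs))) = card (set_decode A)"
proof (induction xs arbitrary: A)
  case (Cons C xs)
  then have "D True A C \<noteq> 0" "chain (D True) C xs \<noteq> 0" by auto
  then show ?case using D.row_card[of True A C] Cons.IH[of C] by simp
qed simp

text \<open>Triangularity leaves finitely many chains from L, so the infinite sum is finite and
  \<open>enn2real\<close> loses nothing. Chains preserve the number of arrows, hence summing over
  all even codes adds nothing to those with N arrows.\<close>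

lemma Gf:
  assumes M: "1 \<le> M" and N: "card (set_decode L) = N"
  shows "infsum (Dsum M L) {C. even C \<and> card (set_decode C) = N} = Gf M L"
    and "ennreal (Gf M L) = (DD ^^ M) (ev (\<lambda>_. 1)) L"
proof -
  let ?X = "{xs. length xs = M \<and> chain (D True) L xs \<noteq> 0 \<and> even (last xs)}"
  let ?K = "{C. even C \<and> card (set_decode C) = N}"
  have fin: "finite ?X"
    by (rule finite_subset[OF _ finite_lists_length_eq[of "{..L}" M]]) (use chain_D_bounded in auto)
  have ls: "last (L # xs) = last xs" if "length xs = M" for xs :: "nat list"
    using that M by (cases xs) auto
  have sub: "last ` ?X \<subseteq> ?K"
  proof
    fix C assume "C \<in> last ` ?X"
    then obtain xs where xs: "length xs = M" "chain (D True) L xs \<noteq> 0" "even (last xs)" "C = last xs" by auto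
    show "C \<in> ?K" using chain_D_card[OF xs(2)] N xs(3,4) unfolding ls[OF xs(1)] by simp
  qed
  have D: "Dsum M L C = (\<Sum>xs\<in>{xs \<in> ?X. last xs = C}. chain (D True) L xs)" if "C \<in> ?K" for C
    unfolding Dsum_def by (rule sum.cong) (use that in auto)
  have "infsum (Dsum M L) ?K = infsum (Dsum M L) (last ` ?X)"
  proof (rule infsum_cong_neutral)
    fix C assume C: "C \<in> ?K - last ` ?X"
    then have "{xs \<in> ?X. last xs = C} = {}" by auto
    then show "Dsum M L C = 0" using D[of C] C by (simp only: sum.empty Diff_iff)
  qed (use sub in auto)
  also have "\<dots> = (\<Sum>C\<in>last ` ?X. Dsum M L C)" using fin by simp
  also have "\<dots> = (\<Sum>C\<in>last ` ?X. \<Sum>xs\<in>{xs \<in> ?X. last xs = C}. chain (D True) L xs)"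
    by (rule sum.cong[OF refl D]) (use sub in blast)
  also have "\<dots> = (\<Sum>xs\<in>?X. chain (D True) L xs)"
    by (rule sum.image_gen[OF fin, symmetric])
  finally have 1: "infsum (Dsum M L) ?K = (\<Sum>xs\<in>?X. chain (D True) L xs)" .
  let ?f = "\<lambda>xs. ennreal (chain (D True) L xs) * ev (\<lambda>_. 1) (last (L # xs)) * indicator {xs. length xs = M} xs"
  have "(DD ^^ M) (ev (\<lambda>_. 1)) L = (\<integral>\<^sup>+xs. ?f xs \<partial>count_space UNIV)"
    by (rule nn_integral_chain[OF D.row_nonneg, symmetric])
  also have "\<dots> = (\<integral>\<^sup>+xs. ?f xs \<partial>count_space ?X)"
    by (rule nn_integral_count_space_eq) (use ls in \<open>auto simp: ev_def indicator_def simp del: last.simps\<close>)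
  also have "\<dots> = (\<integral>\<^sup>+xs. ennreal (chain (D True) L xs) \<partial>count_space ?X)"
    by (rule nn_integral_cong) (use ls in \<open>auto simp: ev_def simp del: last.simps\<close>)
  also have "\<dots> = (\<Sum>xs\<in>?X. ennreal (chain (D True) L xs))"
    by (rule nn_integral_count_space_finite[OF fin])
  also have "\<dots> = ennreal (\<Sum>xs\<in>?X. chain (D True) L xs)"
    by (rule sum_ennreal) (rule chain_nonneg[OF D.row_nonneg])
  finally have 2: "(DD ^^ M) (ev (\<lambda>_. 1)) L = ennreal (\<Sum>xs\<in>?X. chain (D True) L xs)" .
  have nn: "0 \<le> (\<Sum>xs\<in>?X. chain (D True) L xs)"
    by (rule sum_nonneg) (rule chain_nonneg[OF D.row_nonneg])
  show "infsum (Dsum M L) ?K = Gf M L" using 1 2 nn by (simp add: Gf_def)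
  show "ennreal (Gf M L) = (DD ^^ M) (ev (\<lambda>_. 1)) L" unfolding Gf_def 2 using nn by simp
qed

lemma prod_powi_part:
  assumes "card (set_decode C) = N"
  shows "(\<Prod>j=1..N. (- s) powi part (lst (set_decode C)) j) = (- s) ^ wsum C"
proof -
  have "(\<Prod>j=1..N. (- s) powi part (lst (set_decode C)) j) = (\<Prod>j\<in>{1..card (set_decode C)}. (- s) ^ en (set_decode C) j)"
    using part_lst[of "set_decode C"] assms by (intro prod.cong) auto
  also have "\<dots> = (\<Prod>x\<in>set_decode C. (- s) ^ x)"
    by (rule prod.reindex_bij_betw[OF en_bij]) simp
  also have "\<dots> = (- s) ^ wsum C" by (simp add: power_sum)
  finally show ?thesis .
qed

lemma boundary_weight_eq:
  assumes M: "1 \<le> M" and N: "card (set_decode L) = N"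
  shows "boundary_weight s N M (\<lambda>_. v) (lst (set_decode L)) = (- 1) ^ N * ((- s) ^ wsum L * Gf M L)"
proof -
  let ?K = "{C. even C \<and> card (set_decode C) = N}"
  let ?F = "\<lambda>nu. (\<Prod>j=1..N. (- s) powi (part nu j)) * Gc s N M (\<lambda>_. v) (lst (set_decode L)) nu"
  have "infsum ?F {nu \<in> Sign N. sorted_wrt (>) nu \<and> (\<forall>x\<in>set nu. 1 \<le> x)} = infsum (\<lambda>C. ?F (lst (set_decode C))) ?K"
    by (rule infsum_reindex_bij_betw[OF lst_bij, symmetric])
  also have "\<dots> = infsum (\<lambda>C. (- s) ^ wsum L * Dsum M L C) ?K"
  proof (rule infsum_cong)
    fix C assume "C \<in> ?K"
    then have C: "card (set_decode C) = N" by simp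
    \<comment> \<open>The factor \<open>(- s) ^ wsum C\<close> from the parts of nu cancels the
      denominator in \<open>Gc_eq\<close>.\<close>
    show "?F (lst (set_decode C)) = (- s) ^ wsum L * Dsum M L C"
      unfolding prod_powi_part[OF C] Gc_eq[OF M N C] using s by simp
  qed
  also have "\<dots> = (- s) ^ wsum L * Gf M L"
    unfolding infsum_cmult_right' Gf(1)[OF M N] ..
  finally show ?thesis unfolding boundary_weight_def by (simp only:)
qed

definition wt :: "nat \<Rightarrow> nat \<Rightarrow> config \<Rightarrow> real" where
  "wt N M \<omega> = chain (T True) 0 (codes N \<omega>) * Gf M (code \<omega> N)"

lemma card_code:
  assumes "\<omega> \<in> path_collections N" shows "card (set_decode (code \<omega> N)) = N"
proof -
  note bf = path_collections_binflow[OF assms]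
  have fl: "flow N \<omega>" using bf by (simp add: binflow_def)
  have "card (lev \<omega> n) = n" if "n \<le> N" for n
    using that
  proof (induction n)
    case (Suc n)
    then show ?case using binflow_card(2)[OF bf(1), of "Suc n"] by simp
  qed (simp add: bf(2))
  then show ?thesis by (simp add: set_decode_code[OF fl])
qed

text \<open>The powers of \<open>- 1 / s\<close> and \<open>- s\<close> cancel at level N, and the
  sign of \<open>- 1 / s\<^sup>2\<close>, one factor for each entering arrow, is compensated by
  \<open>(- 1) ^ N\<close>. What remains of the gauge is a constant, which the normalisation
  removes.\<close>

lemma config_weight_eq:
  assumes w: "\<omega> \<in> path_collections N" and M: "1 \<le> M"
  shows "config_weight s N M (\<lambda>_. u) (\<lambda>_. v) \<omega> = (1 / s\<^sup>2) ^ N * wt N M \<omega>"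
proof -
  have fl: "flow N \<omega>" using path_collections_binflow(1)[OF w] by (simp add: binflow_def)
  let ?S = "wsum (code \<omega> N)"
  have b: "boundary_weight s N M (\<lambda>_. v) (level N \<omega>) = (- 1) ^ N * ((- s) ^ ?S * Gf M (code \<omega> N))"
    using boundary_weight_eq[OF M card_code[OF w]] by (simp only: level_lst[OF fl] set_decode_code[OF fl])
  have "(- 1 / s) * (- s) = 1" using s by simp
  then have 1: "(- 1 / s) ^ ?S * (- s) ^ ?S = 1" by (simp only: power_mult_distrib[symmetric] power_one)
  have 2: "(1 / (- s\<^sup>2)) ^ N * (- 1) ^ N = (1 / s\<^sup>2) ^ N" by (simp add: power_mult_distrib[symmetric])
  have "config_weight s N M (\<lambda>_. u) (\<lambda>_. v) \<omega> =
      ((- 1 / s) ^ ?S * (- s) ^ ?S) * ((1 / (- s\<^sup>2)) ^ N * (- 1) ^ N) * wt N M \<omega>"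
    unfolding config_weight_def rows_u[OF w] b wt_def by (simp only: mult_ac)
  then show ?thesis unfolding 1 2 by simp
qed

lemma wt_nonneg: "0 \<le> wt N M \<omega>"
  unfolding wt_def Gf_def by (intro mult_nonneg_nonneg chain_nonneg[OF T.row_nonneg]) simp

text \<open>No path can end in column 0, since \<open>\<nu>\<^sub>N \<ge> 1\<close>: that column contributes a power of \<open>\<beta>\<close> and splits
  off, so that the first column above corresponds to the abscissa 1.\<close>

definition double :: "(nat \<Rightarrow> ennreal) \<Rightarrow> nat \<Rightarrow> ennreal" where
  "double g A = (if even A then g (A div 2) else 0)"

lemma double_parts: "even_part (double g) = g" "odd_part (double g) = (\<lambda>_. 0)"
  by (simp_all add: even_part_def odd_part_def double_def fun_eq_iff)

lemma DD_double: "DD (double g) = double (DD g)"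
proof
  fix A
  show "DD (double g) A = double (DD g) A"
  proof (cases "even A")
    case True
    then obtain B where "A = 2 * B" by (elim evenE)
    then show ?thesis using d_even[of "double g" B] by (simp add: double_parts transfer_zero double_def[of "transfer _ _"])
  next
    case False
    then obtain B where "A = 2 * B + 1" by (elim oddE)
    then show ?thesis using d_odd[of "double g" B] by (simp add: double_parts transfer_zero double_def[of "transfer _ _"])
  qed
qed

lemma TT_double: "TT (double g) = double (\<lambda>A. ennreal \<beta> * TT g A)"
proof
  fix A
  show "TT (double g) A = double (\<lambda>A. ennreal \<beta> * TT g A) A"
  proof (cases "even A")
    case True
    then obtain B where "A = 2 * B" by (elim evenE)
    then show ?thesis using t_even[of "double g" B] by (simp add: double_parts transfer_zero double_def[of "\<lambda>A. _ * _ A"])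
  next
    case False
    then obtain B where "A = 2 * B + 1" by (elim oddE)
    then show ?thesis using t_odd[of "double g" B] by (simp add: double_parts transfer_zero double_def[of "\<lambda>A. _ * _ A"])
  qed
qed

lemma DD_pow_ev: "(DD ^^ M) (ev (\<lambda>_. 1)) = double (F M)"
proof (induction M)
  case 0
  then show ?case by (simp add: ev_def double_def F_def fun_eq_iff)
next
  case (Suc M)
  then show ?case by (simp add: DD_double F_def)
qed

lemma TT_pow_double: "(TT ^^ N) (double g) = double (\<lambda>A. ennreal (\<beta> ^ N) * (TT ^^ N) g A)"
proof (induction N)
  case (Suc N)
  have "(TT ^^ Suc N) (double g) = double (\<lambda>A. ennreal \<beta> * TT (\<lambda>A. ennreal (\<beta> ^ N) * (TT ^^ N) g A) A)"
    by (simp add: Suc TT_double)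
  also have "\<dots> = double (\<lambda>A. ennreal (\<beta> ^ Suc N) * (TT ^^ Suc N) g A)"
    using b by (simp add: transfer_cmult_fun ennreal_mult mult.assoc)
  finally show ?case .
qed simp

text \<open>An even code is \<open>2 * A\<close>, where A is the set shifted by one column; P
  therefore is evaluated at \<open>2 * A\<close>, and \<open>\<beta> ^ N\<close> is the share of
  column 0.\<close>

lemma nn_integral_wt:
  assumes M: "1 \<le> M"
  shows "(\<integral>\<^sup>+\<omega>. ennreal (wt N M \<omega>) * (if P (code \<omega> N) then 1 else 0) \<partial>count_space (path_collections N)) =
    ennreal (\<beta> ^ N) * (TT ^^ N) (\<lambda>A. if P (2 * A) then F M A else 0) 0"
proof -
  let ?g = "\<lambda>C. double (F M) C * (if P C then 1 else 0)"
  have "(\<integral>\<^sup>+\<omega>. ennreal (wt N M \<omega>) * (if P (code \<omega> N) then 1 else 0) \<partial>count_space (path_collections N)) =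
      (\<integral>\<^sup>+\<omega>. ennreal (chain (T True) 0 (codes N \<omega>)) * ?g (code \<omega> N) \<partial>count_space (path_collections N))"
  proof (rule nn_integral_cong)
    fix \<omega> assume "\<omega> \<in> space (count_space (path_collections N))"
    then have "ennreal (Gf M (code \<omega> N)) = double (F M) (code \<omega> N)"
      using Gf(2)[OF M card_code] by (simp add: DD_pow_ev)
    moreover have "ennreal (wt N M \<omega>) = ennreal (chain (T True) 0 (codes N \<omega>)) * ennreal (Gf M (code \<omega> N))"
      unfolding wt_def by (rule ennreal_mult) (simp_all add: chain_nonneg[OF T.row_nonneg] Gf_def)
    ultimately show "ennreal (wt N M \<omega>) * (if P (code \<omega> N) then 1 else 0) =
        ennreal (chain (T True) 0 (codes N \<omega>)) * ?g (code \<omega> N)" by (simp add: mult.assoc)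
  qed
  also have "\<dots> = (TT ^^ N) ?g 0" by (rule nn_integral_path_collections)
  also have "?g = double (\<lambda>A. if P (2 * A) then F M A else 0)"
    by (auto simp: double_def fun_eq_iff elim!: evenE)
  also have "(TT ^^ N) (double (\<lambda>A. if P (2 * A) then F M A else 0)) 0 =
      ennreal (\<beta> ^ N) * (TT ^^ N) (\<lambda>A. if P (2 * A) then F M A else 0) 0"
    unfolding TT_pow_double by (simp add: double_def)
  finally show ?thesis .
qed

text \<open>If 0 is missing and 1, ..., k are present, then exactly i - 1 elements lie below i, so i
  has rank N - i + 1 from the top.\<close>

lemma packed_if_full:
  assumes w: "\<omega> \<in> path_collections N" and k: "k \<le> N"
    and ev: "even (code \<omega> N)" and fu: "full k (code \<omega> N div 2)" and i: "i \<in> {1..k}"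
  shows "part (level N \<omega>) (N - i + 1) = int i"
proof -
  have fl: "flow N \<omega>" using path_collections_binflow(1)[OF w] by (simp add: binflow_def)
  define S where "S = set_decode (code \<omega> N)"
  have S: "finite S" "card S = N" "lev \<omega> N = S"
    using card_code[OF w] set_decode_code[OF fl, of N] finite_set_decode[of "code \<omega> N"] by (simp_all only: S_def)
  have "0 \<notin> S" using ev by (simp add: S_def set_decode_0)
  moreover have in_S: "j \<in> S" if j: "j \<in> {1..k}" for j
  proof -
    obtain j' where "j = Suc j'" "j' < k" using j by (cases j) auto
    then show ?thesis using full_bits[OF fu, of j'] by (simp add: S_def set_decode_Suc)
  qed
  ultimately have "{y \<in> S. \<not> i \<le> y} = {1..<i}" using i by (auto simp: not_le Suc_le_eq intro: gr0I)
  then have "card {y \<in> S. \<not> i \<le> y} = i - 1" by (simp only: card_atLeastLessThan)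
  moreover have "card {y \<in> S. i \<le> y} + card {y \<in> S. \<not> i \<le> y} = card S"
    using S(1) by (subst card_Un_disjoint[symmetric]) (auto intro!: arg_cong[where f = card])
  ultimately have c: "card {y \<in> S. i \<le> y} = N - i + 1"
    using S(2) i k unfolding atLeastAtMost_iff by linarith
  obtain m where m: "m \<in> {1..card S}" "en S m = i"
    using en_bij[OF S(1)] in_S[OF i] by (metis bij_betw_imp_surj_on imageE)
  have "m = N - i + 1" using card_above_en[OF S(1) m(1)] c m(2) by simp
  then show ?thesis
    unfolding level_lst[OF fl] S(3) using part_lst[OF S(1) m(1)] m(2) by simp
qed

text \<open>Up to a constant the density is \<open>wt\<close>, whose total mass is known exactly.
  Outside E either the weight vanishes or the shifted block is not full, so the complement is
  controlled by the hypothesis and by \<open>Q\<close>.\<close>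

lemma measure_bound:
  assumes M: "1 \<le> M" and k: "k \<le> N"
    and c: "(TT ^^ N) (\<lambda>C. if full k C then 0 else F M C) 0 \<le> ennreal c * e N M" "0 \<le> c"
  defines "\<mu> \<equiv> path_measure s N M (\<lambda>_. u) (\<lambda>_. v)"
    and "E \<equiv> {\<omega> \<in> path_collections N. \<forall>i\<in>{1..k}. part (level N \<omega>) (N - i + 1) = int i}"
  shows "1 - c * Q N M \<le> measure \<mu> E" and "measure \<mu> E \<le> 1"
proof -
  let ?PC = "path_collections N"
  \<comment> \<open>\<open>\<beta> ^ N\<close> comes from column 0, the power of \<open>Pf\<close>
    from \<open>total\<close>.\<close>
  define Z where "Z = \<beta> ^ N * Pf ^ (N * M)"
  have Z: "0 < Z" using b Pf_pos by (simp add: Z_def)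
  have tot: "(\<integral>\<^sup>+\<omega>. ennreal (wt N M \<omega>) \<partial>count_space ?PC) = ennreal Z"
    using nn_integral_wt[OF M, of N "\<lambda>_. True"] b Pf_pos by (simp add: total Z_def ennreal_mult)
  have "infsum (wt N M) ?PC = Z" by (rule infsum_nn_integral[OF wt_nonneg tot]) (use Z in simp)
  moreover have "partition_function s N M (\<lambda>_. u) (\<lambda>_. v) = infsum (\<lambda>\<omega>. (1 / s\<^sup>2) ^ N * wt N M \<omega>) ?PC"
    unfolding partition_function_def by (rule infsum_cong) (rule config_weight_eq[OF _ M])
  ultimately have PF: "partition_function s N M (\<lambda>_. u) (\<lambda>_. v) = (1 / s\<^sup>2) ^ N * Z"
    by (simp only: infsum_cmult_right')
  have s0: "(1 / s\<^sup>2) ^ N \<noteq> 0" using s by simp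
  have dens: "ennreal (config_weight s N M (\<lambda>_. u) (\<lambda>_. v) \<omega> / partition_function s N M (\<lambda>_. u) (\<lambda>_. v)) =
      ennreal (1 / Z) * ennreal (wt N M \<omega>)" if "\<omega> \<in> ?PC" for \<omega>
    unfolding config_weight_eq[OF that M] PF mult_divide_mult_cancel_left[OF s0]
    using Z wt_nonneg[of N M \<omega>] by (simp add: ennreal_mult[symmetric])
  have em: "emeasure \<mu> X = ennreal (1 / Z) * (\<integral>\<^sup>+\<omega>. ennreal (wt N M \<omega>) * indicator X \<omega> \<partial>count_space ?PC)"
    if "X \<subseteq> ?PC" for X
  proof -
    have "emeasure \<mu> X = (\<integral>\<^sup>+\<omega>. ennreal (config_weight s N M (\<lambda>_. u) (\<lambda>_. v) \<omega> /
        partition_function s N M (\<lambda>_. u) (\<lambda>_. v)) * indicator X \<omega> \<partial>count_space ?PC)"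
      unfolding \<mu>_def path_measure_def point_measure_def by (rule emeasure_density) (use that in auto)
    also have "\<dots> = (\<integral>\<^sup>+\<omega>. ennreal (1 / Z) * (ennreal (wt N M \<omega>) * indicator X \<omega>) \<partial>count_space ?PC)"
      by (rule nn_integral_cong) (simp only: space_count_space dens mult.assoc)
    finally show ?thesis by (simp add: nn_integral_cmult)
  qed
  have sp: "space \<mu> = ?PC" "sets \<mu> = Pow ?PC"
    by (simp_all add: \<mu>_def path_measure_def space_point_measure sets_point_measure)
  have "(\<integral>\<^sup>+\<omega>. ennreal (wt N M \<omega>) * indicator ?PC \<omega> \<partial>count_space ?PC) = ennreal Z"
    unfolding tot[symmetric] by (rule nn_integral_cong) simp
  then have one: "emeasure \<mu> (space \<mu>) = 1"
    unfolding sp using em[OF subset_refl] Z by (simp add: ennreal_mult[symmetric])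
  interpret finite_measure \<mu> by (rule finite_measureI) (simp add: one)
  have "E \<subseteq> ?PC" by (auto simp: E_def)
  then have E: "E \<in> sets \<mu>" by (simp add: sp)
  have m1: "measure \<mu> (space \<mu>) = 1" by (simp add: measure_def one)
  show "measure \<mu> E \<le> 1" using bounded_measure[of E] m1 by simp
  have full_if: "(if \<not> full k (2 * A div 2) then F M A else 0) = (if full k A then 0 else F M A)" for A
    by simp
  have "emeasure \<mu> (space \<mu> - E) \<le> ennreal (1 / Z) *
      (\<integral>\<^sup>+\<omega>. ennreal (wt N M \<omega>) * (if \<not> full k (code \<omega> N div 2) then 1 else 0) \<partial>count_space ?PC)"
    unfolding sp em[OF Diff_subset]
  proof (rule mult_left_mono, rule nn_integral_mono)
    fix \<omega> assume "\<omega> \<in> space (count_space ?PC)"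
    then have w: "\<omega> \<in> ?PC" by simp
    \<comment> \<open>An occupied column 0 at the top level has weight 0, so on the support of the
      measure only fullness of the block can fail.\<close>
    have "Gf M (code \<omega> N) = 0" if "odd (code \<omega> N)"
      using that by (simp add: Gf_def DD_pow_ev double_def)
    then have odd: "wt N M \<omega> = 0" if "odd (code \<omega> N)"
      using that by (simp add: wt_def)
    have "wt N M \<omega> = 0 \<or> \<not> full k (code \<omega> N div 2)" if "\<omega> \<notin> E"
    proof (rule ccontr)
      assume "\<not> ?thesis"
      then have "even (code \<omega> N)" "full k (code \<omega> N div 2)" using odd by auto
      from packed_if_full[OF w k this] that w show False unfolding E_def by blast
    qed
    then show "ennreal (wt N M \<omega>) * indicator (?PC - E) \<omega> \<le>
        ennreal (wt N M \<omega>) * (if \<not> full k (code \<omega> N div 2) then 1 else 0)"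
      by (auto simp: indicator_def)
  qed simp
  also have "\<dots> = ennreal (1 / Z) * (ennreal (\<beta> ^ N) * (TT ^^ N) (\<lambda>A. if full k A then 0 else F M A) 0)"
    unfolding nn_integral_wt[OF M, of N "\<lambda>C. \<not> full k (C div 2)"] full_if ..
  also have "\<dots> \<le> ennreal (1 / Z) * (ennreal (\<beta> ^ N) * (ennreal c * e N M))"
    by (intro mult_left_mono c(1)) simp_all
  also have "\<dots> = ennreal (1 / Z * (\<beta> ^ N * (c * (Pf ^ (N * M) * Q N M))))"
    unfolding e_Q(1) using Z b Pf_pos c(2) e_Q(2)[of N M] by (simp add: ennreal_mult[symmetric])
  also have "1 / Z * (\<beta> ^ N * (c * (Pf ^ (N * M) * Q N M))) = c * Q N M"
    using b Pf_pos by (simp add: Z_def)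
  finally have "measure \<mu> (space \<mu> - E) \<le> c * Q N M"
    unfolding emeasure_eq_measure using c(2) e_Q(2)[of N M] by simp
  then show "1 - c * Q N M \<le> measure \<mu> E"
    using finite_measure_compl[OF E] m1 by simp
qed

text \<open>\<open>rate\<close> is a quotient of the values of B / ((1 - B) (1 - q B)) at
  \<open>\<beta>\<close> and \<open>\<beta>'\<close>. In terms of the spectral parameter x this
  expression is (x - s) (x - 1/s) / x up to a constant that cancels.\<close>

lemma rate_formula:
  "rate = inverse v * (u - inverse s) * (u - s) / (u * (inverse v - inverse s) * (inverse v - s))"
proof -
  define w where "w = 1 / v"
  have part: "B / ((1 - B) * (1 - q * B)) = (x - s) * (x - s * q) / (s * (1 - q)\<^sup>2 * x)"
    if "B = (x - s) / (x - s * q)" "s < x" for B x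
  proof -
    have d: "0 < x - s * q" using less_trans[OF s_inv s] that(2) unfolding q_eq(2) by linarith
    have "1 - B = s * (1 - q) / (x - s * q)" "1 - q * B = x * (1 - q) / (x - s * q)"
      unfolding that(1) using d by (simp_all add: divide_simps) (simp_all add: algebra_simps)
    moreover have "y / z / (a / z * (b / z)) = y * z / (a * b)" if "z \<noteq> 0" for y z a b :: real
      using that by simp
    ultimately show ?thesis unfolding that(1) using d by (simp add: power2_eq_square mult_ac)
  qed
  have w: "s < w" using uv u by (simp add: w_def)
  have "rate = \<beta> / ((1 - \<beta>) * (1 - q * \<beta>)) / (\<beta>' / ((1 - \<beta>') * (1 - q * \<beta>')))"
    unfolding rate_def by (simp add: mult_ac)
  also have "\<dots> = (u - s) * (u - s * q) / (s * (1 - q)\<^sup>2 * u) / ((w - s) * (w - s * q) / (s * (1 - q)\<^sup>2 * w))"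
    unfolding part[OF \<beta>_def u] part[OF \<beta>'_def[folded w_def] w] ..
  also have "\<dots> = (u - s) * (u - s * q) * w / (u * ((w - s) * (w - s * q)))"
    using s q w u by simp
  finally show ?thesis
    unfolding q_eq(2) by (simp add: w_def inverse_eq_divide mult_ac)
qed

text \<open>The strict inequality of \<open>exists_decay\<close> survives a small increase of both
  bases, which absorbs the factor \<open>(1 + \<epsilon>) ^ (n + m)\<close> of
  \<open>not_full_bound\<close>. The failure probability is then at most
  \<open>c * \<rho> ^ M\<close> for all large M.\<close>

lemma packing_limit:
  fixes N :: "nat \<Rightarrow> nat"
  assumes \<gamma>: "rate < \<gamma>" and N: "\<forall>\<^sub>F M in sequentially. \<gamma> * real M \<le> real (N M)"
  shows "(\<lambda>M. measure (path_measure s (N M) M (\<lambda>_. u) (\<lambda>_. v))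
        {\<omega> \<in> path_collections (N M). \<forall>i\<in>{1..k}. part (level (N M) \<omega>) (N M - i + 1) = int i}) \<longlonglongrightarrow> 1"
    (is "?P \<longlonglongrightarrow> 1")
proof -
  have \<gamma>0: "0 < \<gamma>" using \<gamma> rate_pos by simp
  obtain x where x: "\<beta> \<le> x" "x < 1" "x powr \<gamma> * V x < 1" by (rule exists_decay[OF \<gamma>])
  have V0: "0 < V x"
  proof -
    have "0 < Vu" using Pf_pos b by (simp add: Vu_def)
    moreover have "0 \<le> (1 - Ts) * (1 - Vu) / (x - Ts)"
      using Ts_bounds Vu_less x b by (intro divide_nonneg_nonneg mult_nonneg_nonneg) auto
    ultimately show ?thesis by (simp add: V_def)
  qed
  have x0: "0 < x" using x b by simp
  \<comment> \<open>Besides the product, \<open>(1 + \<epsilon>) * x\<close> itself must stay below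
    1: N M is only bounded from below by \<gamma> M, and the exponent is replaced by this
    bound.\<close>
  have "((\<lambda>\<epsilon>. (1 + \<epsilon>) * x) \<longlongrightarrow> (1 + 0) * x) (at_right 0)"
    by (intro tendsto_intros)
  then have "eventually (\<lambda>\<epsilon>. (1 + \<epsilon>) * x < 1) (at_right 0)" by (rule order_tendstoD(2)) (use x in simp)
  moreover have lim: "((\<lambda>\<epsilon>. ((1 + \<epsilon>) * x) powr \<gamma> * ((1 + \<epsilon>) * V x)) \<longlongrightarrow> ((1 + 0) * x) powr \<gamma> * ((1 + 0) * V x)) (at_right 0)"
    using x0 by (intro tendsto_intros) auto
  then have "eventually (\<lambda>\<epsilon>. ((1 + \<epsilon>) * x) powr \<gamma> * ((1 + \<epsilon>) * V x) < 1) (at_right 0)"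
    using x by (intro order_tendstoD(2)[OF lim]) auto
  moreover have "eventually (\<lambda>\<epsilon>. 0 < \<epsilon>) (at_right (0::real))" by (rule eventually_at_right_less)
  ultimately have "eventually (\<lambda>\<epsilon>. (1 + \<epsilon>) * x < 1 \<and> ((1 + \<epsilon>) * x) powr \<gamma> * ((1 + \<epsilon>) * V x) < 1 \<and> 0 < \<epsilon>) (at_right 0)"
    by eventually_elim simp
  then obtain \<epsilon> where \<epsilon>: "(1 + \<epsilon>) * x < 1" "((1 + \<epsilon>) * x) powr \<gamma> * ((1 + \<epsilon>) * V x) < 1" "0 < \<epsilon>"
    using eventually_happens'[OF trivial_limit_at_right_real] by blast
  define y where "y = (1 + \<epsilon>) * x"
  define \<rho> where "\<rho> = y powr \<gamma> * ((1 + \<epsilon>) * V x)"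
  have y: "0 < y" "y < 1" and \<rho>: "0 \<le> \<rho>" "\<rho> < 1"
    using \<epsilon> x0 V0 by (simp_all add: y_def \<rho>_def)
  obtain c where c: "0 \<le> c"
    "\<And>n m. (TT ^^ n) (\<lambda>C. if full k C then 0 else F m C) 0 \<le> ennreal (c * (1 + \<epsilon>) ^ (n + m)) * e n m"
    by (rule not_full_bound[OF \<epsilon>(3), where k = k]) (erule that, blast)
  have bound: "c * (1 + \<epsilon>) ^ (N M + M) * Q (N M) M \<le> c * \<rho> ^ M" if "\<gamma> * real M \<le> real (N M)" for M
  proof -
    have "(1 + \<epsilon>) ^ (N M + M) * Q (N M) M \<le> (1 + \<epsilon>) ^ (N M + M) * (x ^ N M * V x ^ M)"
      using Q_bound[of x "N M" M] x \<epsilon> by (intro mult_left_mono) auto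
    also have "\<dots> = y ^ N M * ((1 + \<epsilon>) * V x) ^ M"
      by (simp add: y_def power_mult_distrib power_add mult_ac)
    also have "y ^ N M = y powr real (N M)" using y by (simp add: powr_realpow)
    also have "y powr real (N M) \<le> y powr (\<gamma> * real M)"
      using y that by (simp add: powr_mono')
    also have "y powr (\<gamma> * real M) = (y powr \<gamma>) ^ M" using y by (simp add: powr_powr[symmetric] powr_realpow)
    also have "(y powr \<gamma>) ^ M * ((1 + \<epsilon>) * V x) ^ M = \<rho> ^ M" by (simp add: \<rho>_def power_mult_distrib)
    finally show ?thesis using c(1) \<epsilon> V0 by (simp add: mult.assoc mult_left_mono)
  qed
  have large: "eventually (\<lambda>M. k \<le> N M) sequentially"
  proof -
    have "eventually (\<lambda>M. nat \<lceil>real k / \<gamma>\<rceil> \<le> M) sequentially" by (rule eventually_ge_at_top)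
    with N show ?thesis
    proof eventually_elim
      case (elim M)
      then have "real k / \<gamma> \<le> real M" by linarith
      then have "real k \<le> \<gamma> * real M" using \<gamma>0 by (simp add: pos_divide_le_eq mult.commute)
      then show ?case using elim by linarith
    qed
  qed
  have "eventually (\<lambda>M. 1 - c * \<rho> ^ M \<le> ?P M \<and> ?P M \<le> 1) sequentially"
    using N large eventually_ge_at_top[of 1]
  proof eventually_elim
    case (elim M)
    have "0 \<le> c * (1 + \<epsilon>) ^ (N M + M)" using c(1) \<epsilon> by simp
    from measure_bound[OF elim(3,2) c(2) this] bound[OF elim(1)] show ?case by linarith
  qed
  then have lower: "eventually (\<lambda>M. 1 - c * \<rho> ^ M \<le> ?P M) sequentially"
    and upper: "eventually (\<lambda>M. ?P M \<le> 1) sequentially"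
    by (auto elim: eventually_mono)
  have "(\<lambda>M. 1 - c * \<rho> ^ M) \<longlonglongrightarrow> 1 - c * 0"
    by (intro tendsto_intros LIMSEQ_realpow_zero \<rho>)
  then show ?thesis
    using tendsto_sandwich[OF lower upper, of 1] by simp
qed

end

theorem theorem1p1:
  fixes s u v a \<gamma> :: real and N :: "nat \<Rightarrow> nat"
  assumes "1 < s"
    and "s < u" and "u < (s + s ^ 3) / 2"
    and "0 < v" and "v < inverse u"
    and "a = inverse v * (u - inverse s) * (u - s) /
             (u * (inverse v - inverse s) * (inverse v - s))"
    and "a < \<gamma>"
    and "\<And>M. 1 \<le> M \<Longrightarrow> 0 < N M"
    and "\<forall>\<^sub>F M in sequentially. \<gamma> * real M \<le> real (N M)"
  shows "0 < a \<and>
    (\<forall>k. (\<lambda>M. measure (path_measure s (N M) M (\<lambda>_. u) (\<lambda>_. v))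
        {\<omega> \<in> path_collections (N M).
           \<forall>i\<in>{1..k}. part (level (N M) \<omega>) (N M - i + 1) = int i})
      \<longlonglongrightarrow> 1)"
proof -
  interpret six_vertex_measure s u v by unfold_locales (fact assms)+
  have "rate = a" unfolding assms(6) by (rule rate_formula)
  then show ?thesis using rate_pos packing_limit[OF _ assms(9)] assms(7) by simp
qed

end
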